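(* Fix $i\in k^\times$ and let $K=k[t]/(t^2+i)$ with its standard involution. The set of isomorphism classes of algebras $\mathcal H_3(K,\Gamma)$, $\Gamma\in GL_3(k)$ diagonal, is in bijection with the set of isomorphism classes of octonion algebras over $k$ containing $K$ as a subalgebra, up to isomorphisms restricting to the identity on $K$ (equivalently, with the orbit space $U_i(k)/Sp_6(k)$).
   Context: $k$ is a field with $\mathrm{char}(k)\neq2,3$. For a composition algebra $C$ over $k$ with conjugation $x\mapsto\bar x$ and diagonal $\Gamma\in GL_3(k)$, $\mathcal H_3(C,\Gamma)=\{X\in M_3(C):\Gamma^{-1}\bar X^t\Gamma=X\}$ with product $X\cdot Y=\tfrac12(XY+YX)$. $U_i(k)$: let $V=k^6$ with basis $e_1,\dots,e_6$, $Sp_6$ the symplectic group of the form with Gram matrix $\begin{pmatrix}0&I_3\\-I_3&0\end{pmatrix}$ acting on $\wedge^3V$, $X\subset\wedge^3V$ the 14-dimensional subrepresentation spanned by $Sp_6\cdot(e_1\wedge e_2\wedge e_3)$, written as $x=(-x_0,-y_0,A,B)$ with $x_0=-x_{123}$, $y_0=-x_{456}$, $A=(x_{423},x_{143},x_{124};x_{523},x_{153},x_{125};x_{623},x_{163},x_{126})$, $B=(x_{156},x_{416},x_{451};x_{256},x_{426},x_{452};x_{356},x_{436},x_{453})$ symmetric (rows separated by semicolons, $x_{ijl}$ the coefficient of $e_i\wedge e_j\wedge e_l$), and $U_i(k)=\{x\in X_k:J(x)=i\}$ with $J(x)=x_0\det B+y_0\det A+\mathrm{tr}(\mathrm{adj}A\,\mathrm{adj}B)-\tfrac14(x_0y_0-\mathrm{tr}(AB))^2$.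 *)

theory Defs
  imports "HOL-Analysis.Finite_Cartesian_Product" "HOL-Library.Product_Plus"
begin

text \<open>An element (a,b) of type 'k \<times> 'k stands for a + b t, where t^2 = -i.
  Addition and zero are componentwise (Product_Plus).\<close>

definition kmul :: "'k::field \<Rightarrow> 'k \<times> 'k \<Rightarrow> 'k \<times> 'k \<Rightarrow> 'k \<times> 'k" where
  "kmul i u v = (fst u * fst v - i * snd u * snd v, fst u * snd v + snd u * fst v)"

definition kconj :: "'k::field \<times> 'k \<Rightarrow> 'k \<times> 'k" where
  "kconj u = (fst u, - snd u)"

definition kscale :: "'k::field \<Rightarrow> 'k \<times> 'k \<Rightarrow> 'k \<times> 'k" where
  "kscale c u = (c * fst u, c * snd u)"

text \<open>3x3 matrices over K are functions nat \<Rightarrow> nat \<Rightarrow> K, indices 0,1,2, zero outside.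
  A diagonal Gamma = diag(g0,g1,g2) in GL_3(k) is given by a triple of nonzero scalars.\<close>

definition gam :: "'k \<times> 'k \<times> 'k \<Rightarrow> nat \<Rightarrow> 'k" where
  "gam g a = (if a = 0 then fst g else if a = 1 then fst (snd g) else snd (snd g))"

definition diag_GL3 :: "('k::field \<times> 'k \<times> 'k) set" where
  "diag_GL3 = {g. fst g \<noteq> 0 \<and> fst (snd g) \<noteq> 0 \<and> snd (snd g) \<noteq> 0}"

text \<open>Gamma^{-1} conj(X)^t Gamma = X, entrywise: g_a^{-1} conj(X_ba) g_b = X_ab.\<close>
definition H3 :: "'k::field \<times> 'k \<times> 'k \<Rightarrow> (nat \<Rightarrow> nat \<Rightarrow> 'k \<times> 'k) set" where
  "H3 g = {X. (\<forall>a b. (3 \<le> a \<or> 3 \<le> b) \<longrightarrow> X a b = 0) \<and>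
              (\<forall>a<3. \<forall>b<3. kscale (inverse (gam g a) * gam g b) (kconj (X b a)) = X a b)}"

definition madd :: "(nat \<Rightarrow> nat \<Rightarrow> 'k::field \<times> 'k) \<Rightarrow> (nat \<Rightarrow> nat \<Rightarrow> 'k \<times> 'k) \<Rightarrow> nat \<Rightarrow> nat \<Rightarrow> 'k \<times> 'k" where
  "madd X Y = (\<lambda>a b. X a b + Y a b)"

definition mscale :: "'k::field \<Rightarrow> (nat \<Rightarrow> nat \<Rightarrow> 'k \<times> 'k) \<Rightarrow> nat \<Rightarrow> nat \<Rightarrow> 'k \<times> 'k" where
  "mscale c X = (\<lambda>a b. kscale c (X a b))"

definition mmul :: "'k::field \<Rightarrow> (nat \<Rightarrow> nat \<Rightarrow> 'k \<times> 'k) \<Rightarrow> (nat \<Rightarrow> nat \<Rightarrow> 'k \<times> 'k) \<Rightarrow> nat \<Rightarrow> nat \<Rightarrow> 'k \<times> 'k" where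
  "mmul i X Y = (\<lambda>a b. \<Sum>m<3. kmul i (X a m) (Y m b))"

definition jprod :: "'k::field \<Rightarrow> (nat \<Rightarrow> nat \<Rightarrow> 'k \<times> 'k) \<Rightarrow> (nat \<Rightarrow> nat \<Rightarrow> 'k \<times> 'k) \<Rightarrow> nat \<Rightarrow> nat \<Rightarrow> 'k \<times> 'k" where
  "jprod i X Y = mscale (1/2) (madd (mmul i X Y) (mmul i Y X))"

definition H3_iso :: "'k::field \<Rightarrow> 'k \<times> 'k \<times> 'k \<Rightarrow> 'k \<times> 'k \<times> 'k \<Rightarrow> bool" where
  "H3_iso i g g' \<longleftrightarrow> (\<exists>\<phi>. bij_betw \<phi> (H3 g) (H3 g') \<and>
     (\<forall>X\<in>H3 g. \<forall>Y\<in>H3 g. \<phi> (madd X Y) = madd (\<phi> X) (\<phi> Y)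
                        \<and> \<phi> (jprod i X Y) = jprod i (\<phi> X) (\<phi> Y)) \<and>
     (\<forall>c. \<forall>X\<in>H3 g. \<phi> (mscale c X) = mscale c (\<phi> X)))"

definition H3_classes :: "'k::field \<Rightarrow> ('k \<times> 'k \<times> 'k) set set" where
  "H3_classes i = diag_GL3 // {(g, g'). g \<in> diag_GL3 \<and> g' \<in> diag_GL3 \<and> H3_iso i g g'}"

text \<open>A k-algebra structure on k^8 is a multiplication map; it is an octonion algebra if it is
  bilinear, unital, and admits a nondegenerate multiplicative quadratic form
  (an 8-dimensional composition algebra).\<close>

definition bilinear_mult :: "('k::field ^'n \<Rightarrow> 'k^'n \<Rightarrow> 'k^'n) \<Rightarrow> bool" where
  "bilinear_mult m \<longleftrightarrow> (\<forall>x y z c.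
      m (x + y) z = m x z + m y z \<and> m z (x + y) = m z x + m z y \<and>
      m (c *s x) z = c *s m x z \<and> m z (c *s x) = c *s m z x)"

definition is_unit_of :: "('a \<Rightarrow> 'a \<Rightarrow> 'a) \<Rightarrow> 'a \<Rightarrow> bool" where
  "is_unit_of m e \<longleftrightarrow> (\<forall>x. m e x = x \<and> m x e = x)"

definition nondeg_quadratic_form :: "('k::field ^'n \<Rightarrow> 'k) \<Rightarrow> bool" where
  "nondeg_quadratic_form N \<longleftrightarrow>
     (\<forall>c x. N (c *s x) = c^2 * N x) \<and>
     (\<forall>x y z c. N (x + y + z) - N (x + y) - N z = (N (x + z) - N x - N z) + (N (y + z) - N y - N z)
              \<and> N (c *s x + z) - N (c *s x) - N z = c * (N (x + z) - N x - N z)) \<and>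
     (\<forall>x. (\<forall>y. N (x + y) - N x - N y = 0) \<longrightarrow> x = 0)"

definition is_octonion_algebra :: "('k::field ^8 \<Rightarrow> 'k^8 \<Rightarrow> 'k^8) \<Rightarrow> bool" where
  "is_octonion_algebra m \<longleftrightarrow> bilinear_mult m \<and> (\<exists>e. is_unit_of m e) \<and>
     (\<exists>N. nondeg_quadratic_form N \<and> (\<forall>x y. N (m x y) = N x * N y))"

definition K_embedding :: "'k::field \<Rightarrow> ('k^8 \<Rightarrow> 'k^8 \<Rightarrow> 'k^8) \<Rightarrow> ('k \<times> 'k \<Rightarrow> 'k^8) \<Rightarrow> bool" where
  "K_embedding i m \<iota> \<longleftrightarrow> inj \<iota> \<and> is_unit_of m (\<iota> (1, 0)) \<and>
     (\<forall>u v. \<iota> (u + v) = \<iota> u + \<iota> v \<and> \<iota> (kmul i u v) = m (\<iota> u) (\<iota> v)) \<and>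
     (\<forall>c u. \<iota> (kscale c u) = c *s \<iota> u)"

definition oct_K :: "'k::field \<Rightarrow> (('k^8 \<Rightarrow> 'k^8 \<Rightarrow> 'k^8) \<times> ('k \<times> 'k \<Rightarrow> 'k^8)) set" where
  "oct_K i = {(m, \<iota>). is_octonion_algebra m \<and> K_embedding i m \<iota>}"

definition oct_K_iso :: "('k::field^8 \<Rightarrow> 'k^8 \<Rightarrow> 'k^8) \<times> ('k \<times> 'k \<Rightarrow> 'k^8)
      \<Rightarrow> ('k^8 \<Rightarrow> 'k^8 \<Rightarrow> 'k^8) \<times> ('k \<times> 'k \<Rightarrow> 'k^8) \<Rightarrow> bool" where
  "oct_K_iso A B \<longleftrightarrow> (\<exists>\<phi>. bij \<phi> \<and>
     (\<forall>x y. \<phi> (x + y) = \<phi> x + \<phi> y \<and> \<phi> (fst A x y) = fst B (\<phi> x) (\<phi> y)) \<and>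
     (\<forall>c x. \<phi> (c *s x) = c *s \<phi> x) \<and>
     (\<forall>u. \<phi> (snd A u) = snd B u))"

definition oct_K_classes :: "'k::field \<Rightarrow> (('k^8 \<Rightarrow> 'k^8 \<Rightarrow> 'k^8) \<times> ('k \<times> 'k \<Rightarrow> 'k^8)) set set" where
  "oct_K_classes i = oct_K i // {(A, B). A \<in> oct_K i \<and> B \<in> oct_K i \<and> oct_K_iso A B}"

text \<open>Elements of \<wedge>^3 k^6 are alternating coefficient functions x i j l (indices 1..6),
  x i j l being the coefficient of e_i \<wedge> e_j \<wedge> e_l (extended alternatingly).
  6x6 matrices are functions nat \<Rightarrow> nat \<Rightarrow> 'k with indices 1..6.\<close>

type_synonym 'k wedge3 = "nat \<Rightarrow> nat \<Rightarrow> nat \<Rightarrow> 'k"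

definition Jsymp :: "nat \<Rightarrow> nat \<Rightarrow> 'k::field" where
  "Jsymp a b = (if a \<in> {1..3} \<and> b = a + 3 then 1 else if a \<in> {4..6} \<and> b + 3 = a then -1 else 0)"

definition Sp6 :: "(nat \<Rightarrow> nat \<Rightarrow> 'k::field) set" where
  "Sp6 = {g. \<forall>a\<in>{1..6}. \<forall>b\<in>{1..6}.
             (\<Sum>p\<in>{1..6}. \<Sum>q\<in>{1..6}. g p a * Jsymp p q * g q b) = Jsymp a b}"

text \<open>Induced action on \<wedge>^3: g(e_i\<wedge>e_j\<wedge>e_l) = ge_i \<wedge> ge_j \<wedge> ge_l.\<close>
definition act3 :: "(nat \<Rightarrow> nat \<Rightarrow> 'k::field) \<Rightarrow> 'k wedge3 \<Rightarrow> 'k wedge3" where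
  "act3 g x = (\<lambda>a b c. if a \<in> {1..6} \<and> b \<in> {1..6} \<and> c \<in> {1..6} then
      (\<Sum>p\<in>{1..6}. \<Sum>q\<in>{1..6}. \<Sum>r\<in>{1..6}. g a p * g b q * g c r * x p q r) else 0)"

definition kd :: "nat \<Rightarrow> nat \<Rightarrow> 'k::field" where
  "kd a b = (if a = b then 1 else 0)"

definition e123 :: "'k::field wedge3" where
  "e123 = (\<lambda>p q r. kd p 1 * (kd q 2 * kd r 3 - kd q 3 * kd r 2)
                 - kd p 2 * (kd q 1 * kd r 3 - kd q 3 * kd r 1)
                 + kd p 3 * (kd q 1 * kd r 2 - kd q 2 * kd r 1))"

definition Xk :: "'k::field wedge3 set" where
  "Xk = {(\<lambda>p q r. \<Sum>s<n. c s * v s p q r) | (n::nat) (c::nat \<Rightarrow> 'k) (v::nat \<Rightarrow> 'k wedge3).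
          \<forall>s<n. \<exists>g\<in>(Sp6::(nat \<Rightarrow> nat \<Rightarrow> 'k) set). v s = act3 g e123}"

definition det3 :: "(nat \<Rightarrow> nat \<Rightarrow> 'k::field) \<Rightarrow> 'k" where
  "det3 M = M 0 0 * (M 1 1 * M 2 2 - M 1 2 * M 2 1)
          - M 0 1 * (M 1 0 * M 2 2 - M 1 2 * M 2 0)
          + M 0 2 * (M 1 0 * M 2 1 - M 1 1 * M 2 0)"

definition adj3 :: "(nat \<Rightarrow> nat \<Rightarrow> 'k::field) \<Rightarrow> nat \<Rightarrow> nat \<Rightarrow> 'k" where
  "adj3 M i j = M ((j+1) mod 3) ((i+1) mod 3) * M ((j+2) mod 3) ((i+2) mod 3)
              - M ((j+1) mod 3) ((i+2) mod 3) * M ((j+2) mod 3) ((i+1) mod 3)"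

definition tr_prod3 :: "(nat \<Rightarrow> nat \<Rightarrow> 'k::field) \<Rightarrow> (nat \<Rightarrow> nat \<Rightarrow> 'k) \<Rightarrow> 'k" where
  "tr_prod3 M N = (\<Sum>a<3. \<Sum>b<3. M a b * N b a)"

definition mat3 :: "'k \<Rightarrow> 'k \<Rightarrow> 'k \<Rightarrow> 'k \<Rightarrow> 'k \<Rightarrow> 'k \<Rightarrow> 'k \<Rightarrow> 'k \<Rightarrow> 'k \<Rightarrow> nat \<Rightarrow> nat \<Rightarrow> 'k" where
  "mat3 a00 a01 a02 a10 a11 a12 a20 a21 a22 = (\<lambda>r c.
     if r = 0 then (if c = 0 then a00 else if c = 1 then a01 else a02)
     else if r = 1 then (if c = 0 then a10 else if c = 1 then a11 else a12)
     else (if c = 0 then a20 else if c = 1 then a21 else a22))"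

definition x0c :: "'k::field wedge3 \<Rightarrow> 'k" where "x0c x = - x 1 2 3"
definition y0c :: "'k::field wedge3 \<Rightarrow> 'k" where "y0c x = - x 4 5 6"
definition Ac :: "'k::field wedge3 \<Rightarrow> nat \<Rightarrow> nat \<Rightarrow> 'k" where
  "Ac x = mat3 (x 4 2 3) (x 1 4 3) (x 1 2 4)
              (x 5 2 3) (x 1 5 3) (x 1 2 5)
              (x 6 2 3) (x 1 6 3) (x 1 2 6)"
definition Bc :: "'k::field wedge3 \<Rightarrow> nat \<Rightarrow> nat \<Rightarrow> 'k" where
  "Bc x = mat3 (x 1 5 6) (x 4 1 6) (x 4 5 1)
              (x 2 5 6) (x 4 2 6) (x 4 5 2)
              (x 3 5 6) (x 4 3 6) (x 4 5 3)"

definition Jq :: "'k::field wedge3 \<Rightarrow> 'k" where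
  "Jq x = x0c x * det3 (Bc x) + y0c x * det3 (Ac x) + tr_prod3 (adj3 (Ac x)) (adj3 (Bc x))
          - (1/4) * (x0c x * y0c x - tr_prod3 (Ac x) (Bc x))^2"

definition Ui :: "'k::field \<Rightarrow> 'k wedge3 set" where
  "Ui i = {x \<in> Xk. Jq x = i}"

definition Ui_orbits :: "'k::field \<Rightarrow> 'k wedge3 set set" where
  "Ui_orbits i = Ui i // {(x, y). x \<in> Ui i \<and> y \<in> Ui i \<and> (\<exists>g\<in>Sp6. act3 g x = y)}"

end

theory Submission
  imports Defs "HOL-Analysis.Cartesian_Space" "HOL-Library.Function_Algebras"
begin

text \<open>All three sets classify the ternary hermitian forms \<open>\<langle>a, b, ab\<rangle>\<close> over K up to isometry, and
  \<open>\<langle>a, b, ab\<rangle>\<close> is isometric to \<open>\<langle>a', b', a'b'\<rangle>\<close> as soon as it represents \<open>a'\<close> and \<open>b'\<close> on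
  orthogonal vectors, the third vector being a cross product. An isomorphism of the Jordan algebras
  carries the diagonal frame to orthogonal rank-one idempotents, that is, to an orthogonal basis, and the
  Peirce spaces recover the form up to a scalar, which the cross product identifies. In an octonion
  algebra the form lives on the orthogonal complement of K, and Cayley--Dickson doubling rebuilds the
  algebra from two orthogonal vectors. A trivector x with \<open>J(x) = i\<close> gives \<open>k\<^sup>6\<close> a K-structure T with
  \<open>T\<^sup>2 = - 16 i\<close>, for which x is the real part of a K-trilinear alternating form; an orthogonal
  K-basis then brings x into a normal form depending only on \<open>(a, b)\<close>.\<close>

section \<open>Quotients and hermitian forms\<close>

text \<open>The relation \<open>represents\<close> is the common meeting point: each of the three
  settings is compared with it and never directly with another. A Jordan algebra sees a hermitian
  form only up to a scalar. Replacing \<Gamma> by det(\<Gamma>) \<Gamma> removes the ambiguity,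
  because rescaling \<Gamma> by c multiplies the new form by the fourth power of c, which is an
  isometry class preserving change. The new form is <a, b, ab> with a = g1 g2 and b = g0 g2, up to
  squares in the first two entries. The obstacle is that K may be split, for instance when i = -1:
  nonzero elements of K can be zero divisors and nonzero vectors can be isotropic. So the arguments
  choose vectors with nonzero value and divide by that value in k, never by an element of K, and
  rank arguments over K are carried out over k. On trivectors Q is -4 times the real part of the
  hermitian form, so T / 4 plays the role of t. This is the origin of the constants 4 and 16
  there.\<close>

lemma ex_bij_betw_quotients:
  assumes r: "equiv A r" and s: "equiv B s"
    and F: "\<And>a. a \<in> A \<Longrightarrow> F a \<in> B"
    and rel: "\<And>a a'. a \<in> A \<Longrightarrow> a' \<in> A \<Longrightarrow> (a, a') \<in> r \<longleftrightarrow> (F a, F a') \<in> s"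
    and onto: "\<And>b. b \<in> B \<Longrightarrow> \<exists>a\<in>A. (F a, b) \<in> s"
  shows "\<exists>f. bij_betw f (A // r) (B // s)"
proof -
  define f where "f X = s `` (F ` X)" for X
  have f_class: "f (r `` {a}) = s `` {F a}" if a: "a \<in> A" for a
  proof -
    have "s `` {F a'} = s `` {F a}" if "a' \<in> r `` {a}" for a'
      using that rel[OF a] s r a equiv_class_eq[OF s] unfolding equiv_def refl_on_def
      by (metis (no_types, lifting) Image_singleton_iff equiv_class_eq_iff r)
    moreover have "a \<in> r `` {a}" using equiv_class_self[OF r a] .
    ultimately show ?thesis unfolding f_def by blast
  qed
  have "inj_on f (A // r)"
  proof (rule inj_onI)
    fix X Y assume X: "X \<in> A // r" and Y: "Y \<in> A // r" and e: "f X = f Y"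
    obtain a b where a: "a \<in> A" "X = r `` {a}" and b: "b \<in> A" "Y = r `` {b}"
      using X Y by (auto elim!: quotientE)
    have "s `` {F a} = s `` {F b}" using e f_class a b by simp
    then have "(F a, F b) \<in> s" using s F[OF b(1)] by (simp add: eq_equiv_class)
    then have "(a, b) \<in> r" using rel a b by blast
    then show "X = Y" using a b r by (simp add: equiv_class_eq)
  qed
  moreover have "f ` (A // r) = B // s"
  proof (intro equalityI subsetI)
    fix Z assume "Z \<in> f ` (A // r)"
    then show "Z \<in> B // s" using f_class F by (auto elim!: quotientE intro!: quotientI)
  next
    fix Z assume "Z \<in> B // s"
    then obtain b where b: "b \<in> B" "Z = s `` {b}" by (auto elim!: quotientE)
    obtain a where a: "a \<in> A" "(F a, b) \<in> s" using onto b by blast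
    then have "Z = f (r `` {a})" using b f_class equiv_class_eq[OF s] by simp
    then show "Z \<in> f ` (A // r)" using a by (auto intro: quotientI)
  qed
  ultimately show ?thesis unfolding bij_betw_def by blast
qed

text \<open>Any enumeration of \<open>S\<close> by a type with equally many elements turns the
  function into a genuine square matrix, where one-sided inverses are two-sided. It serves
  symplectic inverses, matrices over K, and a rank count.\<close>

lemma fun_matrix_left_right_inverse:
  fixes A B :: "nat \<Rightarrow> nat \<Rightarrow> 'k::field"
  assumes S: "finite S" "card S = CARD('n::finite)"
    and AB: "\<And>a c. a \<in> S \<Longrightarrow> c \<in> S \<Longrightarrow> (\<Sum>b\<in>S. A a b * B b c) = (if a = c then 1 else 0)"
    and ac: "a \<in> S" "c \<in> S"
  shows "(\<Sum>b\<in>S. B a b * A b c) = (if a = c then 1 else 0)"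
proof -
  obtain f where f: "bij_betw f (UNIV::'n set) S"
    using S by (metis finite_class.finite_UNIV finite_same_card_bij)
  define A' :: "'k^'n^'n" where "A' = (\<chi> a b. A (f a) (f b))"
  define B' :: "'k^'n^'n" where "B' = (\<chi> a b. B (f a) (f b))"
  have inj: "f p = f q \<longleftrightarrow> p = q" for p q
    using f by (auto simp: bij_betw_def dest: injD)
  have re: "(\<Sum>b\<in>UNIV. X (f b)) = (\<Sum>b\<in>S. X b)" for X :: "nat \<Rightarrow> 'k"
    using sum.reindex_bij_betw[OF f, of X] by simp
  have fS: "f p \<in> S" for p using f by (auto simp: bij_betw_def)
  have "A' ** B' = mat 1"
    unfolding matrix_matrix_mult_def mat_def A'_def B'_def
    using re[of "\<lambda>b. A (f p) b * B b (f q)" for p q] by (simp add: vec_eq_iff AB fS inj)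
  then have BA: "B' ** A' = mat 1" using matrix_left_right_inverse by blast
  obtain p q where pq: "a = f p" "c = f q" using f ac by (auto simp: bij_betw_def)
  have "(B' ** A') $ p $ q = (\<Sum>b\<in>S. B a b * A b c)"
    unfolding matrix_matrix_mult_def A'_def B'_def pq by (simp add: re[of "\<lambda>b. B (f p) b * A b (f q)"])
  then show ?thesis using BA pq inj by (simp add: mat_def)
qed

lemma sum3: "(\<Sum>a<3::nat. f a) = f 0 + f 1 + f 2"
  by (simp add: eval_nat_numeral One_nat_def)

text \<open>The diagonal hermitian form \<open>\<Sum> d\<^sub>j u\<^sub>j conj(v\<^sub>j)\<close> over K is \<open>hre + him t\<close>.\<close>

definition hre :: "'k::field \<Rightarrow> 'k \<times> 'k \<times> 'k \<Rightarrow> (nat \<Rightarrow> 'k \<times> 'k) \<Rightarrow> (nat \<Rightarrow> 'k \<times> 'k) \<Rightarrow> 'k" where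
  "hre i d u v = (\<Sum>j<3. gam d j * (fst (u j) * fst (v j) + i * snd (u j) * snd (v j)))"

definition him :: "'k::field \<times> 'k \<times> 'k \<Rightarrow> (nat \<Rightarrow> 'k \<times> 'k) \<Rightarrow> (nat \<Rightarrow> 'k \<times> 'k) \<Rightarrow> 'k" where
  "him d u v = (\<Sum>j<3. gam d j * (snd (u j) * fst (v j) - fst (u j) * snd (v j)))"

text \<open>Two orthogonal vectors suffice for an isometry with the second form: their cross product
  is orthogonal to both and has the product of their values. The asymmetric formulation is the one
  that each setting can deliver directly.\<close>

definition represents :: "'k::field \<Rightarrow> 'k \<times> 'k \<Rightarrow> 'k \<times> 'k \<Rightarrow> bool" where
  "represents i p p' \<longleftrightarrow> (\<exists>u v. let d = (fst p, snd p, fst p * snd p) in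
     hre i d u u = fst p' \<and> hre i d v v = snd p' \<and> hre i d u v = 0 \<and> him d u v = 0)"

section \<open>Composition algebras and Cayley--Dickson doubling\<close>

locale composition_algebra =
  fixes m :: "'k::field ^ 'n \<Rightarrow> 'k ^ 'n \<Rightarrow> 'k ^ 'n" (infixl "\<cdot>" 70)
    and N :: "'k ^ 'n \<Rightarrow> 'k" and e :: "'k ^ 'n"
  assumes two: "(2::'k) \<noteq> 0"
    and bilin: "bilinear_mult m" and unit: "is_unit_of m e"
    and nondeg: "nondeg_quadratic_form N" and N_mult: "N (x \<cdot> y) = N x * N y"
begin

definition B :: "'k ^ 'n \<Rightarrow> 'k ^ 'n \<Rightarrow> 'k" where
  "B x y = N (x + y) - N x - N y"

definition cj :: "'k ^ 'n \<Rightarrow> 'k ^ 'n" where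
  "cj x = B x e *s e - x"

lemma m_add: "(x + y) \<cdot> z = x \<cdot> z + y \<cdot> z" "z \<cdot> (x + y) = z \<cdot> x + z \<cdot> y"
  and m_scale: "(c *s x) \<cdot> z = c *s (x \<cdot> z)" "z \<cdot> (c *s x) = c *s (z \<cdot> x)"
  using bilin unfolding bilinear_mult_def by blast+

lemma m_minus: "(- x) \<cdot> z = - (x \<cdot> z)" "z \<cdot> (- x) = - (z \<cdot> x)"
  using m_scale(1)[of "- 1" x z] m_scale(2)[of z "- 1" x] by (simp_all add: vector_sneg_minus1[symmetric])

lemma m_diff: "(x - y) \<cdot> z = x \<cdot> z - y \<cdot> z" "z \<cdot> (x - y) = z \<cdot> x - z \<cdot> y"
  using m_add[of x "- y" z] m_add(2)[of z x "- y"] by (simp_all add: m_minus)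

lemma m_unit: "e \<cdot> x = x" "x \<cdot> e = x"
  using unit unfolding is_unit_of_def by blast+

lemma N_scale: "N (c *s x) = c\<^sup>2 * N x"
  using nondeg unfolding nondeg_quadratic_form_def by blast

lemma B_add1: "B (x + y) z = B x z + B y z"
  using nondeg unfolding nondeg_quadratic_form_def B_def by blast

lemma B_scale1: "B (c *s x) z = c * B x z"
  using nondeg unfolding nondeg_quadratic_form_def B_def by blast

lemma B_sym: "B x y = B y x"
  unfolding B_def by (simp add: add.commute)

lemma B_add2: "B z (x + y) = B z x + B z y" and B_scale2: "B z (c *s x) = c * B z x"
  by (simp_all only: B_sym[of z] B_add1 B_scale1)

lemma B_minus: "B (- x) z = - B x z" "B z (- x) = - B z x"
  using B_scale1[of "- 1" x z] B_scale2[of z "- 1" x] by (simp_all add: vector_sneg_minus1[symmetric])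

lemma B_diff: "B (x - y) z = B x z - B y z" "B z (x - y) = B z x - B z y"
  using B_add1[of x "- y" z] B_add2[of z x "- y"] by (simp_all add: B_minus)

lemmas B_lin = B_add1 B_add2 B_scale1 B_scale2 B_minus B_diff

lemma B_zero: "B 0 x = 0" "B x 0 = 0"
  using B_scale1[of 0 0 x] B_scale2[of x 0 0] by simp_all

lemma N_zero: "N 0 = 0"
  using N_scale[of 0 0] by simp

lemma B_self: "B x x = 2 * N x"
proof -
  have "x + x = 2 *s x" by (simp add: vec_eq_iff)
  then have "N (x + x) = 4 * N x" using N_scale[of 2 x] by simp
  then show ?thesis unfolding B_def by simp
qed

lemma B_nondeg: assumes "\<And>y. B x y = 0" shows "x = 0"
  using assms nondeg unfolding nondeg_quadratic_form_def B_def by blast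

lemma B_eqI: assumes "\<And>z. B x z = B y z" shows "x = y"
  using B_nondeg[of "x - y"] assms by (simp add: B_diff)

lemma N_add: "N (x + y) = N x + N y + B x y"
  unfolding B_def by simp

lemma B_mult_left: "B (x \<cdot> y) (x \<cdot> z) = N x * B y z"
  unfolding B_def m_add[symmetric] N_mult by (simp add: algebra_simps)

lemma B_mult_right: "B (x \<cdot> z) (y \<cdot> z) = B x y * N z"
  unfolding B_def m_add[symmetric] N_mult by (simp add: algebra_simps)

lemma B_exchange: "B (x \<cdot> y) (z \<cdot> w) + B (z \<cdot> y) (x \<cdot> w) = B x z * B y w"
proof -
  have "B ((x + z) \<cdot> y) ((x + z) \<cdot> w) = (N x + N z + B x z) * B y w"
    unfolding B_mult_left N_add ..
  then show ?thesis
    unfolding m_add B_add1 B_add2 B_mult_left by (simp add: algebra_simps)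
qed

lemma N_unit: "N e = 1"
proof -
  obtain x where "N x \<noteq> 0"
  proof (rule ccontr)
    assume "\<not> thesis"
    then have "N x = 0" for x using that by blast
    then have "(x :: 'k ^ 'n) = 0" for x using B_nondeg unfolding B_def by simp
    from this[of "1"] show False by (simp add: vec_eq_iff)
  qed
  then show ?thesis using N_mult[of e x] by (simp add: m_unit)
qed

text \<open>Putting the unit into \<open>B_exchange\<close> makes multiplication by
  \<open>cj x\<close> adjoint to multiplication by \<open>x\<close>. Moving factors across
  \<open>B\<close> and comparing by nondegeneracy then replaces associativity.\<close>

lemma B_move_left: "B (x \<cdot> y) z = B y (cj x \<cdot> z)"
  using B_exchange[of x y e z] unfolding cj_def m_diff m_scale m_unit B_lin
  by (simp add: algebra_simps)

lemma B_move_right: "B (x \<cdot> y) z = B x (z \<cdot> cj y)"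
  using B_exchange[of x y z e] unfolding cj_def m_diff m_scale m_unit B_lin
  by (simp add: algebra_simps B_sym)

lemma cj_cj: "cj (cj x) = x"
proof -
  have "B e e = 2" using B_self[of e] N_unit by simp
  then show ?thesis unfolding cj_def B_lin by (simp add: vec_eq_iff algebra_simps)
qed

lemma B_cj: "B (cj x) y = B x (cj y)"
  unfolding cj_def B_lin by (simp add: B_sym)

lemma cj_mult: "cj (x \<cdot> y) = cj y \<cdot> cj x"
proof (rule B_eqI)
  fix z
  have "B (cj y \<cdot> cj x) z = B (cj x) (y \<cdot> z)" by (simp add: B_move_left cj_cj)
  also have "\<dots> = B (cj x \<cdot> cj z) y" by (simp add: B_move_right cj_cj)
  also have "\<dots> = B (cj z) (x \<cdot> y)" by (simp add: B_move_left cj_cj)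
  also have "\<dots> = B (cj (x \<cdot> y)) z" by (simp only: B_cj B_sym[of z])
  finally show "B (cj (x \<cdot> y)) z = B (cj y \<cdot> cj x) z" by simp
qed

lemma cj_mult_cancel: "cj x \<cdot> (x \<cdot> y) = N x *s y"
proof (rule B_eqI)
  fix z
  have "B (cj x \<cdot> (x \<cdot> y)) z = B (x \<cdot> y) (x \<cdot> z)" by (simp add: B_move_left cj_cj)
  then show "B (cj x \<cdot> (x \<cdot> y)) z = B (N x *s y) z" by (simp add: B_mult_left B_lin)
qed

lemma mult_cj_cancel: "(y \<cdot> x) \<cdot> cj x = N x *s y"
proof (rule B_eqI)
  fix z
  have "B ((y \<cdot> x) \<cdot> cj x) z = B (y \<cdot> x) (z \<cdot> x)" by (simp add: B_move_right cj_cj)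
  then show "B ((y \<cdot> x) \<cdot> cj x) z = B (N x *s y) z" by (simp add: B_mult_right B_lin)
qed

lemma cj_add: "cj (x + y) = cj x + cj y"
  unfolding cj_def B_lin by (simp add: vec.scale_left_distrib)

lemma cj_mult_cancel2: "cj x \<cdot> (z \<cdot> y) + cj z \<cdot> (x \<cdot> y) = B x z *s y"
  using cj_mult_cancel[of "x + z" y]
  unfolding cj_add m_add N_add cj_mult_cancel vec.scale_left_distrib by (simp add: algebra_simps)

lemma mult_cj_cancel2: "(y \<cdot> z) \<cdot> cj x + (y \<cdot> x) \<cdot> cj z = B x z *s y"
  using mult_cj_cancel[of y "x + z"]
  unfolding cj_add m_add N_add mult_cj_cancel vec.scale_left_distrib by (simp add: algebra_simps)

lemma square: "x \<cdot> x = B x e *s x - N x *s e"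
proof -
  have "cj x \<cdot> (x \<cdot> e) = N x *s e" by (rule cj_mult_cancel)
  then show ?thesis unfolding cj_def m_unit m_diff m_scale by (simp add: algebra_simps)
qed

text \<open>For v orthogonal to the unital subalgebra generated by x and y,
  the products of elements x and y v are determined by the products inside the subalgebra.\<close>

context
  fixes v assumes ve: "B e v = 0"
begin

lemma cj_perp: "cj v = - v"
  unfolding cj_def using ve B_sym[of v e] by simp

text \<open>\<open>mult_cj_cancel2\<close> at \<open>cj x\<close> and \<open>v\<close> has
  right-hand side 0, since \<open>B (cj x) v = - B x v\<close>; its two terms are the two sides
  here, with the sign supplied by \<open>cj v = - v\<close>.\<close>

lemma double_right: "B x v = 0 \<Longrightarrow> (y \<cdot> v) \<cdot> x = (y \<cdot> cj x) \<cdot> v"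
  using mult_cj_cancel2[of y v "cj x"] B_cj[of x v] 
  by (simp add: cj_perp cj_cj B_lin m_minus)

lemma double_left_aux: "B x v = 0 \<Longrightarrow> cj x \<cdot> (v \<cdot> y) = v \<cdot> (x \<cdot> y)"
  using cj_mult_cancel2[of x v y] by (simp add: cj_perp m_minus)

lemma double_comm: "B x v = 0 \<Longrightarrow> v \<cdot> x = cj x \<cdot> v"
  using double_right[of x e] by (simp add: m_unit)

text \<open>Writing \<open>y \<cdot> v\<close> as \<open>v \<cdot> cj y\<close> exposes
  \<open>v\<close> to \<open>double_left_aux\<close>. The third hypothesis is what allows
  \<open>v \<cdot> cj (y \<cdot> x)\<close> to be turned back.\<close>

lemma double_left:
  assumes "B x v = 0" "B y v = 0" "B (y \<cdot> x) v = 0"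
  shows "x \<cdot> (y \<cdot> v) = (y \<cdot> x) \<cdot> v"
proof -
  have c: "B (cj z) v = 0" if "B z v = 0" for z
    using that by (simp add: B_cj cj_perp B_lin)
  have "x \<cdot> (y \<cdot> v) = cj (cj x) \<cdot> (v \<cdot> cj y)"
    using double_comm[OF c[OF assms(2)]] by (simp add: cj_cj)
  also have "\<dots> = v \<cdot> cj (y \<cdot> x)"
    unfolding double_left_aux[OF c[OF assms(1)]] cj_mult ..
  also have "\<dots> = (y \<cdot> x) \<cdot> v"
    using double_comm[OF c[OF assms(3)]] by (simp add: cj_cj)
  finally show ?thesis .
qed

text \<open>Moving \<open>y \<cdot> v\<close> across \<open>B\<close> produces
  \<open>z \<cdot> (y \<cdot> v)\<close> with \<open>z\<close> arbitrary, to which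
  \<open>double_left\<close> does not apply. \<open>B_exchange\<close> trades \<open>z\<close> for
  \<open>x\<close>, after which it does.\<close>

lemma double_both:
  assumes "B x v = 0" "B y v = 0" "B (y \<cdot> x) v = 0"
  shows "(x \<cdot> v) \<cdot> (y \<cdot> v) = - (N v *s (cj y \<cdot> x))"
proof (rule B_eqI)
  fix z
  have "B (y \<cdot> v) e = 0"
    using B_move_left[of y v e] B_cj[of v y] assms(2) B_sym[of v y] by (simp add: m_unit cj_perp B_lin)
  then have cy: "cj (y \<cdot> v) = - (y \<cdot> v)" unfolding cj_def by simp
  have "B ((x \<cdot> v) \<cdot> (y \<cdot> v)) z = - B (x \<cdot> v) (z \<cdot> (y \<cdot> v))"
    unfolding B_move_right[of "x \<cdot> v"] cy by (simp add: m_minus B_lin)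
  also have "B (x \<cdot> v) (z \<cdot> (y \<cdot> v)) = B x z * B v (y \<cdot> v) - B (z \<cdot> v) (x \<cdot> (y \<cdot> v))"
    using B_exchange[of x v z "y \<cdot> v"] by (simp add: algebra_simps)
  also have "B v (y \<cdot> v) = B e y * N v"
    using B_mult_right[of e v y] by (simp add: m_unit)
  also have "B (z \<cdot> v) (x \<cdot> (y \<cdot> v)) = B (y \<cdot> x) z * N v"
    unfolding double_left[OF assms] B_mult_right by (simp add: B_sym)
  finally show "B ((x \<cdot> v) \<cdot> (y \<cdot> v)) z = B (- (N v *s (cj y \<cdot> x))) z"
    unfolding cj_def m_diff m_scale m_unit B_lin by (simp add: algebra_simps B_sym)
qed

end

end

section \<open>Quaternions and octonions over K in coordinates\<close>

type_synonym 'k quat = "('k \<times> 'k) \<times> ('k \<times> 'k)"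

definition knorm :: "'k::field \<Rightarrow> 'k \<times> 'k \<Rightarrow> 'k" where
  "knorm i u = (fst u)\<^sup>2 + i * (snd u)\<^sup>2"

text \<open>The pair (u, w) stands for u + w v with v orthogonal to K and v v = - a. The order of
  the factors does not matter over the commutative K, but it is the order found in
  \<open>double_left\<close>, \<open>double_right\<close> and \<open>double_both\<close>, so
  \<open>omul\<close> can repeat the same pattern.\<close>

definition qmul :: "'k::field \<Rightarrow> 'k \<Rightarrow> 'k quat \<Rightarrow> 'k quat \<Rightarrow> 'k quat" where
  "qmul i a X Y = (kmul i (fst X) (fst Y) - kscale a (kmul i (kconj (snd Y)) (snd X)),
     kmul i (snd Y) (fst X) + kmul i (snd X) (kconj (fst Y)))"

definition qconj :: "'k::field quat \<Rightarrow> 'k quat" where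
  "qconj X = (kconj (fst X), - snd X)"

definition qscale :: "'k::field \<Rightarrow> 'k quat \<Rightarrow> 'k quat" where
  "qscale c X = (kscale c (fst X), kscale c (snd X))"

definition omul :: "'k::field \<Rightarrow> 'k \<Rightarrow> 'k \<Rightarrow> 'k quat \<times> 'k quat \<Rightarrow> 'k quat \<times> 'k quat \<Rightarrow> 'k quat \<times> 'k quat" where
  "omul i a b X Y = (qmul i a (fst X) (fst Y) - qscale b (qmul i a (qconj (snd Y)) (snd X)),
     qmul i a (snd Y) (fst X) + qmul i a (snd X) (qconj (fst Y)))"

definition onorm :: "'k::field \<Rightarrow> 'k \<Rightarrow> 'k \<Rightarrow> 'k quat \<times> 'k quat \<Rightarrow> 'k" where
  "onorm i a b X = knorm i (fst (fst X)) + a * knorm i (snd (fst X))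
     + b * (knorm i (fst (snd X)) + a * knorm i (snd (snd X)))"

definition qnorm :: "'k::field \<Rightarrow> 'k \<Rightarrow> 'k quat \<Rightarrow> 'k" where
  "qnorm i a X = knorm i (fst X) + a * knorm i (snd X)"

definition qpolar :: "'k::field \<Rightarrow> 'k \<Rightarrow> 'k quat \<Rightarrow> 'k quat \<Rightarrow> 'k" where
  "qpolar i a X Y = 2 * (fst (fst X) * fst (fst Y) + i * snd (fst X) * snd (fst Y)
     + a * (fst (snd X) * fst (snd Y) + i * snd (snd X) * snd (snd Y)))"

lemmas quat_defs = qnorm_def qpolar_def qmul_def qconj_def qscale_def kmul_def kconj_def kscale_def knorm_def
    fst_conv snd_conv plus_prod_def minus_prod_def uminus_prod_def

lemma qnorm_qmul: "qnorm i a (qmul i a X Y) = qnorm i a X * qnorm i a Y"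
  unfolding quat_defs by algebra

lemma qnorm_qconj: "qnorm i a (qconj X) = qnorm i a X"
  unfolding quat_defs by algebra

lemma qnorm_add: "qnorm i a (X + Y) = qnorm i a X + qnorm i a Y + qpolar i a X Y"
  unfolding quat_defs by algebra

lemma qnorm_diff_scale: "qnorm i a (X - qscale b Y) = qnorm i a X + b\<^sup>2 * qnorm i a Y - b * qpolar i a X Y"
  unfolding quat_defs by algebra

text \<open>In the norm of an octonion product the two mixed terms are these two sides with opposite
  signs. Moving factors from one side to the other rests on associativity, so the cancellation is
  special to doubling quaternions.\<close>

lemma qpolar_exchange:
  "qpolar i a (qmul i a X Z) (qmul i a (qconj W) Y) = qpolar i a (qmul i a W X) (qmul i a Y (qconj Z))"
  unfolding quat_defs by (simp add: algebra_simps)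

lemma onorm_omul: "onorm i a b (omul i a b X Y) = onorm i a b X * onorm i a b Y"
proof -
  have o: "onorm i a b Z = qnorm i a (fst Z) + b * qnorm i a (snd Z)" for Z
    unfolding onorm_def qnorm_def ..
  show ?thesis
    unfolding o omul_def fst_conv snd_conv qnorm_diff_scale qnorm_add qnorm_qmul qnorm_qconj
      qpolar_exchange by algebra
qed

definition pr8 :: "'k ^ 8 \<Rightarrow> 'k quat \<times> 'k quat" where
  "pr8 x = (((x $ 1, x $ 2), (x $ 3, x $ 4)), ((x $ 5, x $ 6), (x $ 7, x $ 8)))"

definition emb8 :: "'k quat \<times> 'k quat \<Rightarrow> 'k ^ 8" where
  "emb8 X = (\<chi> j. if j = 1 then fst (fst (fst X)) else if j = 2 then snd (fst (fst X))
     else if j = 3 then fst (snd (fst X)) else if j = 4 then snd (snd (fst X))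
     else if j = 5 then fst (fst (snd X)) else if j = 6 then snd (fst (snd X))
     else if j = 7 then fst (snd (snd X)) else snd (snd (snd X)))"

lemma exhaust_8: "(j :: 8) = 1 \<or> j = 2 \<or> j = 3 \<or> j = 4 \<or> j = 5 \<or> j = 6 \<or> j = 7 \<or> j = 8"
proof (induct j)
  case (of_int z)
  then have "0 \<le> z" and "z < 8" by simp_all
  \<comment> \<open>In the index type 8 the numeral 8 is 0, so the case \<open>z = 0\<close> is the
    index 8.\<close>
  then have "z = 0 \<or> z = 1 \<or> z = 2 \<or> z = 3 \<or> z = 4 \<or> z = 5 \<or> z = 6 \<or> z = 7" by arith
  then show ?case by auto
qed

lemma pr8_emb8: "pr8 (emb8 X) = X"
  unfolding pr8_def emb8_def by (simp add: prod_eq_iff)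

lemma pr8_eqI: "pr8 x = pr8 y \<Longrightarrow> x = y"
proof (rule iffD2[OF vec_eq_iff], rule allI)
  fix j assume "pr8 x = pr8 y"
  then show "x $ j = y $ j"
    using exhaust_8[of j] unfolding pr8_def by (elim disjE) simp_all
qed

lemma emb8_pr8: "emb8 (pr8 x) = x"
  by (rule pr8_eqI) (rule pr8_emb8)

definition oscale :: "'k::field \<Rightarrow> 'k quat \<times> 'k quat \<Rightarrow> 'k quat \<times> 'k quat" where
  "oscale c X = (qscale c (fst X), qscale c (snd X))"

lemma pr8_lin: "pr8 (x + y) = pr8 x + pr8 y" "pr8 (c *s x) = oscale c (pr8 x)"
  unfolding pr8_def oscale_def qscale_def kscale_def by simp_all

lemma emb8_lin: "emb8 (X + Y) = emb8 X + emb8 Y" "emb8 (oscale c X) = c *s emb8 X"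
  by (rule pr8_eqI, simp add: pr8_emb8 pr8_lin)+

definition cd_mult :: "'k::field \<Rightarrow> 'k \<times> 'k \<Rightarrow> 'k ^ 8 \<Rightarrow> 'k ^ 8 \<Rightarrow> 'k ^ 8" where
  "cd_mult i p x y = emb8 (omul i (fst p) (snd p) (pr8 x) (pr8 y))"

definition cd_embed :: "'k::field \<times> 'k \<Rightarrow> 'k ^ 8" where
  "cd_embed u = emb8 ((u, 0), 0)"

definition cd_norm :: "'k::field \<Rightarrow> 'k \<times> 'k \<Rightarrow> 'k ^ 8 \<Rightarrow> 'k" where
  "cd_norm i p x = onorm i (fst p) (snd p) (pr8 x)"

lemma omul_lin:
  "omul i a b (X + Y) Z = omul i a b X Z + omul i a b Y Z"
  "omul i a b Z (X + Y) = omul i a b Z X + omul i a b Z Y"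
  "omul i a b (oscale c X) Z = oscale c (omul i a b X Z)"
  "omul i a b Z (oscale c X) = oscale c (omul i a b Z X)"
  unfolding omul_def qmul_def qconj_def qscale_def oscale_def kmul_def kconj_def kscale_def
  by (simp_all add: prod_eq_iff algebra_simps)

lemma cd_mult_bilinear: "bilinear_mult (cd_mult i p)"
  unfolding bilinear_mult_def cd_mult_def
  by (simp add: pr8_lin omul_lin emb8_lin)

lemma cd_mult_unit: "is_unit_of (cd_mult i p) (cd_embed (1, 0))"
  unfolding is_unit_of_def
proof (intro allI conjI)
  fix x
  have "omul i (fst p) (snd p) ((((1, 0), 0), 0)) X = X" "omul i (fst p) (snd p) X (((1, 0), 0), 0) = X" for X
    unfolding omul_def qmul_def qconj_def qscale_def oscale_def kmul_def kconj_def kscale_def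
    by (simp_all add: prod_eq_iff)
  then show "cd_mult i p (cd_embed (1, 0)) x = x" "cd_mult i p x (cd_embed (1, 0)) = x"
    unfolding cd_mult_def cd_embed_def pr8_emb8 by (simp_all add: emb8_pr8)
qed

definition cd_polar :: "'k::field \<Rightarrow> 'k \<times> 'k \<Rightarrow> 'k quat \<times> 'k quat \<Rightarrow> 'k quat \<times> 'k quat \<Rightarrow> 'k" where
  "cd_polar i p X Y = 2 * (fst (fst (fst X)) * fst (fst (fst Y)) + i * snd (fst (fst X)) * snd (fst (fst Y))
      + fst p * (fst (snd (fst X)) * fst (snd (fst Y)) + i * snd (snd (fst X)) * snd (snd (fst Y)))
      + snd p * (fst (fst (snd X)) * fst (fst (snd Y)) + i * snd (fst (snd X)) * snd (fst (snd Y)))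
      + fst p * snd p * (fst (snd (snd X)) * fst (snd (snd Y)) + i * snd (snd (snd X)) * snd (snd (snd Y))))"

lemma cd_norm_polar: "cd_norm i p (x + y) - cd_norm i p x - cd_norm i p y = cd_polar i p (pr8 x) (pr8 y)"
  unfolding cd_norm_def pr8_lin onorm_def knorm_def cd_polar_def by (simp add: algebra_simps power2_eq_square)

lemma cd_norm_nondeg:
  fixes i :: "'k::field"
  assumes "(2::'k) \<noteq> 0" "i \<noteq> 0" "fst p \<noteq> 0" "snd p \<noteq> 0"
  shows "nondeg_quadratic_form (cd_norm i p)"
proof -
  note C = cd_norm_polar[of i p] and C_def = cd_polar_def[of i p]
  show ?thesis
    unfolding nondeg_quadratic_form_def C
  proof (intro conjI allI impI)
    fix c x
    show "cd_norm i p (c *s x) = c\<^sup>2 * cd_norm i p x"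
      unfolding cd_norm_def pr8_lin onorm_def knorm_def oscale_def qscale_def kscale_def
      by (simp add: algebra_simps power2_eq_square)
  next
    fix x y z c
    show "cd_polar i p (pr8 (x + y)) (pr8 z) = cd_polar i p (pr8 x) (pr8 z) + cd_polar i p (pr8 y) (pr8 z)"
      "cd_polar i p (pr8 (c *s x)) (pr8 z) = c * cd_polar i p (pr8 x) (pr8 z)"
      unfolding pr8_lin C_def oscale_def qscale_def kscale_def by (simp_all add: algebra_simps)
  next
    fix x assume z: "\<forall>y. cd_polar i p (pr8 x) (pr8 y) = 0"
    then have *: "cd_polar i p (pr8 x) Y = 0" for Y using pr8_emb8 by metis
    have "pr8 x = 0"
      using *[of "(((1, 0), 0), 0)"] *[of "(((0, 1), 0), 0)"] *[of "((0, (1, 0)), 0)"] *[of "((0, (0, 1)), 0)"]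
        *[of "(0, ((1, 0), 0))"] *[of "(0, ((0, 1), 0))"] *[of "(0, (0, (1, 0)))"] *[of "(0, (0, (0, 1)))"] assms
      unfolding C_def by (simp add: prod_eq_iff)
    then show "x = 0" using pr8_eqI[of x 0] by (simp add: pr8_def prod_eq_iff)
  qed
qed

lemma cd_mult_octonion:
  fixes i :: "'k::field"
  assumes "(2::'k) \<noteq> 0" "i \<noteq> 0" "fst p \<noteq> 0" "snd p \<noteq> 0"
  shows "is_octonion_algebra (cd_mult i p)"
proof -
  have "cd_norm i p (cd_mult i p x y) = cd_norm i p x * cd_norm i p y" for x y
    unfolding cd_norm_def cd_mult_def pr8_emb8 by (rule onorm_omul)
  then show ?thesis
    unfolding is_octonion_algebra_def
    using cd_mult_bilinear cd_mult_unit cd_norm_nondeg[OF assms] by blast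
qed

lemma cd_K_embedding: "K_embedding i (cd_mult i p) cd_embed"
proof -
  have "inj cd_embed"
    by (rule injI) (metis (no_types) cd_embed_def fst_conv pr8_emb8)
  moreover have "cd_embed (u + v) = cd_embed u + cd_embed v" for u v :: "'a \<times> 'a"
    unfolding cd_embed_def emb8_lin(1)[symmetric] by simp
  moreover have "cd_embed (kmul i u v) = cd_mult i p (cd_embed u) (cd_embed v)" for u v
    unfolding cd_embed_def cd_mult_def pr8_emb8
    by (simp add: omul_def qmul_def qconj_def qscale_def kmul_def kconj_def kscale_def prod_eq_iff zero_prod_def)
  moreover have "cd_embed (kscale c u) = c *s cd_embed u" for c :: 'a and u
    unfolding cd_embed_def emb8_lin(2)[symmetric]
    by (simp add: oscale_def qscale_def kscale_def zero_prod_def)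
  ultimately show ?thesis unfolding K_embedding_def using cd_mult_unit by blast
qed

lemma cd_oct_K:
  fixes i :: "'k::field"
  assumes "(2::'k) \<noteq> 0" "i \<noteq> 0" "fst p \<noteq> 0" "snd p \<noteq> 0"
  shows "(cd_mult i p, cd_embed) \<in> oct_K i"
  unfolding oct_K_def using cd_mult_octonion[OF assms] cd_K_embedding by blast

section \<open>Octonion algebras containing K\<close>

locale octonion_with_K = composition_algebra m N "\<iota> (1, 0)"
  for m :: "'k::field ^ 8 \<Rightarrow> 'k ^ 8 \<Rightarrow> 'k ^ 8" (infixl "\<cdot>" 70) and N and \<iota> :: "'k \<times> 'k \<Rightarrow> 'k ^ 8" +
  fixes i :: 'k
  assumes i0: "i \<noteq> 0" and K: "K_embedding i m \<iota>"
begin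

lemma iota_add: "\<iota> (u + v) = \<iota> u + \<iota> v" and iota_mult: "\<iota> (kmul i u v) = \<iota> u \<cdot> \<iota> v"
  and iota_scale: "\<iota> (kscale c u) = c *s \<iota> u" and iota_inj: "\<iota> u = \<iota> v \<Longrightarrow> u = v"
  using K unfolding K_embedding_def inj_def by blast+

lemma iota_minus: "\<iota> (- u) = - \<iota> u"
  using iota_scale[of "- 1" u] unfolding vector_sneg_minus1[of "\<iota> u"]
  by (simp add: kscale_def uminus_prod_def)

lemma iota_diff: "\<iota> (u - v) = \<iota> u - \<iota> v"
  using iota_add[of u "- v"] by (simp add: iota_minus)

text \<open>Nothing relates \<open>N\<close> to the norm of K beforehand. Comparing t t = - i with
  the quadratic equation \<open>square\<close>, inside the injective image of K, forces the trace
  and the norm of t.\<close>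

lemma iota_t: "B (\<iota> (0, 1)) (\<iota> (1, 0)) = 0" "N (\<iota> (0, 1)) = i"
proof -
  let ?t = "\<iota> (0, 1)"
  have "?t \<cdot> ?t = \<iota> (- i, 0)" unfolding iota_mult[symmetric] by (simp add: kmul_def)
  moreover have "?t \<cdot> ?t = \<iota> (kscale (B ?t (\<iota> (1, 0))) (0, 1) - kscale (N ?t) (1, 0))"
    unfolding iota_diff iota_scale by (rule square)
  ultimately have "(- i, 0) = kscale (B ?t (\<iota> (1, 0))) (0, 1) - kscale (N ?t) (1, 0)"
    using iota_inj by metis
  then show "B (\<iota> (0, 1)) (\<iota> (1, 0)) = 0" "N (\<iota> (0, 1)) = i"
    by (simp_all add: kscale_def)
qed

lemma iota_eq: "\<iota> u = fst u *s \<iota> (1, 0) + snd u *s \<iota> (0, 1)"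
  unfolding iota_scale[symmetric] iota_add[symmetric] by (simp add: kscale_def)

lemma B_iota: "B (\<iota> u) (\<iota> v) = 2 * (fst u * fst v + i * snd u * snd v)"
  unfolding iota_eq[of u] iota_eq[of v] B_lin B_self N_unit iota_t B_sym[of "\<iota> (1, 0)" "\<iota> (0, 1)"]
  by (simp add: algebra_simps)

lemma N_iota: "N (\<iota> u) = knorm i u"
proof -
  have "2 * N (\<iota> u) = 2 * knorm i u"
    unfolding B_self[symmetric] B_iota knorm_def by (simp add: power2_eq_square)
  then show ?thesis using two by simp
qed

lemma cj_iota: "cj (\<iota> u) = \<iota> (kconj u)"
  unfolding cj_def B_iota iota_scale[symmetric] iota_diff[symmetric]
  by (rule arg_cong[where f = \<iota>]) (simp add: kscale_def kconj_def prod_eq_iff)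

end

locale octonion_first_doubling = octonion_with_K +
  fixes v1
  assumes v1: "\<And>u. B (\<iota> u) v1 = 0"
begin

definition D :: "'a quat \<Rightarrow> 'a ^ 8" where
  "D X = \<iota> (fst X) + \<iota> (snd X) \<cdot> v1"

lemma D_add: "D (X + Y) = D X + D Y"
  unfolding D_def by (simp add: iota_add m_add)

lemma D_scale: "D (qscale c X) = c *s D X"
  unfolding D_def qscale_def by (simp add: iota_scale m_scale vec.scale_right_distrib)

lemma D_diff: "D (X - Y) = D X - D Y"
  unfolding D_def by (simp add: iota_diff m_diff)

lemma iota_double:
  "\<iota> p \<cdot> (\<iota> q \<cdot> v1) = \<iota> (kmul i q p) \<cdot> v1"
  "(\<iota> q \<cdot> v1) \<cdot> \<iota> p = \<iota> (kmul i q (kconj p)) \<cdot> v1"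
  "(\<iota> p \<cdot> v1) \<cdot> (\<iota> q \<cdot> v1) = - (N v1 *s \<iota> (kmul i (kconj q) p))"
proof -
  have m: "B (\<iota> q \<cdot> \<iota> p) v1 = 0" for p q unfolding iota_mult[symmetric] by (rule v1)
  show "\<iota> p \<cdot> (\<iota> q \<cdot> v1) = \<iota> (kmul i q p) \<cdot> v1"
    unfolding iota_mult by (rule double_left[OF v1 v1 v1 m])
  show "(\<iota> q \<cdot> v1) \<cdot> \<iota> p = \<iota> (kmul i q (kconj p)) \<cdot> v1"
    unfolding iota_mult cj_iota[symmetric] by (rule double_right[OF v1 v1])
  show "(\<iota> p \<cdot> v1) \<cdot> (\<iota> q \<cdot> v1) = - (N v1 *s \<iota> (kmul i (kconj q) p))"
    unfolding iota_mult cj_iota[symmetric] by (rule double_both[OF v1 v1 v1 m])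
qed

lemma D_mult: "D (qmul i (N v1) X Y) = D X \<cdot> D Y"
  unfolding D_def qmul_def fst_conv snd_conv m_add iota_double iota_mult[symmetric]
  by (simp add: iota_add iota_diff iota_scale m_add algebra_simps)

lemma D_cj: "cj (D X) = D (qconj X)"
proof -
  have "cj (\<iota> u \<cdot> v1) = - (\<iota> u \<cdot> v1)" for u
    unfolding cj_mult cj_perp[OF v1] m_minus cj_iota double_comm[OF v1 v1]
    by (simp add: kconj_def)
  then show ?thesis unfolding D_def qconj_def cj_add cj_iota by (simp add: iota_minus m_minus)
qed

lemma B_iota_v1: "B (\<iota> u) (\<iota> w \<cdot> v1) = 0"
  unfolding B_sym[of "\<iota> u"] B_move_left cj_iota iota_mult[symmetric] B_sym[of v1] by (rule v1)

lemma N_D: "N (D X) = qnorm i (N v1) X"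
  unfolding D_def N_add N_mult N_iota B_iota_v1 qnorm_def by (simp add: mult.commute)

end

locale octonion_second_doubling = octonion_first_doubling +
  fixes v2
  assumes v2: "\<And>X. B (D X) v2 = 0"
begin

definition Oc :: "'a quat \<times> 'a quat \<Rightarrow> 'a ^ 8" where
  "Oc X = D (fst X) + D (snd X) \<cdot> v2"

lemma Oc_add: "Oc (X + Y) = Oc X + Oc Y"
  unfolding Oc_def by (simp add: D_add m_add)

lemma Oc_scale: "Oc (oscale c X) = c *s Oc X"
  unfolding Oc_def oscale_def by (simp add: D_scale m_scale vec.scale_right_distrib)

lemma D_double:
  "D X \<cdot> (D Y \<cdot> v2) = D (qmul i (N v1) Y X) \<cdot> v2"
  "(D Y \<cdot> v2) \<cdot> D X = D (qmul i (N v1) Y (qconj X)) \<cdot> v2"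
  "(D X \<cdot> v2) \<cdot> (D Y \<cdot> v2) = - (N v2 *s D (qmul i (N v1) (qconj Y) X))"
proof -
  have e: "B (\<iota> (1, 0)) v2 = 0"
  proof -
    have "\<iota> 0 = 0" using iota_scale[of 0 0] by (simp add: kscale_def zero_prod_def)
    then have "D ((1, 0), 0) = \<iota> (1, 0)"
      unfolding D_def using m_scale(1)[of 0 0 v1] by simp
    then show ?thesis using v2 by metis
  qed
  have m: "B (D Y \<cdot> D X) v2 = 0" for X Y unfolding D_mult[symmetric] by (rule v2)
  show "D X \<cdot> (D Y \<cdot> v2) = D (qmul i (N v1) Y X) \<cdot> v2"
    unfolding D_mult by (rule double_left[OF e v2 v2 m])
  show "(D Y \<cdot> v2) \<cdot> D X = D (qmul i (N v1) Y (qconj X)) \<cdot> v2"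
    unfolding D_mult D_cj[symmetric] by (rule double_right[OF e v2])
  show "(D X \<cdot> v2) \<cdot> (D Y \<cdot> v2) = - (N v2 *s D (qmul i (N v1) (qconj Y) X))"
    unfolding D_mult D_cj[symmetric] by (rule double_both[OF e v2 v2 m])
qed

lemma Oc_mult: "Oc (omul i (N v1) (N v2) X Y) = Oc X \<cdot> Oc Y"
  unfolding Oc_def omul_def fst_conv snd_conv m_add D_double D_mult[symmetric]
  by (simp add: D_add D_diff D_scale m_add algebra_simps)

lemma N_Oc: "N (Oc X) = onorm i (N v1) (N v2) X"
proof -
  have "B (D X) (D Y \<cdot> v2) = 0" for X Y
    unfolding B_sym[of "D X"] B_move_left D_cj D_mult[symmetric] B_sym[of v2] by (rule v2)
  then show ?thesis
    unfolding Oc_def N_add N_mult N_D onorm_def qnorm_def by (simp add: algebra_simps)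
qed

text \<open>A norm preserving linear map sends nothing but 0 to 0 when the source form is
  nondegenerate, since a kernel vector lies in the radical. Source and target both have dimension 8,
  so injectivity already gives bijectivity and \<open>Oc\<close> need not be inverted.\<close>

lemma isomorphic_cd_mult:
  assumes nz: "N v1 \<noteq> 0" "N v2 \<noteq> 0"
  shows "oct_K_iso (cd_mult i (N v1, N v2), cd_embed) (m, \<iota>)"
proof -
  define \<phi> where "\<phi> x = Oc (pr8 x)" for x
  have add: "\<phi> (x + y) = \<phi> x + \<phi> y" and scale: "\<phi> (c *s x) = c *s \<phi> x" for x y c
    unfolding \<phi>_def by (simp_all add: pr8_lin Oc_add Oc_scale)
  have mult: "\<phi> (cd_mult i (N v1, N v2) x y) = \<phi> x \<cdot> \<phi> y" for x y
    unfolding \<phi>_def cd_mult_def pr8_emb8 by (simp add: Oc_mult)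
  have embed: "\<phi> (cd_embed u) = \<iota> u" for u
  proof -
    have "\<iota> 0 = 0" using iota_scale[of 0 0] by (simp add: kscale_def zero_prod_def)
    moreover have "0 \<cdot> x = 0" for x using m_scale(1)[of 0 0 x] by simp
    ultimately show ?thesis unfolding \<phi>_def cd_embed_def pr8_emb8 Oc_def D_def by simp
  qed
  have norm: "N (\<phi> x) = cd_norm i (N v1, N v2) x" for x
    unfolding \<phi>_def N_Oc cd_norm_def by simp
  have lin: "Vector_Spaces.linear (*s) (*s) \<phi>"
    unfolding Vector_Spaces.linear_iff using add scale vec.vector_space_axioms by blast
  have ker: "x = 0" if "\<phi> x = 0" for x
  proof -
    have "cd_norm i (N v1, N v2) (x + y) - cd_norm i (N v1, N v2) x - cd_norm i (N v1, N v2) y = 0" for y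
      unfolding norm[symmetric] add that by (simp add: N_zero)
    then show ?thesis
      using cd_norm_nondeg[of i "(N v1, N v2)"] two i0 nz
      unfolding nondeg_quadratic_form_def by simp
  qed
  have inj: "inj \<phi>"
  proof (rule injI)
    fix x y assume "\<phi> x = \<phi> y"
    then have "\<phi> (x + (- 1) *s y) = 0" unfolding add scale by simp
    then have "x + (- 1) *s y = 0" by (rule ker)
    then show "x = y" by simp
  qed
  then have "bij \<phi>"
    using vec.linear_inj_imp_surj[OF lin] inj by (simp add: bij_def)
  then show ?thesis
    unfolding oct_K_iso_def fst_conv snd_conv using add scale mult embed by blast
qed

end

section \<open>Existence of doubling vectors\<close>

context composition_algebra
begin

text \<open>\<open>P\<close> is the projection onto the orthogonal complement. If \<open>N\<close>
  vanished on its image, so would \<open>B\<close>; as \<open>B (P x) y = B (P x) (P y)\<close>,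
  nondegeneracy would make \<open>P\<close> zero and \<open>n\<close> vectors would span a space of
  larger dimension.\<close>

lemma exists_anisotropic_perp:
  assumes f: "\<And>j. j < n \<Longrightarrow> N (f j) \<noteq> 0" "\<And>j k. j < n \<Longrightarrow> k < n \<Longrightarrow> j \<noteq> k \<Longrightarrow> B (f j) (f k) = 0"
    and n: "n < CARD('n)"
  shows "\<exists>v. N v \<noteq> 0 \<and> (\<forall>j<n. B (f j) v = 0)"
proof -
  define P where "P x = x - (\<Sum>j<n. (B x (f j) / B (f j) (f j)) *s f j)" for x
  have B_sum: "B (\<Sum>j\<in>A. c j *s f j) y = (\<Sum>j\<in>A. c j * B (f j) y)" if "finite A" for A c y
    using that by induction (simp_all add: B_zero B_lin)
  have P: "B (f k) (P x) = 0" if "k < n" for k x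
  proof -
    have "B (P x) (f k) = B x (f k) - (\<Sum>j<n. B x (f j) / B (f j) (f j) * B (f j) (f k))"
      unfolding P_def B_diff by (simp add: B_sum)
    also have "(\<Sum>j<n. B x (f j) / B (f j) (f j) * B (f j) (f k)) = (\<Sum>j<n. if j = k then B x (f k) else 0)"
      using f that two by (intro sum.cong refl) (auto simp: B_self)
    also have "\<dots> = B x (f k)" using that by simp
    finally show ?thesis by (simp add: B_sym[of "f k"])
  qed
  have "\<exists>x. N (P x) \<noteq> 0"
  proof (rule ccontr)
    assume "\<not> (\<exists>x. N (P x) \<noteq> 0)"
    then have N0: "N (P x) = 0" for x by blast
    have P_add: "P (x + y) = P x + P y" for x y
      unfolding P_def B_lin by (simp add: add_divide_distrib vec.scale_left_distrib sum.distrib)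
    have "B (P x) (P y) = 0" for x y
      using N0[of "x + y"] N0 unfolding P_add N_add by simp
    moreover have "B (P x) (P y) = B (P x) y" for x y
    proof -
      have "B (\<Sum>j<n. (B y (f j) / B (f j) (f j)) *s f j) (P x) = 0"
        by (subst B_sum) (simp_all add: P)
      then show ?thesis unfolding P_def[of y] B_diff by (simp add: B_sym[of "P x"])
    qed
    ultimately have "P x = 0" for x using B_nondeg by metis
    then have x: "x = (\<Sum>j<n. (B x (f j) / B (f j) (f j)) *s f j)" for x unfolding P_def by simp
    have "x \<in> vec.span (f ` {..<n})" for x
      by (subst x) (intro vec.span_sum vec.span_scale vec.span_base imageI)
    then have "vec.dim (UNIV :: ('k ^ 'n) set) \<le> card (f ` {..<n})"
      by (intro vec.dim_le_card) auto
    also have "\<dots> \<le> n" using card_image_le[of "{..<n}" f] by simp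
    finally show False using n by (simp add: card_cart_basis)
  qed
  then show ?thesis using P by blast
qed

end

context octonion_with_K
begin

lemma exists_cd_mult:
  "\<exists>p. fst p \<noteq> 0 \<and> snd p \<noteq> 0 \<and> oct_K_iso (cd_mult i p, cd_embed) (m, \<iota>)"
proof -
  define f where "f j = (if j = 0 then \<iota> (1, 0) else \<iota> (0, 1))" for j :: nat
  have "\<exists>v. N v \<noteq> 0 \<and> (\<forall>j<2. B (f j) v = 0)"
    by (rule exists_anisotropic_perp) (auto simp: f_def N_unit iota_t i0 B_sym[of "\<iota> (1, 0)" "\<iota> (0, 1)"])
  then obtain v1 where w1: "N v1 \<noteq> 0" "B (f 0) v1 = 0" "B (f 1) v1 = 0"
    by (metis one_less_numeral_iff semiring_norm(76) zero_less_numeral)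
  interpret octonion_first_doubling m N \<iota> i v1
    by unfold_locales (use w1 in \<open>subst iota_eq, simp add: f_def B_lin\<close>)
  \<comment> \<open>1, t, v1 and t v1 form an orthogonal basis of the quaternion subalgebra, so
    being orthogonal to these four is being orthogonal to every \<open>D X\<close>.\<close>
  define h where "h j = (if j = 0 then \<iota> (1, 0) else if j = 1 then \<iota> (0, 1) else if j = 2 then v1 else \<iota> (0, 1) \<cdot> v1)" for j :: nat
  have h: "N (h j) \<noteq> 0" for j
    unfolding h_def using w1 i0 by (simp add: N_unit iota_t N_mult)
  have b: "B (\<iota> (0, 1) \<cdot> v1) v1 = 0" "B v1 (\<iota> (0, 1) \<cdot> v1) = 0" "B v1 (\<iota> u) = 0" "B (\<iota> u \<cdot> v1) (\<iota> w) = 0" for u w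
    using B_mult_right[of "\<iota> (0, 1)" v1 "\<iota> (1, 0)"] B_sym[of v1 "\<iota> (0, 1) \<cdot> v1"] B_sym[of v1 "\<iota> u"]       B_iota_v1 B_sym[of "\<iota> u \<cdot> v1" "\<iota> w"] v1
    by (simp_all add: m_unit iota_t)
  have hh: "B (h j) (h k) = 0" if "j < 4" "k < 4" "j \<noteq> k" for j k
    unfolding h_def using that b B_iota_v1 v1
    by (auto simp: iota_t B_sym[of "\<iota> (1, 0)" "\<iota> (0, 1)"])
  have "\<exists>v. N v \<noteq> 0 \<and> (\<forall>j<4. B (h j) v = 0)"
    by (rule exists_anisotropic_perp) (simp_all add: h hh)
  then obtain v2 where w2: "N v2 \<noteq> 0" and "\<And>j. j < 4 \<Longrightarrow> B (h j) v2 = 0" by blast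
  from this(2)[of 0] this(2)[of 1] this(2)[of 2] this(2)[of 3]
  have w: "B (\<iota> (1, 0)) v2 = 0" "B (\<iota> (0, 1)) v2 = 0" "B v1 v2 = 0" "B (\<iota> (0, 1) \<cdot> v1) v2 = 0"
    unfolding h_def by simp_all
  interpret octonion_second_doubling m N \<iota> i v1 v2
  proof unfold_locales
    fix X
    show "B (D X) v2 = 0"
      unfolding D_def iota_eq[of "fst X"] iota_eq[of "snd X"] m_add m_scale m_unit B_lin w by simp
  qed
  show ?thesis
    using isomorphic_cd_mult[OF w1(1) w2] w1(1) w2 by (intro exI[of _ "(N v1, N v2)"]) simp
qed

end

lemma oct_K_composition:
  fixes i :: "'k::field"
  assumes "(2::'k) \<noteq> 0" "i \<noteq> 0" "(m, \<iota>) \<in> oct_K i"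
  obtains N where "octonion_with_K m N \<iota> i"
proof -
  have o: "is_octonion_algebra m" and K: "K_embedding i m \<iota>"
    using assms(3) unfolding oct_K_def by auto
  obtain N where N: "nondeg_quadratic_form N" "\<And>x y. N (m x y) = N x * N y"
    using o unfolding is_octonion_algebra_def by blast
  have "bilinear_mult m" using o unfolding is_octonion_algebra_def by blast
  moreover have "is_unit_of m (\<iota> (1, 0))" using K unfolding K_embedding_def by blast
  ultimately have "octonion_with_K m N \<iota> i"
    using assms(1,2) N K by unfold_locales auto
  then show thesis by (rule that)
qed

lemma oct_K_meets_cd_mult:
  fixes i :: "'k::field"
  assumes "(2::'k) \<noteq> 0" "i \<noteq> 0" "A \<in> oct_K i"
  shows "\<exists>p. fst p \<noteq> 0 \<and> snd p \<noteq> 0 \<and> oct_K_iso (cd_mult i p, cd_embed) A"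
proof -
  obtain m \<iota> where A: "A = (m, \<iota>)" by (cases A)
  obtain N where "octonion_with_K m N \<iota> i"
    using oct_K_composition assms unfolding A by blast
  then interpret octonion_with_K m N \<iota> i .
  show ?thesis unfolding A by (rule exists_cd_mult)
qed

section \<open>Isomorphisms of octonion algebras over K and the hermitian form\<close>

lemma oct_K_iso_sym: "oct_K_iso A A' \<Longrightarrow> oct_K_iso A' A"
proof -
  assume "oct_K_iso A A'"
  then obtain \<phi> where b: "bij \<phi>" and \<phi>: "\<And>x y. \<phi> (x + y) = \<phi> x + \<phi> y"
    "\<And>x y. \<phi> (fst A x y) = fst A' (\<phi> x) (\<phi> y)" "\<And>c x. \<phi> (c *s x) = c *s \<phi> x" "\<And>u. \<phi> (snd A u) = snd A' u"
    unfolding oct_K_iso_def by blast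
  have s: "\<phi> (inv \<phi> y) = y" for y using b by (simp add: bij_is_surj surj_f_inv_f)
  have i: "inv \<phi> y = x \<longleftrightarrow> y = \<phi> x" for x y using b s by (metis bij_inv_eq_iff)
  show "oct_K_iso A' A"
    unfolding oct_K_iso_def
    by (intro exI[of _ "inv \<phi>"]) (simp add: b bij_imp_bij_inv i \<phi> s)
qed

lemma oct_K_iso_trans: "oct_K_iso A A' \<Longrightarrow> oct_K_iso A' A'' \<Longrightarrow> oct_K_iso A A''"
proof -
  assume 1: "oct_K_iso A A'" and 2: "oct_K_iso A' A''"
  from 1 obtain \<phi> where b1: "bij \<phi>" and \<phi>: "\<And>x y. \<phi> (x + y) = \<phi> x + \<phi> y"
    "\<And>x y. \<phi> (fst A x y) = fst A' (\<phi> x) (\<phi> y)" "\<And>c x. \<phi> (c *s x) = c *s \<phi> x" "\<And>u. \<phi> (snd A u) = snd A' u"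
    unfolding oct_K_iso_def by blast
  from 2 obtain \<psi> where b2: "bij \<psi>" and \<psi>: "\<And>x y. \<psi> (x + y) = \<psi> x + \<psi> y"
    "\<And>x y. \<psi> (fst A' x y) = fst A'' (\<psi> x) (\<psi> y)" "\<And>c x. \<psi> (c *s x) = c *s \<psi> x" "\<And>u. \<psi> (snd A' u) = snd A'' u"
    unfolding oct_K_iso_def by blast
  show "oct_K_iso A A''"
    unfolding oct_K_iso_def
    by (intro exI[of _ "\<psi> \<circ> \<phi>"]) (simp add: b1 b2 bij_comp \<phi> \<psi>)
qed

lemma equiv_oct_K: "equiv (oct_K i) {(A, A'). A \<in> oct_K i \<and> A' \<in> oct_K i \<and> oct_K_iso A A'}"
proof (rule equivI)
  have "oct_K_iso A A" for A :: "('a ^ 8 \<Rightarrow> 'a ^ 8 \<Rightarrow> 'a ^ 8) \<times> ('a \<times> 'a \<Rightarrow> 'a ^ 8)"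
    unfolding oct_K_iso_def by (intro exI[of _ "\<lambda>x. x"]) (simp add: bij_id[unfolded id_def])
  then show "refl_on (oct_K i) {(A, A'). A \<in> oct_K i \<and> A' \<in> oct_K i \<and> oct_K_iso A A'}"
    by (intro refl_onI) blast
  show "sym {(A, A'). A \<in> oct_K i \<and> A' \<in> oct_K i \<and> oct_K_iso A A'}"
    using oct_K_iso_sym by (intro symI) blast
  show "trans {(A, A'). A \<in> oct_K i \<and> A' \<in> oct_K i \<and> oct_K_iso A A'}"
    using oct_K_iso_trans by (intro transI) blast
qed auto

text \<open>K-linear coordinates on the orthogonal complement of K: the third one is conjugated because
  \<open>u ((s v) w) = ((s conj(u)) v) w\<close>.\<close>

definition perp :: "(nat \<Rightarrow> 'k::field \<times> 'k) \<Rightarrow> 'k ^ 8" where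
  "perp z = emb8 ((0, z 0), (z 1, kconj (z 2)))"

text \<open>The two vectors, placed in the complement of K, serve as new doubling vectors with norms
  \<open>fst p'\<close> and \<open>snd p'\<close>. For the second doubling \<open>perp v\<close> has
  to be orthogonal to the whole of K times \<open>perp u\<close>: the real scalars give the
  condition on \<open>hre\<close>, the multiples of t the one on \<open>him\<close>.\<close>

lemma represents_imp_iso:
  fixes i :: "'k::field"
  assumes two: "(2::'k) \<noteq> 0" and i0: "i \<noteq> 0" and nz: "fst p \<noteq> 0" "snd p \<noteq> 0" "fst p' \<noteq> 0" "snd p' \<noteq> 0"
    and r: "represents i p p'"
  shows "oct_K_iso (cd_mult i p', cd_embed) (cd_mult i p, cd_embed)"
proof -
  obtain u v where uv: "hre i (fst p, snd p, fst p * snd p) u u = fst p'"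
      "hre i (fst p, snd p, fst p * snd p) v v = snd p'"
      "hre i (fst p, snd p, fst p * snd p) u v = 0" "him (fst p, snd p, fst p * snd p) u v = 0"
    using r unfolding represents_def Let_def by blast
  note h = uv[unfolded hre_def him_def sum3 gam_def]
  have n: "cd_norm i p (cd_mult i p x y) = cd_norm i p x * cd_norm i p y" for x y
    unfolding cd_norm_def cd_mult_def pr8_emb8 by (rule onorm_omul)
  interpret octonion_with_K "cd_mult i p" "cd_norm i p" cd_embed i
    by unfold_locales
      (rule two i0 n cd_norm_nondeg[OF two i0 nz(1,2)] cd_mult_bilinear cd_mult_unit cd_K_embedding)+
  note C_def = cd_polar_def[of i p]
  have C: "B x y = cd_polar i p (pr8 x) (pr8 y)" for x y
    unfolding B_def by (rule cd_norm_polar)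
  have norm: "cd_norm i p (perp z) = hre i (fst p, snd p, fst p * snd p) z z" for z
    unfolding cd_norm_def perp_def pr8_emb8 onorm_def knorm_def hre_def sum3 gam_def kconj_def
    by (simp add: algebra_simps power2_eq_square)
  interpret octonion_first_doubling "cd_mult i p" "cd_norm i p" cd_embed i "perp u"
    by unfold_locales (simp add: C cd_embed_def perp_def pr8_emb8 C_def)
  have c: "cd_mult i p (cd_embed w) (perp u)
      = emb8 ((0, kmul i (u 0) w), (kmul i (u 1) w, kmul i (kconj (u 2)) (kconj w)))" for w
    unfolding cd_mult_def cd_embed_def perp_def pr8_emb8
    by (rule arg_cong[where f = emb8])
      (simp add: omul_def qmul_def qconj_def qscale_def kmul_def kconj_def kscale_def prod_eq_iff)
  interpret octonion_second_doubling "cd_mult i p" "cd_norm i p" cd_embed i "perp u" "perp v"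
  proof unfold_locales
    fix X :: "'k quat"
    have 1: "B (cd_embed (fst X)) (perp v) = 0"
      by (simp add: C cd_embed_def perp_def pr8_emb8 C_def)
    have "B (cd_mult i p (cd_embed (snd X)) (perp u)) (perp v)
       = 2 * (fst (snd X) * hre i (fst p, snd p, fst p * snd p) u v
          + i * snd (snd X) * - him (fst p, snd p, fst p * snd p) u v)"
      unfolding c C unfolding perp_def pr8_emb8 C_def hre_def him_def sum3 gam_def kmul_def kconj_def
      by (simp add: algebra_simps)
    then show "B (D X) (perp v) = 0" unfolding D_def B_lin 1 by (simp add: uv)
  qed
  show ?thesis
    using isomorphic_cd_mult unfolding norm uv using nz by simp
qed

text \<open>On elements orthogonal to K the K-component of a product is minus the hermitian form.
  The generators \<open>x1\<close> and \<open>x2\<close> have scalar squares - a' and - b' and a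
  product orthogonal to K, where (a', b') = \<open>p'\<close>; carried over by the isomorphism,
  these facts are the required values.\<close>

lemma iso_imp_represents:
  fixes i :: "'k::field"
  assumes two: "(2::'k) \<noteq> 0" and i0: "i \<noteq> 0"
    and iso: "oct_K_iso (cd_mult i p', cd_embed) (cd_mult i p, cd_embed)"
  shows "represents i p p'"
proof -
  obtain \<phi> where add: "\<And>x y. \<phi> (x + y) = \<phi> x + \<phi> y"
    and mult: "\<And>x y. \<phi> (cd_mult i p' x y) = cd_mult i p (\<phi> x) (\<phi> y)"
    and scale: "\<And>c x. \<phi> (c *s x) = c *s \<phi> x" and embed: "\<And>u. \<phi> (cd_embed u) = cd_embed u"
    using iso unfolding oct_K_iso_def by auto
  let ?t = "cd_embed (0, 1)"
  define x1 where "x1 = (emb8 ((0, (1, 0)), 0) :: 'k ^ 8)"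
  define x2 where "x2 = (emb8 (0, ((1, 0), 0)) :: 'k ^ 8)"
  define x12 where "x12 = cd_mult i p' x1 x2"
  \<comment> \<open>Anticommuting with t characterises the complement of K by the product alone, so
    an isomorphism fixing K preserves it without any comparison of norms.\<close>
  have anti: "cd_mult i q x ?t = (- 1) *s cd_mult i q ?t x \<longleftrightarrow> fst (fst (pr8 x)) = 0" for q x
  proof -
    have 2: "s = - s \<longleftrightarrow> s = 0" for s :: 'k
    proof
      assume "s = - s"
      then have "2 * s = 0" unfolding mult_2 by (rule iffD1[OF eq_neg_iff_add_eq_0])
      then show "s = 0" using two by simp
    qed simp
    have "cd_mult i q x ?t = (- 1) *s cd_mult i q ?t x
        \<longleftrightarrow> pr8 (cd_mult i q x ?t) = oscale (- 1) (pr8 (cd_mult i q ?t x))"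
      unfolding pr8_lin(2)[symmetric] by (rule iffI, erule arg_cong) (rule pr8_eqI)
    also have "\<dots> \<longleftrightarrow> fst (fst (pr8 x)) = 0"
      unfolding cd_mult_def cd_embed_def pr8_emb8
      by (auto simp: omul_def qmul_def qconj_def qscale_def oscale_def kmul_def kconj_def kscale_def prod_eq_iff 2 i0 two)
    finally show ?thesis .
  qed
  have t: "\<phi> ?t = ?t" by (rule embed)
  have perp_image: "fst (fst (pr8 (\<phi> x))) = 0" if "fst (fst (pr8 x)) = 0" for x
  proof -
    have "\<phi> (cd_mult i p' x ?t) = \<phi> ((- 1) *s cd_mult i p' ?t x)"
      using that anti by metis
    then show ?thesis unfolding mult scale t anti .
  qed
  have x1: "fst (fst (pr8 (\<phi> x1))) = 0" and x2: "fst (fst (pr8 (\<phi> x2))) = 0"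
    by (rule perp_image, simp add: x1_def x2_def pr8_emb8)+
  have "fst (fst (pr8 (\<phi> x12))) = 0"
    by (rule perp_image)
      (simp add: x12_def x1_def x2_def pr8_emb8 cd_mult_def omul_def qmul_def qconj_def qscale_def kmul_def kconj_def kscale_def prod_eq_iff)
  then have x12: "fst (fst (pr8 (cd_mult i p (\<phi> x1) (\<phi> x2)))) = 0"
    unfolding x12_def mult .
  have "\<phi> (cd_mult i p' x1 x1) = \<phi> (cd_embed (- fst p', 0))" "\<phi> (cd_mult i p' x2 x2) = \<phi> (cd_embed (- snd p', 0))"
    unfolding x1_def x2_def cd_mult_def pr8_emb8 cd_embed_def
    by (intro arg_cong[where f = \<phi>] arg_cong[where f = emb8];
        simp add: omul_def qmul_def qconj_def qscale_def kmul_def kconj_def kscale_def prod_eq_iff)+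
  then have sq: "fst (fst (pr8 (cd_mult i p (\<phi> x1) (\<phi> x1)))) = (- fst p', 0)"
    "fst (fst (pr8 (cd_mult i p (\<phi> x2) (\<phi> x2)))) = (- snd p', 0)"
    unfolding mult embed by (simp_all add: cd_embed_def pr8_emb8)
  define co where "co x j = (if j = 0 then snd (fst (pr8 x)) else if j = 1 then fst (snd (pr8 x))
     else kconj (snd (snd (pr8 x))))" for x :: "'k ^ 8" and j :: nat
  have prod: "fst (fst (pr8 (cd_mult i p x y)))
      = (- hre i (fst p, snd p, fst p * snd p) (co x) (co y), - him (fst p, snd p, fst p * snd p) (co x) (co y))"
    if "fst (fst (pr8 x)) = 0" "fst (fst (pr8 y)) = 0" for x y
    unfolding hre_def him_def sum3 gam_def co_def cd_mult_def pr8_emb8 using that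
    by (simp add: omul_def qmul_def qconj_def qscale_def kmul_def kconj_def kscale_def prod_eq_iff algebra_simps)
  show ?thesis
    unfolding represents_def
    by (intro exI[of _ "co (\<phi> x1)"] exI[of _ "co (\<phi> x2)"])
      (use x12 sq in \<open>simp add: prod x1 x2 Let_def zero_prod_def\<close>)
qed

section \<open>Hermitian matrices over K\<close>

type_synonym 'k kmat = "nat \<Rightarrow> nat \<Rightarrow> 'k \<times> 'k"

lemma kmul_comm: "kmul i u v = kmul i v u"
  unfolding kmul_def by (simp add: algebra_simps)

lemma kmul_assoc: "kmul i (kmul i u v) w = kmul i u (kmul i v w)"
  unfolding kmul_def by (simp add: algebra_simps)

lemma kmul_add: "kmul i (u + v) w = kmul i u w + kmul i v w" "kmul i w (u + v) = kmul i w u + kmul i w v"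
  unfolding kmul_def by (simp_all add: algebra_simps prod_eq_iff)

lemma kmul_zero: "kmul i 0 u = 0" "kmul i u 0 = 0"
  unfolding kmul_def by (simp_all add: zero_prod_def)

lemma kmul_sum: "kmul i (\<Sum>a\<in>A. f a) u = (\<Sum>a\<in>A. kmul i (f a) u)" "kmul i u (\<Sum>a\<in>A. f a) = (\<Sum>a\<in>A. kmul i u (f a))"
  by (induction A rule: infinite_finite_induct) (simp_all add: kmul_zero kmul_add)

lemma kscale_add: "kscale c (u + v) = kscale c u + kscale c v"
  unfolding kscale_def by (simp add: algebra_simps prod_eq_iff)

lemma kscale_zero: "kscale c 0 = 0" "kscale 0 u = 0"
  unfolding kscale_def by (simp_all add: zero_prod_def)

lemma kscale_sum: "kscale c (\<Sum>a\<in>A. f a) = (\<Sum>a\<in>A. kscale c (f a))"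
  by (induction A rule: infinite_finite_induct) (simp_all add: kscale_zero kscale_add)

lemma kmul_kscale: "kmul i (kscale c u) v = kscale c (kmul i u v)" "kmul i u (kscale c v) = kscale c (kmul i u v)"
  unfolding kmul_def kscale_def by (simp_all add: algebra_simps)

lemma kconj_kmul: "kconj (kmul i u v) = kmul i (kconj v) (kconj u)"
  unfolding kmul_def kconj_def by (simp add: algebra_simps)

lemma kconj_sum: "kconj (\<Sum>a\<in>A. f a) = (\<Sum>a\<in>A. kconj (f a))"
  by (induction A rule: infinite_finite_induct) (simp_all add: kconj_def prod_eq_iff)

lemma kconj_kconj: "kconj (kconj u) = u"
  unfolding kconj_def by simp

lemma kconj_fixed: "(2::'k::field) \<noteq> 0 \<Longrightarrow> kconj u = u \<Longrightarrow> u = (fst u, 0 :: 'k)"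
proof -
  assume two: "(2::'k) \<noteq> 0" and "kconj u = u"
  then have "- snd u = snd u" unfolding kconj_def by (metis snd_conv)
  then have "2 * snd u = 0" unfolding mult_2 by (metis add.left_inverse)
  then show ?thesis using two by (simp add: prod_eq_iff)
qed

lemma kscale_kscale: "kscale c (kscale d u) = kscale (c * d) u" "kscale 1 u = u"
  unfolding kscale_def by (simp_all add: mult.assoc)

lemma kconj_kscale: "kconj (kscale c u) = kscale c (kconj u)"
  unfolding kconj_def kscale_def by simp

lemma kmul_one: "kmul i (1, 0) u = u" "kmul i u (1, 0) = u"
  unfolding kmul_def by simp_all

lemma knorm_kmul: "knorm i (kmul i u v) = knorm i u * knorm i v"
  unfolding knorm_def kmul_def by (simp add: algebra_simps power2_eq_square)

lemma kmul_kconj: "kmul i u (kconj u) = (knorm i u, 0)"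
  unfolding knorm_def kmul_def kconj_def by (simp add: power2_eq_square)

lemma knorm_kscale: "knorm i (kscale c u) = c\<^sup>2 * knorm i u"
  unfolding knorm_def kscale_def by (simp add: algebra_simps)

lemma madd_plus: "madd X Y = X + Y"
  unfolding madd_def by (simp add: fun_eq_iff)

lemma mmul_assoc: "mmul i (mmul i X Y) Z = mmul i X (mmul i Y Z)"
proof (intro ext)
  fix a b
  have "mmul i (mmul i X Y) Z a b = (\<Sum>m<3. \<Sum>n<3. kmul i (X a n) (kmul i (Y n m) (Z m b)))"
    unfolding mmul_def kmul_sum kmul_assoc ..
  also have "\<dots> = mmul i X (mmul i Y Z) a b"
    unfolding mmul_def kmul_sum by (rule sum.swap)
  finally show "mmul i (mmul i X Y) Z a b = mmul i X (mmul i Y Z) a b" .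
qed

lemma mmul_add: "mmul i (X + Y) Z = mmul i X Z + mmul i Y Z" "mmul i Z (X + Y) = mmul i Z X + mmul i Z Y"
  unfolding mmul_def by (simp_all add: fun_eq_iff kmul_add sum.distrib)

lemma mmul_mscale: "mmul i (mscale c X) Y = mscale c (mmul i X Y)" "mmul i X (mscale c Y) = mscale c (mmul i X Y)"
  unfolding mmul_def mscale_def by (simp_all add: kmul_kscale kscale_sum)

lemma mmul_zero: "mmul i 0 X = 0" "mmul i X 0 = 0"
  unfolding mmul_def by (simp_all add: fun_eq_iff kmul_zero)

lemma mscale_add: "mscale c (X + Y) = mscale c X + mscale c Y" "mscale (c + d) X = mscale c X + mscale d X"
  unfolding mscale_def by (simp_all add: fun_eq_iff kscale_add kscale_def algebra_simps)

lemma mscale_mscale: "mscale c (mscale d X) = mscale (c * d) X" "mscale 1 X = X"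
  unfolding mscale_def by (simp_all add: kscale_kscale)

lemma mscale_zero: "mscale 0 X = 0" "mscale c 0 = 0"
  unfolding mscale_def by (simp_all add: fun_eq_iff kscale_zero)

lemma mscale_eq_0: assumes "mscale c X = 0" "c \<noteq> 0" shows "X = 0"
proof -
  have "X = mscale (inverse c) (mscale c X)" using assms(2) by (simp add: mscale_mscale)
  then show ?thesis using assms(1) by (simp add: mscale_zero)
qed

lemmas mat_lin = mmul_add mmul_mscale mmul_zero mscale_add mscale_mscale mscale_zero

definition M3 :: "'k::field kmat set" where
  "M3 = {X. \<forall>a b. (3 \<le> a \<or> 3 \<le> b) \<longrightarrow> X a b = 0}"

text \<open>The adjoint \<open>\<Gamma>\<^sup>-\<^sup>1 X\<^sup>* \<Gamma>'\<close> of a map from the form \<open>\<Gamma>\<close> to the form \<open>\<Gamma>'\<close>.\<close>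

definition dg :: "'k::field \<times> 'k \<times> 'k \<Rightarrow> 'k \<times> 'k \<times> 'k \<Rightarrow> 'k kmat \<Rightarrow> 'k kmat" where
  "dg g g' X a b = (if a < 3 \<and> b < 3 then kscale (inverse (gam g a) * gam g' b) (kconj (X b a)) else 0)"

definition mone :: "'k::field kmat" where
  "mone a b = (if a < 3 \<and> a = b then (1, 0) else 0)"

lemma M3_closed: "X \<in> M3 \<Longrightarrow> Y \<in> M3 \<Longrightarrow> X + Y \<in> M3" "X \<in> M3 \<Longrightarrow> Y \<in> M3 \<Longrightarrow> mmul i X Y \<in> M3"
  "X \<in> M3 \<Longrightarrow> mscale c X \<in> M3" "dg g g' X \<in> M3" "mone \<in> M3" "0 \<in> M3"
  unfolding M3_def mmul_def mscale_def dg_def mone_def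
  by (auto simp: kmul_zero kscale_zero)

lemma mmul_mone: "X \<in> M3 \<Longrightarrow> mmul i mone X = X" "X \<in> M3 \<Longrightarrow> mmul i X mone = X"
proof -
  assume X: "X \<in> M3"
  have o: "X a b = 0" if "3 \<le> a \<or> 3 \<le> b" for a b using X that unfolding M3_def by blast
  show "mmul i mone X = X"
  proof (intro ext)
    fix a b
    have "mmul i mone X a b = (\<Sum>m<3. if m = a then X a b else 0)"
      unfolding mmul_def mone_def by (intro sum.cong refl) (auto simp: kmul_one kmul_zero)
    then show "mmul i mone X a b = X a b" using o[of a b] by auto
  qed
  show "mmul i X mone = X"
  proof (intro ext)
    fix a b
    have "mmul i X mone a b = (\<Sum>m<3. if m = b then X a b else 0)"
      unfolding mmul_def mone_def by (intro sum.cong refl) (auto simp: kmul_one kmul_zero)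
    then show "mmul i X mone a b = X a b" using o[of a b] by auto
  qed
qed

lemma gam_nonzero: "g \<in> diag_GL3 \<Longrightarrow> gam g a \<noteq> 0"
  unfolding diag_GL3_def gam_def by auto

lemma H3_iff: "X \<in> H3 g \<longleftrightarrow> X \<in> M3 \<and> dg g g X = X"
  unfolding H3_def M3_def dg_def fun_eq_iff by (auto simp: not_less)

lemma dg_mmul:
  assumes "g' \<in> diag_GL3"
  shows "dg g g'' (mmul i X Y) = mmul i (dg g g' Y) (dg g' g'' X)"
proof (intro ext)
  fix a b
  show "dg g g'' (mmul i X Y) a b = mmul i (dg g g' Y) (dg g' g'' X) a b"
  proof (cases "a < 3 \<and> b < 3")
    case True
    have c: "inverse (gam g' m) * gam g'' b * (inverse (gam g a) * gam g' m) = inverse (gam g a) * gam g'' b" for m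
    proof -
      have "gam g' m * inverse (gam g' m) = 1" using gam_nonzero[OF assms] by simp
      then show ?thesis by (metis mult.commute mult.left_commute mult.right_neutral)
    qed
    show ?thesis
      unfolding mmul_def using True
      by (simp add: dg_def kconj_sum kscale_sum kconj_kmul)
        (intro sum.cong refl, simp add: kmul_kscale kscale_kscale c)
  next
    case False
    then show ?thesis unfolding mmul_def dg_def by (auto simp: kmul_zero)
  qed
qed

lemma dg_add: "dg g g' (X + Y) = dg g g' X + dg g g' Y"
  unfolding dg_def by (auto simp: fun_eq_iff kconj_def kscale_def algebra_simps)

lemma dg_mscale: "dg g g' (mscale c X) = mscale c (dg g g' X)"
  unfolding dg_def mscale_def by (auto simp: fun_eq_iff kconj_def kscale_def algebra_simps zero_prod_def)

lemma dg_dg: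
  assumes "g \<in> diag_GL3" "g' \<in> diag_GL3" "X \<in> M3"
  shows "dg g' g (dg g g' X) = X"
proof (intro ext)
  fix a b
  show "dg g' g (dg g g' X) a b = X a b"
  proof (cases "a < 3 \<and> b < 3")
    case True
    then have "inverse (gam g' a) * gam g b * (inverse (gam g b) * gam g' a) = 1"
      using gam_nonzero[OF assms(1), of b] gam_nonzero[OF assms(2), of a] by (simp add: field_simps)
    then show ?thesis using True by (simp add: dg_def kconj_kscale kconj_kconj kscale_kscale)
  next
    case False
    then show ?thesis using assms(3) unfolding M3_def dg_def by auto
  qed
qed

lemma dg_mone: "g \<in> diag_GL3 \<Longrightarrow> dg g g mone = mone"
  unfolding dg_def mone_def fun_eq_iff
  by (auto simp: gam_nonzero kconj_def kscale_def zero_prod_def)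

text \<open>K need not be a field, so the claim is transferred to 6 by 6 matrices over k through the
  regular representation of K.\<close>

lemma mmul_left_right_inverse:
  assumes P: "P \<in> M3" "Q \<in> M3" and QP: "mmul i Q P = mone"
  shows "mmul i P Q = mone"
proof -
  \<comment> \<open>Each entry becomes the 2 by 2 matrix of multiplication by it in the basis 1, t.
    The first column of a block recovers the entry.\<close>
  define R where "R M r c =
      (if c mod 2 = 0 then (if r mod 2 = 0 then fst (M (r div 2) (c div 2)) else snd (M (r div 2) (c div 2)))
       else (if r mod 2 = 0 then - i * snd (M (r div 2) (c div 2)) else fst (M (r div 2) (c div 2))))"
    for M :: "'a kmat" and r c :: nat
  have sum6: "(\<Sum>s<6::nat. f s) = f 0 + f 1 + f 2 + f 3 + f 4 + f 5" for f :: "nat \<Rightarrow> 'a"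
    by (simp add: eval_nat_numeral)
  have R: "(\<Sum>s<6. R M r s * R M' s c) = R (mmul i M M') r c" for M M' r c
    unfolding sum6 R_def mmul_def sum3 kmul_def by (simp add: algebra_simps)
  have R1: "R mone r c = (if r = c then 1 else 0)" if "r < 6" "c < 6" for r c
  proof -
    have "r = c \<longleftrightarrow> r div 2 = c div 2 \<and> r mod 2 = c mod 2"
      by (metis div_mult_mod_eq)
    moreover have "r div 2 < 3" using that by simp
    ultimately show ?thesis unfolding R_def mone_def
      by (auto simp: zero_prod_def mod2_eq_if split: if_splits)
  qed
  have "(\<Sum>s<6. R P r s * R Q s c) = (if r = c then 1 else 0)" if "r < 6" "c < 6" for r c
    using fun_matrix_left_right_inverse[where 'n = 6, of "{..<6}" "R Q" "R P" r c] that
    by (simp add: R QP R1)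
  then have PQ: "R (mmul i P Q) r c = R mone r c" if "r < 6" "c < 6" for r c
    using that by (simp add: R R1)
  show ?thesis
  proof (intro ext)
    fix a b
    show "mmul i P Q a b = mone a b"
    proof (cases "a < 3 \<and> b < 3")
      case True
      then show ?thesis
        using PQ[of "2 * a" "2 * b"] PQ[of "2 * a + 1" "2 * b"] by (simp add: R_def prod_eq_iff)
    next
      case False
      then show ?thesis
        using M3_closed(2)[OF P, of i] M3_closed(5) unfolding M3_def by (metis (mono_tags, lifting) mem_Collect_eq not_less)
    qed
  qed
qed

definition mu :: "nat \<Rightarrow> nat \<Rightarrow> 'k::field \<times> 'k \<Rightarrow> 'k kmat" where
  "mu a b u = (\<lambda>p q. if p = a \<and> q = b then u else 0)"

lemma mu_M3: "a < 3 \<Longrightarrow> b < 3 \<Longrightarrow> mu a b u \<in> M3"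
  unfolding mu_def M3_def by auto

lemma mmul_mu_mu: "b < 3 \<Longrightarrow> mmul i (mu a b u) (mu c d v) = (if b = c then mu a d (kmul i u v) else 0)"
proof -
  assume b: "b < 3"
  have "mmul i (mu a b u) (mu c d v) p q = (\<Sum>m<3. if m = b then (if p = a \<and> b = c \<and> q = d then kmul i u v else 0) else 0)" for p q
    unfolding mmul_def mu_def by (intro sum.cong refl) (auto simp: kmul_zero)
  then show ?thesis using b by (auto simp: fun_eq_iff mu_def)
qed

lemma mu_sandwich: "b < 3 \<Longrightarrow> c < 3 \<Longrightarrow> mmul i (mu a b (1, 0)) (mmul i X (mu c d (1, 0))) = mu a d (X b c)"
proof -
  assume b: "b < 3" and c: "c < 3"
  have 1: "mmul i X (mu c d (1, 0)) p q = (if q = d then X p c else 0)" for p q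
  proof -
    have "mmul i X (mu c d (1, 0)) p q = (\<Sum>m<3. if m = c then (if q = d then X p c else 0) else 0)"
      unfolding mmul_def mu_def by (intro sum.cong refl) (auto simp: kmul_zero kmul_one)
    then show ?thesis using c by simp
  qed
  have "mmul i (mu a b (1, 0)) (mmul i X (mu c d (1, 0))) p q
     = (\<Sum>m<3. if m = b then (if p = a \<and> q = d then X b c else 0) else 0)" for p q
    unfolding mmul_def[of i "mu a b (1, 0)"] 1 unfolding mu_def by (intro sum.cong refl) (auto simp: kmul_zero kmul_one)
  then show ?thesis using b by (auto simp: fun_eq_iff mu_def)
qed

lemma mu_scale: "mu a b (c, 0) = mscale c (mu a b (1, 0))"
  unfolding mu_def mscale_def fun_eq_iff by (auto simp: kscale_def zero_prod_def)

lemma dg_mu: "a < 3 \<Longrightarrow> b < 3 \<Longrightarrow> dg g g' (mu a b u) = mu b a (kscale (inverse (gam g b) * gam g' a) (kconj u))"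
  unfolding dg_def mu_def fun_eq_iff by (auto simp: kscale_def kconj_def zero_prod_def)

text \<open>A rank-one hermitian idempotent is \<open>d\<^sup>-\<^sup>1 v v\<^sup>\<dagger>\<close> for a column \<open>v\<close> (a matrix supported in
  the first column).\<close>

locale hermitian_matrices =
  fixes i :: "'k::field" and g :: "'k \<times> 'k \<times> 'k"
  assumes two: "(2::'k) \<noteq> 0" and i0: "i \<noteq> 0" and g: "g \<in> diag_GL3"
begin

abbreviation mul (infixl "\<odot>" 70) where "X \<odot> Y \<equiv> mmul i X Y"
abbreviation st where "st \<equiv> dg g g"
abbreviation E where "E \<equiv> mu 0 0 (1, 0) :: 'k kmat"

lemma st_mmul: "st (X \<odot> Y) = st Y \<odot> st X"
  by (rule dg_mmul[OF g])

lemma st_st: "X \<in> M3 \<Longrightarrow> st (st X) = X"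
  by (rule dg_dg[OF g g])

lemma st_E: "st E = E"
  using gam_nonzero[OF g, of 0] by (subst dg_mu) (simp_all add: kconj_def kscale_def)

lemma sandwich_E: "E \<odot> (X \<odot> E) = mu 0 0 (X 0 0)"
  by (rule mu_sandwich) simp_all

lemma hermitian_corner: "st X = X \<Longrightarrow> X 0 0 = (fst (X 0 0), 0)"
proof -
  assume "st X = X"
  then have "st X 0 0 = X 0 0" by simp
  then have "kconj (X 0 0) = X 0 0" using gam_nonzero[OF g, of 0] by (simp add: dg_def kscale_kscale)
  then show ?thesis by (rule kconj_fixed[OF two])
qed

text \<open>The values \<open>st W \<odot> (p \<odot> W)\<close> on columns are those of the
  hermitian form with matrix p, and they lie in k because the corner entry is self-conjugate. A
  nonzero diagonal entry is the value at a unit column; if the diagonal vanishes, polarisation at an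
  off-diagonal entry gives a nonzero value, as 2 is invertible.\<close>

lemma exists_anisotropic_column:
  assumes p: "p \<in> H3 g" "p \<noteq> 0"
  shows "\<exists>W\<in>M3. \<exists>d. d \<noteq> 0 \<and> W \<odot> E = W \<and> st W \<odot> (p \<odot> W) = mscale d E"
proof -
  have pM: "p \<in> M3" and ps: "st p = p" using p(1) unfolding H3_iff by auto
  have pab: "kscale (inverse (gam g a) * gam g b) (kconj (p b a)) = p a b" if "a < 3" "b < 3" for a b
    using ps that unfolding fun_eq_iff dg_def by metis
  have key: "\<exists>d. st W \<odot> (p \<odot> W) = mscale d E \<and> (d \<noteq> 0 \<longleftrightarrow> fst ((st W \<odot> (p \<odot> W)) 0 0) \<noteq> 0)"
    if W: "W \<in> M3" "W \<odot> E = W" for W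
  proof -
    have sW: "E \<odot> st W = st W" using W(2) st_mmul[of W E] st_E by simp
    have "st (st W \<odot> (p \<odot> W)) = st W \<odot> (p \<odot> W)"
      using W(1) by (simp add: st_mmul ps st_st mmul_assoc)
    then have h: "(st W \<odot> (p \<odot> W)) 0 0 = (fst ((st W \<odot> (p \<odot> W)) 0 0), 0)"
      by (rule hermitian_corner)
    have "st W \<odot> (p \<odot> W) = E \<odot> ((st W \<odot> (p \<odot> W)) \<odot> E)"
      by (metis mmul_assoc sW W(2))
    also have "\<dots> = mu 0 0 (fst ((st W \<odot> (p \<odot> W)) 0 0), 0)"
      unfolding sandwich_E by (subst h) (rule refl)
    finally show ?thesis unfolding mu_scale[of 0 0 "fst ((st W \<odot> (p \<odot> W)) 0 0)"]
      by (intro exI[of _ "fst ((st W \<odot> (p \<odot> W)) 0 0)"]) simp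
  qed
  show ?thesis
  proof (cases "\<exists>a<3. p a a \<noteq> 0")
    case True
    then obtain a where a: "a < 3" "p a a \<noteq> 0" by blast
    have WM: "mu a 0 (1, 0) \<in> M3" using a(1) by (intro mu_M3) simp_all
    have WE: "mu a 0 (1, 0) \<odot> E = mu a 0 (1, 0)" by (simp add: mmul_mu_mu kmul_one)
    have real: "p a a = (fst (p a a), 0)"
    proof -
      have "kconj (p a a) = p a a" using pab[OF a(1) a(1)] gam_nonzero[OF g, of a] by (simp add: kscale_kscale)
      then show ?thesis by (rule kconj_fixed[OF two])
    qed
    have "st (mu a 0 (1, 0)) = mscale (inverse (gam g 0) * gam g a) (mu 0 a (1, 0))"
      using a by (subst dg_mu) (simp_all add: kconj_def kscale_def mu_scale[of 0 a "inverse (gam g 0) * gam g a"])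
    then have "st (mu a 0 (1, 0)) \<odot> (p \<odot> mu a 0 (1, 0)) = mscale (inverse (gam g 0) * gam g a) (mu 0 0 (p a a))"
      using a by (simp add: mmul_mscale mu_sandwich)
    then have "fst ((st (mu a 0 (1, 0)) \<odot> (p \<odot> mu a 0 (1, 0))) 0 0) = inverse (gam g 0) * gam g a * fst (p a a)"
      by (simp add: mscale_def mu_def kscale_def)
    moreover have "fst (p a a) \<noteq> 0" using a(2) real by (auto simp: zero_prod_def)
    ultimately show ?thesis
      using key[OF WM WE] WM WE gam_nonzero[OF g] by (metis inverse_nonzero_iff_nonzero mult_eq_0_iff)
  next
    case False
    then have diag: "p a a = 0" if "a < 3" for a using that by blast
    obtain a b where ab: "a < 3" "b < 3" "p a b \<noteq> 0" "a \<noteq> b"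
    proof -
      obtain a b where "p a b \<noteq> 0" using p(2) by (auto simp: fun_eq_iff)
      moreover from this have "a < 3" "b < 3" using pM unfolding M3_def by (metis (mono_tags, lifting) mem_Collect_eq not_less)+
      ultimately show ?thesis using that diag by metis
    qed
    \<comment> \<open>\<open>u\<close> makes the real part of \<open>p a b\<close> times
      \<open>u\<close> nonzero: 1 does if the real part of \<open>p a b\<close> is nonzero, and
      otherwise \<open>p a b\<close> is a multiple of t, which t turns into an element of k.\<close>
    define u :: "'k \<times> 'k" where "u = (if fst (p a b) \<noteq> 0 then (1, 0) else (0, 1))"
    define W where "W = mu a 0 (1, 0) + mu b 0 u"
    have WM: "W \<in> M3" unfolding W_def using ab mu_M3 M3_closed(1) by (metis zero_less_numeral)
    have WE: "W \<odot> E = W" unfolding W_def mmul_add by (simp add: mmul_mu_mu kmul_one)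
    have Wa: "W a 0 = (1, 0)" "W b 0 = u" "\<And>m. m \<noteq> a \<Longrightarrow> m \<noteq> b \<Longrightarrow> W m 0 = 0"
      unfolding W_def mu_def using ab(4) by auto
    have pba: "p b a = kscale (inverse (gam g b) * gam g a) (kconj (p a b))"
      using pab[OF ab(2,1)] by simp
    have sub: "(\<Sum>m<3. f m) = f a + f b" if "\<And>m. m \<noteq> a \<Longrightarrow> m \<noteq> b \<Longrightarrow> f m = 0" for f :: "nat \<Rightarrow> 'k \<times> 'k"
    proof -
      have "(\<Sum>m<3. f m) = (\<Sum>m\<in>{a, b}. f m)"
        using ab that by (intro sum.mono_neutral_right) auto
      then show ?thesis using ab(4) by simp
    qed
    have pW: "(p \<odot> W) m 0 = p m a + kmul i (p m b) u" for m
      unfolding mmul_def by (subst sub) (simp_all add: Wa kmul_zero kmul_one)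
    have stW: "st W 0 m = kscale (inverse (gam g 0) * gam g m) (kconj (W m 0))" if "m < 3" for m
      using that by (simp add: dg_def)
    have st0: "st W 0 m = 0" if "m \<noteq> a" "m \<noteq> b" for m
      using that by (simp add: dg_def Wa kconj_def kscale_def zero_prod_def)
    have "(st W \<odot> (p \<odot> W)) 0 0 = kmul i (st W 0 a) ((p \<odot> W) a 0) + kmul i (st W 0 b) ((p \<odot> W) b 0)"
      unfolding mmul_def[of i "st W"] by (rule sub) (simp add: st0 kmul_zero)
    also have "\<dots> = kscale (inverse (gam g 0) * gam g a) (kmul i (p a b) u)
       + kmul i (kscale (inverse (gam g 0) * gam g b) (kconj u)) (kscale (inverse (gam g b) * gam g a) (kconj (p a b)))"
      unfolding stW[OF ab(1)] stW[OF ab(2)] pW Wa diag[OF ab(1)] diag[OF ab(2)] pba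
      by (simp add: kconj_def[of "(1, 0)"] kmul_kscale kmul_one kmul_zero)
    also have "fst \<dots> = inverse (gam g 0) * gam g a * (2 * fst (kmul i (p a b) u))"
      using gam_nonzero[OF g, of b] gam_nonzero[OF g, of 0] by (simp add: kscale_def kmul_def kconj_def field_simps)
    finally have "fst ((st W \<odot> (p \<odot> W)) 0 0) = inverse (gam g 0) * gam g a * (2 * fst (kmul i (p a b) u))" .
    moreover have "fst (kmul i (p a b) u) \<noteq> 0"
      unfolding u_def kmul_def using ab(3) i0 by (auto simp: zero_prod_def prod_eq_iff)
    ultimately show ?thesis
      using key[OF WM WE] WM WE gam_nonzero[OF g] two by (metis inverse_nonzero_iff_nonzero mult_eq_0_iff)
  qed
qed

text \<open>Take v = p W for an anisotropic column W. The rank condition makes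
  \<open>v \<odot> st v\<close> a multiple of p, anisotropy makes \<open>st v \<odot> v\<close> a
  nonzero multiple of \<open>E\<close>, and evaluating \<open>v \<odot> st v \<odot> v\<close> both
  ways shows that the two scalars agree.\<close>

lemma rank_one_idempotent:
  assumes p: "p \<in> H3 g" "p \<noteq> 0" "p \<odot> p = p"
    and rank: "\<And>Y. Y \<in> H3 g \<Longrightarrow> \<exists>c. p \<odot> (Y \<odot> p) = mscale c p"
  shows "\<exists>v\<in>M3. \<exists>d. d \<noteq> 0 \<and> v \<odot> E = v \<and> v \<odot> st v = mscale d p \<and> st v \<odot> v = mscale d E"
proof -
  have ps: "st p = p" and pM: "p \<in> M3" using p(1) unfolding H3_iff by auto
  obtain W d where W: "W \<in> M3" "d \<noteq> 0" "W \<odot> E = W" "st W \<odot> (p \<odot> W) = mscale d E"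
    using exists_anisotropic_column[OF p(1,2)] by blast
  define v where "v = p \<odot> W"
  have vM: "v \<in> M3" unfolding v_def using pM W(1) M3_closed(2) by blast
  have vE: "v \<odot> E = v" unfolding v_def mmul_assoc W(3) ..
  have sv: "st v = st W \<odot> p" unfolding v_def st_mmul ps ..
  have "W \<odot> st W \<in> H3 g"
    unfolding H3_iff using W(1) M3_closed(2)[OF W(1) M3_closed(4)] by (simp add: st_mmul st_st)
  then obtain c where c: "p \<odot> ((W \<odot> st W) \<odot> p) = mscale c p" using rank by blast
  have vv: "v \<odot> st v = mscale c p"
    unfolding sv unfolding v_def using c by (simp add: mmul_assoc)
  have svv: "st v \<odot> v = mscale d E"
    unfolding sv unfolding v_def using W(4) p(3) by (metis mmul_assoc)
  have "mscale c v = mscale d v"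
  proof -
    have "(v \<odot> st v) \<odot> v = v \<odot> (st v \<odot> v)" by (rule mmul_assoc)
    then have "mscale c (p \<odot> v) = mscale d (v \<odot> E)" unfolding vv svv mmul_mscale .
    moreover have "p \<odot> v = v" unfolding v_def using p(3) by (metis mmul_assoc)
    ultimately show ?thesis unfolding vE by simp
  qed
  then have "mscale (c - d) v = 0"
    unfolding mscale_def fun_eq_iff kscale_def by (simp add: zero_prod_def algebra_simps)
  moreover have "v \<noteq> 0"
  proof
    assume "v = 0"
    then have "mscale d E = 0" using svv by (simp add: mmul_zero)
    then have "E = (0 :: 'k kmat)" using mscale_eq_0 W(2) by blast
    then have "E 0 0 = (0 :: 'k kmat) 0 0" by simp
    then show False by (simp add: mu_def zero_prod_def)
  qed
  ultimately have "c = d" using mscale_eq_0[of "c - d" v] by auto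
  then show ?thesis using vM W(2) vE vv svv by blast
qed

text \<open>Multiplying the Jordan relation by p on either side gives p q = - p q p = q p, hence 2 p
  q = 0.\<close>

lemma orthogonal_idempotents:
  assumes p: "p \<odot> p = p" "q \<odot> q = q" and pq: "p \<odot> q + q \<odot> p = 0"
  shows "p \<odot> q = 0"
proof -
  have "p \<odot> (p \<odot> q + q \<odot> p) = 0" "(p \<odot> q + q \<odot> p) \<odot> p = 0" unfolding pq mmul_zero by simp_all
  then have "p \<odot> q + p \<odot> (q \<odot> p) = 0" "p \<odot> (q \<odot> p) + q \<odot> p = 0"
    unfolding mmul_add using p(1) by (metis mmul_assoc)+
  then have "p \<odot> q = q \<odot> p" by (metis add.commute add_left_cancel)
  then have "mscale 2 (p \<odot> q) = 0"
    using pq mscale_add(2)[of 1 1 "p \<odot> q"] by (simp add: mscale_mscale)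
  then show ?thesis using mscale_eq_0 two by blast
qed

text \<open>The Peirce space of two frame elements carries a multiple of the norm of K: an element Y of it with
  square \<open>c (p + q)\<close> forces \<open>c d d'\<close> to be a norm.\<close>

lemma peirce_norm:
  assumes v: "v \<in> M3" "v \<odot> E = v" "v \<odot> st v = mscale d p" "st v \<odot> v = mscale d E" "d \<noteq> 0"
    and w: "w \<in> M3" "w \<odot> E = w" "w \<odot> st w = mscale d' q" "st w \<odot> w = mscale d' E" "d' \<noteq> 0"
    and p: "p \<odot> p = p" and q: "q \<odot> q = q" and pq: "p \<odot> q = 0" "q \<odot> p = 0"
    and Y: "st Y = Y" "Y \<in> M3" "p \<odot> Y + Y \<odot> p = Y" "q \<odot> Y + Y \<odot> q = Y" "Y \<odot> Y = mscale c (p + q)"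
  shows "\<exists>s. knorm i s = c * d * d'"
proof -
  have pv: "p \<odot> v = v"
  proof -
    have "mscale d (p \<odot> v) = (v \<odot> st v) \<odot> v" unfolding v(3) mmul_mscale ..
    also have "\<dots> = mscale d v" unfolding mmul_assoc v(4) mmul_mscale v(2) ..
    finally have "mscale (inverse d) (mscale d (p \<odot> v)) = mscale (inverse d) (mscale d v)" by simp
    then show ?thesis using v(5) by (simp add: mscale_mscale)
  qed
  have qv: "q \<odot> v = 0" using pv pq(2) by (metis mmul_assoc mmul_zero(1))
  have qYv: "q \<odot> (Y \<odot> v) = Y \<odot> v"
  proof -
    have "(q \<odot> Y + Y \<odot> q) \<odot> v = Y \<odot> v" unfolding Y(4) ..
    then show ?thesis unfolding mmul_add mmul_assoc qv mmul_zero by simp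
  qed
  have Ev: "E \<odot> st v = st v" using v(2) st_mmul[of v E] st_E by simp
  \<comment> \<open>Y carries the line of w to the line of v, and \<open>S\<close> is its single
    K-entry. Its product with its adjoint is a norm from K, and also computable from the square of
    Y.\<close>
  define S where "S = st v \<odot> (Y \<odot> w)"
  have SE: "S = mu 0 0 (S 0 0)"
  proof -
    have "S = E \<odot> (S \<odot> E)" unfolding S_def by (metis Ev mmul_assoc w(2))
    then show ?thesis unfolding sandwich_E .
  qed
  have "S \<odot> st S = mscale (c * d * d') E"
  proof -
    have "S \<odot> st S = st v \<odot> (Y \<odot> ((w \<odot> st w) \<odot> (Y \<odot> v)))"
      unfolding S_def st_mmul Y(1) st_st[OF v(1)] mmul_assoc ..
    also have "\<dots> = mscale d' (st v \<odot> (Y \<odot> (Y \<odot> v)))"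
      unfolding w(3) mmul_mscale qYv ..
    also have "\<dots> = mscale d' (st v \<odot> ((Y \<odot> Y) \<odot> v))" unfolding mmul_assoc ..
    also have "\<dots> = mscale d' (mscale c (st v \<odot> v))"
      unfolding Y(5) mmul_mscale mmul_add pv qv mmul_zero by simp
    also have "\<dots> = mscale (c * d * d') E" unfolding v(4) mscale_mscale by (simp add: mult_ac)
    finally show ?thesis .
  qed
  moreover have "S \<odot> st S = mscale (knorm i (S 0 0)) E"
  proof -
    have "st S = mu 0 0 (kconj (S 0 0))"
      using gam_nonzero[OF g, of 0] by (subst SE, subst dg_mu) (simp_all add: kscale_kscale)
    then show ?thesis
      by (subst (1) SE) (simp add: mmul_mu_mu kmul_kconj mu_scale[of 0 0 "knorm i (S 0 0)"])
  qed
  ultimately have "mscale (knorm i (S 0 0)) E 0 0 = mscale (c * d * d') E 0 0" by simp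
  then show ?thesis by (intro exI[of _ "S 0 0"]) (simp add: mscale_def mu_def kscale_def)
qed

end

section \<open>Vectors over K, cross products and similitudes\<close>

definition hf :: "'k::field \<Rightarrow> 'k \<times> 'k \<times> 'k \<Rightarrow> (nat \<Rightarrow> 'k \<times> 'k) \<Rightarrow> (nat \<Rightarrow> 'k \<times> 'k) \<Rightarrow> 'k \<times> 'k" where
  "hf i d u v = (\<Sum>m<3. kscale (gam d m) (kmul i (u m) (kconj (v m))))"

lemma hf_eq: "hf i d u v = (hre i d u v, him d u v)"
  unfolding hf_def hre_def him_def sum3 kscale_def kmul_def kconj_def by (simp add: algebra_simps)

definition vmul :: "'k::field \<Rightarrow> 'k \<times> 'k \<Rightarrow> (nat \<Rightarrow> 'k \<times> 'k) \<Rightarrow> nat \<Rightarrow> 'k \<times> 'k" where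
  "vmul i c u = (\<lambda>m. kmul i c (u m))"

lemma hf_vmul: "hf i d (vmul i c u) (vmul i c' v) = kmul i (kmul i c (kconj c')) (hf i d u v)"
proof -
  have "kscale s (kmul i (kmul i c x) (kconj (kmul i c' y)))
      = kmul i (kmul i c (kconj c')) (kscale s (kmul i x (kconj y)))" for s x y
    unfolding kmul_def kconj_def kscale_def by (simp add: algebra_simps)
  then show ?thesis unfolding hf_def vmul_def kmul_sum by simp
qed

text \<open>The weights are ab divided by the diagonal coefficients a, b, ab. Pairing the cross
  product with w therefore gives ab times the conjugate of det(u, v, w), which explains
  orthogonality, and the Lagrange identity holds with no extra factor in
  \<open>cross_norm\<close>.\<close>

definition cross :: "'k::field \<Rightarrow> 'k \<times> 'k \<Rightarrow> (nat \<Rightarrow> 'k \<times> 'k) \<Rightarrow> (nat \<Rightarrow> 'k \<times> 'k) \<Rightarrow> nat \<Rightarrow> 'k \<times> 'k" where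
  "cross i p u v = (\<lambda>m. if m = 0 then kscale (snd p) (kconj (kmul i (u 1) (v 2) - kmul i (u 2) (v 1)))
     else if m = 1 then kscale (fst p) (kconj (kmul i (u 2) (v 0) - kmul i (u 0) (v 2)))
     else kconj (kmul i (u 0) (v 1) - kmul i (u 1) (v 0)))"

abbreviation form3 :: "'k::field \<times> 'k \<Rightarrow> 'k \<times> 'k \<times> 'k" where
  "form3 p \<equiv> (fst p, snd p, fst p * snd p)"

lemma gam_simps: "gam (x, y, z) 0 = x" "gam (x, y, z) 1 = y" "gam (x, y, z) 2 = z"
  by (simp_all add: gam_def)

lemma cross_simps:
  "cross i p u v 0 = kscale (snd p) (kconj (kmul i (u 1) (v 2) - kmul i (u 2) (v 1)))"
  "cross i p u v 1 = kscale (fst p) (kconj (kmul i (u 2) (v 0) - kmul i (u 0) (v 2)))"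
  "cross i p u v 2 = kconj (kmul i (u 0) (v 1) - kmul i (u 1) (v 0))"
  unfolding cross_def by simp_all

lemma cross_perp: "hf i (form3 p) (cross i p u v) u = 0" "hf i (form3 p) (cross i p u v) v = 0"
  unfolding hf_def sum3 gam_simps cross_simps kscale_def kmul_def kconj_def
  by (simp_all add: algebra_simps zero_prod_def)

lemma cross_norm:
  "hre i (form3 p) (cross i p u v) (cross i p u v)
    = hre i (form3 p) u u * hre i (form3 p) v v - knorm i (hf i (form3 p) u v)"
  unfolding hf_eq unfolding hre_def him_def sum3 gam_simps cross_simps kscale_def kmul_def kconj_def knorm_def
    fst_conv snd_conv minus_prod_def
  by algebra

text \<open>The form \<open>det(g) \<langle>g\<^sub>0, g\<^sub>1, g\<^sub>2\<rangle>\<close> is isometric to \<open>\<langle>a, b, ab\<rangle>\<close> for \<open>(a, b) = param g\<close>, by the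
  rescaling \<open>stretch\<close>.\<close>

definition param :: "'k::field \<times> 'k \<times> 'k \<Rightarrow> 'k \<times> 'k" where
  "param g = (gam g 1 * gam g 2, gam g 0 * gam g 2)"

definition det_gam :: "'k::field \<times> 'k \<times> 'k \<Rightarrow> 'k" where
  "det_gam g = gam g 0 * gam g 1 * gam g 2"

definition stretch :: "'k::field \<times> 'k \<times> 'k \<Rightarrow> (nat \<Rightarrow> 'k \<times> 'k) \<Rightarrow> nat \<Rightarrow> 'k \<times> 'k" where
  "stretch g z m = (if m < 2 then kscale (gam g m) (z m) else z m)"

lemma stretch_simps: "stretch g z 0 = kscale (gam g 0) (z 0)" "stretch g z 1 = kscale (gam g 1) (z 1)" "stretch g z 2 = z 2"
  unfolding stretch_def by simp_all

lemma hf_stretch: "hf i (form3 (param g)) (stretch g u) (stretch g v) = kscale (det_gam g) (hf i g u v)"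
  unfolding hf_def sum3 gam_simps param_def stretch_simps det_gam_def fst_conv snd_conv
  unfolding kscale_def kmul_def kconj_def
  by (simp add: algebra_simps)

lemma H3_closed:
  assumes "g \<in> diag_GL3" "X \<in> H3 g" "Y \<in> H3 g"
  shows "X + Y \<in> H3 g" "mscale c X \<in> H3 g" "jprod i X Y \<in> H3 g"
  using assms(2,3) unfolding H3_iff jprod_def madd_plus
  by (auto intro!: M3_closed simp: dg_add dg_mscale dg_mmul[OF assms(1)] add.commute)

text \<open>Conjugation by P works because the inverse of P is its adjoint divided by \<mu>: the
  factors \<mu> and 1 / \<mu> on the two sides cancel when the adjoint of P X Q is taken, so
  hermitian matrices stay hermitian.\<close>

lemma H3_iso_of_similitude:
  fixes i :: "'k::field"
  assumes g: "g \<in> diag_GL3" "g' \<in> diag_GL3" and P: "P \<in> M3" and \<mu>: "\<mu> \<noteq> 0"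
    and PP: "mmul i (dg g g' P) P = mscale \<mu> mone"
  shows "H3_iso i g g'"
proof -
  define Q where "Q = mscale (inverse \<mu>) (dg g g' P)"
  have Q: "Q \<in> M3" unfolding Q_def by (intro M3_closed)
  have QP: "mmul i Q P = mone" unfolding Q_def mmul_mscale PP mscale_mscale using \<mu> by (simp add: mscale_mscale)
  have PQ: "mmul i P Q = mone" by (rule mmul_left_right_inverse[OF P Q QP])
  have dP: "dg g g' P = mscale \<mu> Q" unfolding Q_def mscale_mscale using \<mu> by (simp add: mscale_mscale)
  have dQ: "dg g' g Q = mscale (inverse \<mu>) P" unfolding Q_def dg_mscale dg_dg[OF g P] ..
  have c: "mmul i P (mmul i Q X) = X" "mmul i Q (mmul i P X) = X" if "X \<in> M3" for X
    unfolding mmul_assoc[symmetric] PQ QP mmul_mone(1)[OF that] by simp_all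
  define \<phi> where "\<phi> X = mmul i P (mmul i X Q)" for X
  define \<psi> where "\<psi> X = mmul i Q (mmul i X P)" for X
  have \<phi>H: "\<phi> X \<in> H3 g'" if "X \<in> H3 g" for X
  proof -
    have X: "X \<in> M3" "dg g g X = X" using that unfolding H3_iff by auto
    have "dg g' g' (\<phi> X) = mmul i (mmul i (dg g' g Q) (dg g g X)) (dg g g' P)"
      unfolding \<phi>_def dg_mmul[OF g(1)] ..
    also have "\<dots> = \<phi> X"
      unfolding dP dQ X(2) mmul_mscale mscale_mscale \<phi>_def mmul_assoc using \<mu> by (simp add: mscale_mscale)
    finally show ?thesis unfolding H3_iff \<phi>_def using P Q X by (intro conjI M3_closed)
  qed
  have \<psi>H: "\<psi> X \<in> H3 g" if "X \<in> H3 g'" for X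
  proof -
    have X: "X \<in> M3" "dg g' g' X = X" using that unfolding H3_iff by auto
    have "dg g g (\<psi> X) = mmul i (mmul i (dg g g' P) (dg g' g' X)) (dg g' g Q)"
      unfolding \<psi>_def dg_mmul[OF g(2)] ..
    also have "\<dots> = \<psi> X"
      unfolding dP dQ X(2) mmul_mscale mscale_mscale \<psi>_def mmul_assoc using \<mu> by (simp add: mscale_mscale)
    finally show ?thesis unfolding H3_iff \<psi>_def using P Q X by (intro conjI M3_closed)
  qed
  have HM: "X \<in> M3" if "X \<in> H3 d" for X :: "'k kmat" and d using that unfolding H3_iff by blast
  have "\<psi> (\<phi> X) = X" if "X \<in> M3" for X
  proof -
    have "\<psi> (\<phi> X) = mmul i (mmul i Q P) (mmul i X (mmul i Q P))" unfolding \<psi>_def \<phi>_def by (simp only: mmul_assoc)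
    then show ?thesis unfolding QP by (simp add: mmul_mone that)
  qed
  moreover have "\<phi> (\<psi> X) = X" if "X \<in> M3" for X
  proof -
    have "\<phi> (\<psi> X) = mmul i (mmul i P Q) (mmul i X (mmul i P Q))" unfolding \<psi>_def \<phi>_def by (simp only: mmul_assoc)
    then show ?thesis unfolding PQ by (simp add: mmul_mone that)
  qed
  ultimately have "bij_betw \<phi> (H3 g) (H3 g')"
    using \<phi>H \<psi>H HM by (intro bij_betw_byWitness[where f' = \<psi>]) auto
  moreover have "\<phi> (jprod i X Y) = jprod i (\<phi> X) (\<phi> Y)" if "X \<in> H3 g" "Y \<in> H3 g" for X Y
  proof -
    have "mmul i (\<phi> X) (\<phi> Y) = \<phi> (mmul i X Y)" if "Y \<in> M3" for X Y
      unfolding \<phi>_def mmul_assoc by (subst c(2)) (use that Q in \<open>simp_all add: M3_closed\<close>)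
    then have "mmul i (\<phi> X) (\<phi> Y) = \<phi> (mmul i X Y)" "mmul i (\<phi> Y) (\<phi> X) = \<phi> (mmul i Y X)"
      using that HM by blast+
    then show ?thesis unfolding jprod_def madd_plus by (simp add: \<phi>_def mat_lin)
  qed
  moreover have "\<phi> (madd X Y) = madd (\<phi> X) (\<phi> Y)" "\<phi> (mscale c X) = mscale c (\<phi> X)" for X Y c
    unfolding madd_plus \<phi>_def mat_lin by simp_all
  ultimately show ?thesis unfolding H3_iso_def by blast
qed

text \<open>The two given vectors and their cross product, suitably rescaled, are the columns of a
  similitude from the form g to the form g'. The multiplier is the quotient of the
  determinants.\<close>

lemma represents_imp_H3_iso:
  fixes i :: "'k::field"
  assumes g: "g \<in> diag_GL3" "g' \<in> diag_GL3" and r: "represents i (param g') (param g)"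
  shows "H3_iso i g g'"
proof -
  let ?F = "form3 (param g')"
  obtain u v where uv: "hre i ?F u u = gam g 1 * gam g 2" "hre i ?F v v = gam g 0 * gam g 2"
      "hre i ?F u v = 0" "him ?F u v = 0"
    using r unfolding represents_def Let_def param_def[of g] fst_conv snd_conv by blast
  define w where "w = cross i (param g') u v"
  have him0: "him d x x = 0" for d :: "'k \<times> 'k \<times> 'k" and x unfolding him_def by (simp add: mult.commute)
  have sw: "hf i d y x = kconj (hf i d x y)" for d x y
    unfolding hf_eq hre_def him_def sum3 kconj_def by (simp add: algebra_simps)
  have huv: "hf i ?F u v = 0" "hf i ?F v u = 0"
    using uv sw[of ?F v u] by (simp_all add: hf_eq zero_prod_def kconj_def)
  have hwu: "hf i ?F w u = 0" "hf i ?F w v = 0" "hf i ?F u w = 0" "hf i ?F v w = 0"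
    using cross_perp[of i "param g'" u v] sw[of ?F u w] sw[of ?F v w] unfolding w_def
    by (simp_all add: kconj_def zero_prod_def)
  have hww: "hre i ?F w w = (gam g 1 * gam g 2) * (gam g 0 * gam g 2)"
    unfolding w_def cross_norm huv uv by (simp add: knorm_def)
  \<comment> \<open>The factors g0, g1 and 1 turn the values g1 g2, g0 g2 and their product into
    det(g) g0, det(g) g1 and det(g) g2.\<close>
  define f where "f b = (if b = 0 then vmul i (gam g 0, 0) u else if b = 1 then vmul i (gam g 1, 0) v
      else vmul i (1, 0) w)" for b :: nat
  have ff: "hf i ?F (f b) (f a) = (if a = b then (det_gam g * gam g a, 0) else 0)" if "a < 3" "b < 3" for a b
  proof -
    have "a = 0 \<or> a = 1 \<or> a = 2" "b = 0 \<or> b = 1 \<or> b = 2" using that by auto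
    moreover have h: "hf i ?F u u = (gam g 1 * gam g 2, 0)" "hf i ?F v v = (gam g 0 * gam g 2, 0)"
      "hf i ?F w w = ((gam g 1 * gam g 2) * (gam g 0 * gam g 2), 0)"
      unfolding hf_eq uv hww him0 by simp_all
    moreover have f: "f 0 = vmul i (gam g 0, 0) u" "f 1 = vmul i (gam g 1, 0) v" "f 2 = vmul i (1, 0) w"
      unfolding f_def by simp_all
    ultimately show ?thesis
      by (elim disjE; hypsubst; unfold f hf_vmul huv hwu h kmul_zero; simp add: kmul_def kconj_def det_gam_def)
  qed
  \<comment> \<open>Dividing the first two coordinates undoes \<open>stretch\<close>, so these
    columns live in the space of the form g' itself.\<close>
  define P where "P m b = (if m < 3 \<and> b < 3 then (if m < 2 then kscale (inverse (gam g' m)) (f b m) else f b m) else 0)" for m b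
  have PM: "P \<in> M3" unfolding P_def M3_def by auto
  have st: "stretch g' (\<lambda>m. P m b) m = f b m" if "b < 3" "m < 3" for b m
    unfolding stretch_def P_def using that gam_nonzero[OF g(2), of m] by (simp add: kscale_kscale)
  have hP: "kscale (det_gam g') (hf i g' (\<lambda>m. P m b) (\<lambda>m. P m a)) = hf i ?F (f b) (f a)" if "a < 3" "b < 3" for a b
    unfolding hf_stretch[symmetric] unfolding hf_def using that by (simp add: st)
  have d0: "det_gam g \<noteq> 0" "det_gam g' \<noteq> 0" unfolding det_gam_def using gam_nonzero[OF g(1)] gam_nonzero[OF g(2)] by simp_all
  have "mmul i (dg g g' P) P = mscale (det_gam g / det_gam g') mone"
  proof (intro ext)
    fix a b
    show "mmul i (dg g g' P) P a b = mscale (det_gam g / det_gam g') mone a b"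
    proof (cases "a < 3 \<and> b < 3")
      case True
      have "mmul i (dg g g' P) P a b = kscale (inverse (gam g a)) (hf i g' (\<lambda>m. P m b) (\<lambda>m. P m a))"
        unfolding mmul_def hf_def kscale_sum using True
        by (intro sum.cong refl) (simp add: dg_def kmul_kscale kscale_kscale kmul_comm[of i "P _ b"])
      also have "hf i g' (\<lambda>m. P m b) (\<lambda>m. P m a) = kscale (inverse (det_gam g')) (hf i ?F (f b) (f a))"
        using True d0 by (simp flip: hP add: kscale_kscale)
      finally show ?thesis
        using True gam_nonzero[OF g(1), of a] d0
        by (auto simp: ff mscale_def mone_def kscale_def zero_prod_def divide_simps)
    next
      case False
      then have "mmul i (dg g g' P) P a b = 0" unfolding mmul_def dg_def P_def by (auto simp: kmul_zero)
      then show ?thesis using False by (auto simp: mscale_def mone_def kscale_def zero_prod_def)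
    qed
  qed
  moreover have "det_gam g / det_gam g' \<noteq> 0" using d0 by simp
  ultimately show ?thesis by (intro H3_iso_of_similitude[OF g PM])
qed

text \<open>Only the Jordan product is preserved, so whatever is carried through
  \<open>\<phi>\<close> must be expressible by it: idempotency, orthogonality, rank one through
  \<open>U\<close>, and Peirce membership. The images of the diagonal idempotents then give
  orthogonal vectors \<open>w j\<close> of the target form with values \<open>D j\<close>, which are
  still to be corrected by norms from K.\<close>

lemma H3_iso_imp_represents:
  fixes i :: "'k::field"
  assumes two: "(2::'k) \<noteq> 0" and i0: "i \<noteq> 0" and g: "g \<in> diag_GL3" "g' \<in> diag_GL3" and iso: "H3_iso i g g'"
  shows "represents i (param g') (param g)"
proof -
  interpret S: hermitian_matrices i g using two i0 g by unfold_locales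
  interpret T: hermitian_matrices i g' using two i0 g by unfold_locales
  let ?m = "mmul i"
  obtain \<phi> where bij: "bij_betw \<phi> (H3 g) (H3 g')"
    and add: "\<And>X Y. X \<in> H3 g \<Longrightarrow> Y \<in> H3 g \<Longrightarrow> \<phi> (X + Y) = \<phi> X + \<phi> Y"
    and jordan: "\<And>X Y. X \<in> H3 g \<Longrightarrow> Y \<in> H3 g \<Longrightarrow> \<phi> (jprod i X Y) = jprod i (\<phi> X) (\<phi> Y)"
    and scale: "\<And>c X. X \<in> H3 g \<Longrightarrow> \<phi> (mscale c X) = mscale c (\<phi> X)"
    using iso unfolding H3_iso_def madd_plus by blast
  have \<phi>H: "X \<in> H3 g \<Longrightarrow> \<phi> X \<in> H3 g'" for X using bij by (auto simp: bij_betw_def)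
  have \<phi>inj: "X = Y" if "\<phi> X = \<phi> Y" "X \<in> H3 g" "Y \<in> H3 g" for X Y
    using bij that by (auto simp: bij_betw_def inj_on_def)
  have \<phi>surj: "\<exists>X\<in>H3 g. \<phi> X = Y" if "Y \<in> H3 g'" for Y using bij that by (force simp: bij_betw_def)
  have zH: "(0 :: 'k kmat) \<in> H3 d" for d
    unfolding H3_iff by (auto simp: M3_closed dg_def fun_eq_iff kconj_def kscale_def zero_prod_def)
  have \<phi>0: "\<phi> 0 = 0" using scale[OF zH, of 0] by (simp add: mscale_zero)
  have half: "mscale 2 (mscale (1/2) X) = (X :: 'k kmat)" "mscale (1/2) (mscale 2 X) = X" for X
    using two by (simp_all add: mscale_mscale)
  have dbl: "X + X = mscale 2 X" for X :: "'k kmat"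
    using mscale_add(2)[of 1 1 X] by (simp add: mscale_mscale)
  have jsq: "jprod i X X = ?m X X" for X
    unfolding jprod_def madd_plus dbl half ..
  have j2: "mscale 2 (jprod i X Y) = ?m X Y + ?m Y X" for X Y
    unfolding jprod_def madd_plus half ..
  \<comment> \<open>This expresses the associative corner p X p by Jordan products, which lets the
    isomorphism transport the rank-one condition.\<close>
  have U: "?m p (?m X p) + jprod i p X = mscale 2 (jprod i p (jprod i p X))" if "?m p p = p" for p X
  proof -
    have pp: "?m p (?m p Z) = ?m p Z" "?m (?m Z p) p = ?m Z p" for Z
      unfolding mmul_assoc[symmetric] that by (simp_all add: mmul_assoc that)
    have "mscale 2 (mscale 2 (jprod i p (jprod i p X))) = ?m p (mscale 2 (jprod i p X)) + ?m (mscale 2 (jprod i p X)) p"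
      unfolding j2[of p "jprod i p X"] mscale_add mmul_mscale ..
    also have "\<dots> = ?m p X + ?m X p + (?m p (?m X p) + ?m p (?m X p))"
      unfolding j2 mmul_add by (simp add: pp that mmul_assoc algebra_simps)
    also have "\<dots> = mscale 2 (?m p (?m X p) + jprod i p X)"
      unfolding mscale_add j2[of p X] unfolding dbl[symmetric] by (simp add: algebra_simps)
    finally have "mscale (1/2) (mscale 2 (mscale 2 (jprod i p (jprod i p X)))) = mscale (1/2) (mscale 2 (?m p (?m X p) + jprod i p X))"
      by simp
    then show ?thesis unfolding half by simp
  qed
  define e where "e j = mu j j (1, 0 :: 'k)" for j :: nat
  have eH: "e j \<in> H3 g" if "j < 3" for j
    unfolding H3_iff e_def using that gam_nonzero[OF g(1), of j]
    by (simp add: mu_M3 dg_mu kconj_def kscale_def)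
  have ee: "?m (e j) (e k) = (if j = k then e j else 0)" if "j < 3" "k < 3" for j k
    unfolding e_def using that by (simp add: mmul_mu_mu kmul_one)
  define p where "p j = \<phi> (e j)" for j
  have pH: "p j \<in> H3 g'" if "j < 3" for j unfolding p_def using \<phi>H eH that by blast
  have pp: "?m (p j) (p j) = p j" if "j < 3" for j
    using jordan[OF eH[OF that] eH[OF that]] ee[OF that that] unfolding jsq p_def by simp
  have pq: "?m (p j) (p k) = 0" if "j < 3" "k < 3" "j \<noteq> k" for j k
  proof -
    have "jprod i (e j) (e k) = 0" unfolding jprod_def madd_plus using ee that by (simp add: mscale_zero)
    then have "jprod i (p j) (p k) = 0" using jordan[OF eH[OF that(1)] eH[OF that(2)]] \<phi>0 unfolding p_def by simp
    then have "?m (p j) (p k) + ?m (p k) (p j) = 0" using j2[of "p j" "p k"] by (simp add: mscale_zero)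
    then show ?thesis by (rule T.orthogonal_idempotents[OF pp[OF that(1)] pp[OF that(2)]])
  qed
  have p0: "p j \<noteq> 0" if "j < 3" for j
  proof
    assume "p j = 0"
    then have "e j = 0" using \<phi>inj[OF _ eH[OF that] zH] \<phi>0 unfolding p_def by simp
    then have "e j j j = 0" by simp
    then show False by (simp add: e_def mu_def zero_prod_def)
  qed
  have rank: "\<exists>c. ?m (p j) (?m Y (p j)) = mscale c (p j)" if j: "j < 3" and Y: "Y \<in> H3 g'" for j Y
  proof -
    obtain X where X: "X \<in> H3 g" "\<phi> X = Y" using \<phi>surj[OF Y] by blast
    have Xs: "dg g g X = X" using X unfolding H3_iff by blast
    have "kconj (X j j) = X j j"
    proof -
      have "dg g g X j j = X j j" using Xs by simp
      then show ?thesis using j gam_nonzero[OF g(1), of j] by (simp add: dg_def kscale_kscale)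
    qed
    then have "X j j = (fst (X j j), 0)" by (rule kconj_fixed[OF two])
    then have eXe: "?m (e j) (?m X (e j)) = mscale (fst (X j j)) (e j)"
      unfolding e_def mu_sandwich[OF j j] mu_scale[symmetric] by simp
    have jH: "jprod i (e j) X \<in> H3 g" by (rule H3_closed(3)[OF g(1) eH[OF j] X(1)])
    have "mscale (fst (X j j)) (e j) + jprod i (e j) X = mscale 2 (jprod i (e j) (jprod i (e j) X))"
      using U[of "e j" X] ee[OF j j] eXe by simp
    then have "\<phi> (mscale (fst (X j j)) (e j) + jprod i (e j) X) = \<phi> (mscale 2 (jprod i (e j) (jprod i (e j) X)))"
      by simp
    then have "mscale (fst (X j j)) (p j) + jprod i (p j) Y = mscale 2 (jprod i (p j) (jprod i (p j) Y))"
      using X eH[OF j] jH H3_closed[OF g(1) eH[OF j] eH[OF j]] H3_closed(3)[OF g(1) eH[OF j] jH]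
      by (simp add: add jordan scale p_def)
    also have "\<dots> = ?m (p j) (?m Y (p j)) + jprod i (p j) Y" using U[OF pp[OF j]] by simp
    finally show ?thesis by (metis add_right_cancel)
  qed
  have "\<forall>j. \<exists>v d. j < 3 \<longrightarrow> v \<in> M3 \<and> d \<noteq> 0 \<and> ?m v T.E = v \<and> ?m v (T.st v) = mscale d (p j) \<and> ?m (T.st v) v = mscale d T.E"
    using T.rank_one_idempotent[OF pH p0 pp rank] by blast
  then obtain v d where v: "\<And>j. j < 3 \<Longrightarrow> v j \<in> M3" "\<And>j. j < 3 \<Longrightarrow> d j \<noteq> 0" "\<And>j. j < 3 \<Longrightarrow> ?m (v j) T.E = v j"
    "\<And>j. j < 3 \<Longrightarrow> ?m (v j) (T.st (v j)) = mscale (d j) (p j)" "\<And>j. j < 3 \<Longrightarrow> ?m (T.st (v j)) (v j) = mscale (d j) T.E"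
    by metis
  have norms: "\<exists>s. knorm i s = (inverse (gam g k) * gam g j) * d j * d k" if jk: "j < 3" "k < 3" "j \<noteq> k" for j k
  proof -
    \<comment> \<open>The entry 1 at (j, k) and hermitian symmetry force the entry g j / g k at (k,
      j). That constant is also the factor in the square of \<open>X\<close>.\<close>
    define X where "X = mu j k (1, 0) + mu k j (inverse (gam g k) * gam g j, 0)"
    have one: "inverse (gam g j) * gam g k * (inverse (gam g k) * gam g j) = 1"
      using gam_nonzero[OF g(1), of j] gam_nonzero[OF g(1), of k] by (simp add: field_simps)
    have XH: "X \<in> H3 g"
      unfolding H3_iff X_def using jk gam_nonzero[OF g(1), of j] gam_nonzero[OF g(1), of k]
        one by (auto simp: M3_closed mu_M3 dg_add dg_mu kconj_def kscale_def add.commute)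
    have eX: "?m (e j) X + ?m X (e j) = X" "?m (e k) X + ?m X (e k) = X"
      unfolding e_def X_def mmul_add using jk by (simp_all add: mmul_mu_mu kmul_one add.commute)
    have XX: "?m X X = mscale (inverse (gam g k) * gam g j) (e j + e k)"
      unfolding X_def mmul_add e_def mscale_add mu_scale[symmetric] using jk by (simp add: mmul_mu_mu kmul_one add.commute)
    have pY: "?m (p l) (\<phi> X) + ?m (\<phi> X) (p l) = \<phi> X" if "l < 3" "?m (e l) X + ?m X (e l) = X" for l
    proof -
      have "mscale 2 (jprod i (p l) (\<phi> X)) = \<phi> (mscale 2 (jprod i (e l) X))"
        using H3_closed(3)[OF g(1) eH[OF that(1)] XH] eH[OF that(1)] XH by (simp add: scale jordan p_def)
      then show ?thesis unfolding j2 that(2) .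
    qed
    have "\<phi> (?m X X) = ?m (\<phi> X) (\<phi> X)" using jordan[OF XH XH] unfolding jsq .
    then have YY: "?m (\<phi> X) (\<phi> X) = mscale (inverse (gam g k) * gam g j) (p j + p k)"
      unfolding XX using eH jk H3_closed(1)[OF g(1)] by (simp add: scale add p_def)
    have Y: "T.st (\<phi> X) = \<phi> X" "\<phi> X \<in> M3" using \<phi>H[OF XH] unfolding H3_iff by auto
    show ?thesis
      by (rule T.peirce_norm[OF v(1,3,4,5,2)[OF jk(1)] v(1,3,4,5,2)[OF jk(2)] pp[OF jk(1)] pp[OF jk(2)]
            pq[OF jk] pq[OF jk(2,1)] Y pY[OF jk(1) eX(1)] pY[OF jk(2) eX(2)] YY]) (use jk in auto)
  qed
  have vv0: "?m (T.st (v j)) (v k) = 0" if jk: "j < 3" "k < 3" "j \<noteq> k" for j k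
  proof -
    have Es: "?m T.E (T.st (v j)) = T.st (v j)" using v(3)[OF jk(1)] T.st_mmul[of "v j" T.E] T.st_E by simp
    have "?m (T.st (v j)) (?m (?m (v j) (T.st (v j))) (?m (?m (v k) (T.st (v k))) (v k))) = 0"
      unfolding v(4)[OF jk(1)] v(4)[OF jk(2)] mmul_mscale
      using pq[OF jk] by (simp add: mmul_assoc[symmetric] mmul_zero mscale_zero)
    moreover have "?m (T.st (v j)) (?m (?m (v j) (T.st (v j))) (?m (?m (v k) (T.st (v k))) (v k)))
        = ?m (?m (T.st (v j)) (v j)) (?m (T.st (v j)) (?m (v k) (?m (T.st (v k)) (v k))))"
      by (simp only: mmul_assoc)
    moreover have "\<dots> = mscale (d j * d k) (?m (T.st (v j)) (v k))"
      unfolding v(5)[OF jk(1)] v(5)[OF jk(2)] mmul_mscale v(3)[OF jk(2)]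
      by (simp add: mscale_mscale mmul_assoc[symmetric] Es mult.commute)
    ultimately have "mscale (d j * d k) (?m (T.st (v j)) (v k)) = 0" by simp
    then show ?thesis by (rule mscale_eq_0) (use v(2)[OF jk(1)] v(2)[OF jk(2)] in simp)
  qed
  have esum: "e 0 + e 1 + e 2 = mone"
    unfolding e_def mu_def mone_def by (auto simp: fun_eq_iff zero_prod_def)
  have monH: "mone \<in> H3 g'" "mone \<in> H3 g" unfolding H3_iff by (simp_all add: dg_mone g M3_closed)
  have psum: "p 0 + p 1 + p 2 = mone"
  \<comment> \<open>The map is not assumed unital. Multiplying \<open>\<phi> mone\<close> with the
    image of a preimage of \<open>mone\<close> shows that it is the Jordan unit of the
    target.\<close>
  proof -
    have ps: "p 0 + p 1 + p 2 = \<phi> mone"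
      unfolding esum[symmetric] p_def using eH H3_closed(1)[OF g(1)] by (simp add: add)
    obtain X where X: "X \<in> H3 g" "\<phi> X = mone" using \<phi>surj[OF monH(1)] by blast
    then have XM: "X \<in> M3" unfolding H3_iff by blast
    have j1: "jprod i mone Z = Z" if "Z \<in> M3" for Z
      unfolding jprod_def madd_plus by (simp add: mmul_mone that dbl half)
    have "jprod i (\<phi> mone) mone = mone"
      using jordan[OF monH(2) X(1)] unfolding j1[OF XM] X(2) by simp
    moreover have "jprod i (\<phi> mone) mone = \<phi> mone"
    proof -
      have "\<phi> mone \<in> M3" using \<phi>H[OF monH(2)] unfolding H3_iff by blast
      then show ?thesis unfolding jprod_def madd_plus by (simp add: mmul_mone dbl half)
    qed
    ultimately show ?thesis unfolding ps by simp
  qed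
  let ?F = "form3 (param g')"
  define z where "z j = (\<lambda>m. v j m 0)" for j
  define w where "w j = stretch g' (z j)" for j
  \<comment> \<open>The factor \<open>gam g' 0\<close> undoes the division in the corner entry of an
    adjoint, and \<open>det_gam g'\<close> is the factor in \<open>hf_stretch\<close>; so
    \<open>D j\<close> is the value of the target form at \<open>w j\<close>.\<close>
  define D where "D j = det_gam g' * gam g' 0 * d j" for j
  have st_entry: "?m (T.st X) Y 0 0 = kscale (inverse (gam g' 0)) (hf i g' (\<lambda>m. Y m 0) (\<lambda>m. X m 0))" for X Y
    unfolding mmul_def hf_def kscale_sum
    by (intro sum.cong refl) (simp add: dg_def kmul_kscale kscale_kscale kmul_comm[of i "Y _ 0"])
  have gp: "gam g' m \<noteq> 0" "gam g m \<noteq> 0" for m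
    by (rule gam_nonzero[OF g(2)], rule gam_nonzero[OF g(1)])
  have hw: "hf i ?F (w k) (w j) = (if j = k then (D j, 0) else 0)" if jk: "j < 3" "k < 3" for j k
  proof -
    have "hf i g' (z k) (z j) = kscale (gam g' 0) (?m (T.st (v j)) (v k) 0 0)"
      unfolding st_entry z_def using gp(1)[of 0] by (simp add: kscale_kscale)
    also have "\<dots> = (if j = k then (gam g' 0 * d j, 0) else 0)"
      using vv0[OF jk] v(5)[OF jk(1)] by (auto simp: mscale_def mu_def kscale_def zero_prod_def)
    finally show ?thesis unfolding w_def hf_stretch D_def by (auto simp: kscale_def zero_prod_def mult.assoc)
  qed
  have dg0: "det_gam g' \<noteq> 0" unfolding det_gam_def using gp(1) by simp
  have D0: "D j \<noteq> 0" if "j < 3" for j unfolding D_def using gp dg0 v(2)[OF that] by simp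
  define Y where "Y = cross i (param g') (w 0) (w 1)"
  have YY: "hre i ?F Y Y = D 0 * D 1"
    unfolding Y_def cross_norm using hw[of 0 0] hw[of 1 1] hw[of 1 0]
    by (simp add: hf_eq zero_prod_def knorm_def)
  have Yp: "hf i ?F Y (w 0) = 0" "hf i ?F Y (w 1) = 0" unfolding Y_def by (rule cross_perp)+
  \<comment> \<open>Undoing \<open>stretch\<close> makes a column \<open>M\<close> of
    \<open>Y\<close>. Orthogonality to \<open>w 0\<close> and \<open>w 1\<close> means that
    \<open>p 0\<close> and \<open>p 1\<close> kill \<open>M\<close>, so the resolution of the
    identity leaves \<open>p 2\<close> times \<open>M\<close>, a K-multiple of
    \<open>v 2\<close>.\<close>
  have expand: "\<exists>\<kappa>. \<forall>m<3. Y m = kmul i \<kappa> (w 2 m)"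
  proof -
    define M where "M m b = (if m < 3 \<and> b = 0 then (if m < 2 then kscale (inverse (gam g' m)) (Y m) else Y m) else 0)" for m b :: nat
    have MM: "M \<in> M3" unfolding M_def M3_def by auto
    have Ms: "stretch g' (\<lambda>m. M m 0) m = Y m" if "m < 3" for m
      unfolding stretch_def M_def using that gp(1)[of m] by (simp add: kscale_kscale)
    have hM: "hf i g' (\<lambda>m. M m 0) (z j) = 0" if "hf i ?F Y (w j) = 0" for j
    proof -
      have "kscale (det_gam g') (hf i g' (\<lambda>m. M m 0) (z j)) = hf i ?F Y (w j)"
        unfolding hf_stretch[symmetric] w_def unfolding hf_def by (intro sum.cong refl) (simp add: Ms)
      then show ?thesis unfolding that using dg0 by (simp add: kscale_def zero_prod_def prod_eq_iff)
    qed
    have ME: "?m M T.E = M"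
    proof (intro ext)
      fix a b
      have "?m M T.E a b = (\<Sum>m<3::nat. if m = 0 then (if b = 0 then M a 0 else 0) else 0)"
        unfolding mmul_def mu_def by (intro sum.cong refl) (auto simp: kmul_zero kmul_one)
      then show "?m M T.E a b = M a b" by (simp add: M_def)
    qed
    have pM0: "?m (p j) M = 0" if j: "j < 3" and 0: "hf i ?F Y (w j) = 0" for j
    proof -
      have Es: "?m T.E (T.st (v j)) = T.st (v j)" using v(3)[OF j] T.st_mmul[of "v j" T.E] T.st_E by simp
      have "?m (T.st (v j)) M = ?m T.E (?m (?m (T.st (v j)) M) T.E)"
        using Es ME by (metis mmul_assoc)
      also have "\<dots> = 0"
        unfolding T.sandwich_E st_entry z_def[symmetric] hM[OF 0] by (auto simp: mu_def kscale_zero fun_eq_iff)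
      finally have "mscale (d j) (?m (p j) M) = 0"
        unfolding mmul_mscale(1)[symmetric] v(4)[OF j, symmetric] mmul_assoc by (simp add: mmul_zero)
      then show ?thesis using mscale_eq_0 v(2)[OF j] by blast
    qed
    have "M = ?m (p 0 + p 1 + p 2) M" unfolding psum using MM by (simp add: mmul_mone)
    also have "\<dots> = ?m (p 2) M" unfolding mmul_add using pM0[of 0] pM0[of 1] Yp by simp
    finally have "mscale (d 2) M = ?m (v 2) (?m (T.st (v 2)) M)"
      using v(4)[of 2] by (metis mmul_assoc mmul_mscale(1) numeral_less_iff semiring_norm(79) semiring_norm(81) lessI numeral_3_eq_3 numeral_2_eq_2)
    then have dM: "mscale (d 2) M = ?m (v 2) (mu 0 0 (?m (T.st (v 2)) M 0 0))"
    proof -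
      have Es: "?m T.E (T.st (v 2)) = T.st (v 2)" using v(3)[of 2] T.st_mmul[of "v 2" T.E] T.st_E by simp
      have "?m (T.st (v 2)) M = ?m T.E (?m (?m (T.st (v 2)) M) T.E)"
        using Es ME by (metis mmul_assoc)
      then show ?thesis using \<open>mscale (d 2) M = ?m (v 2) (?m (T.st (v 2)) M)\<close> unfolding T.sandwich_E by simp
    qed
    have ent: "kscale (d 2) (M m 0) = kmul i (v 2 m 0) s" if "s = ?m (T.st (v 2)) M 0 0" for m s
    proof -
      have "?m (v 2) (mu 0 0 s) m 0 = (\<Sum>l<3::nat. if l = 0 then kmul i (v 2 m 0) s else 0)"
        unfolding mmul_def mu_def by (intro sum.cong refl) (auto simp: kmul_zero)
      then show ?thesis using dM that unfolding fun_eq_iff mscale_def by simp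
    qed
    define \<kappa> where "\<kappa> = kscale (inverse (d 2)) (?m (T.st (v 2)) M 0 0)"
    have "M m 0 = kmul i \<kappa> (z 2 m)" for m
    proof -
      have "M m 0 = kscale (inverse (d 2)) (kscale (d 2) (M m 0))" using v(2)[of 2] by (simp add: kscale_kscale)
      then show ?thesis unfolding ent[OF refl] \<kappa>_def z_def by (simp add: kmul_kscale kmul_comm)
    qed
    then have "Y m = kmul i \<kappa> (w 2 m)" if "m < 3" for m
      unfolding Ms[OF that, symmetric] w_def stretch_def by (simp add: kmul_kscale)
    then show ?thesis by blast
  qed
  then obtain \<kappa> where \<kappa>: "\<And>m. m < 3 \<Longrightarrow> Y m = kmul i \<kappa> (w 2 m)" by blast
  have k: "D 0 * D 1 = knorm i \<kappa> * D 2"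
  proof -
    have "hf i ?F Y Y = hf i ?F (vmul i \<kappa> (w 2)) (vmul i \<kappa> (w 2))"
      unfolding hf_def vmul_def by (intro sum.cong refl) (simp add: \<kappa>)
    also have "\<dots> = (knorm i \<kappa> * D 2, 0)"
      unfolding hf_vmul kmul_kconj using hw[of 2 2] by (simp add: kmul_def)
    finally show ?thesis using YY by (simp add: hf_eq)
  qed
  have k0: "knorm i \<kappa> \<noteq> 0" using k D0[of 0] D0[of 1] by auto
  \<comment> \<open>The Peirce space makes g j g h D j D h a norm, and the cross product makes D 0 D
    1 D 2 a norm times a square. Dividing, D l becomes g j g h after multiplication by a norm, and
    that norm can be absorbed into \<open>w l\<close>.\<close>
  have scaled: "\<exists>\<rho>. knorm i \<rho> * D l = gam g j * gam g h"
    if jh: "j < 3" "h < 3" "l < 3" "j \<noteq> h" and eq: "D l * D j * D h = knorm i \<kappa> * (D 2)\<^sup>2" for j h l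
  proof -
    obtain s where s: "knorm i s = (inverse (gam g h) * gam g j) * d j * d h" using norms[of j h] jh by blast
    define t where "t = kscale (det_gam g' * gam g' 0 * gam g h) s"
    have t: "knorm i t = gam g j * gam g h * D j * D h"
      unfolding t_def knorm_kscale s D_def using gp(2)[of h] by (simp add: power2_eq_square field_simps)
    define \<rho> where "\<rho> = kscale (inverse (knorm i \<kappa> * D 2)) (kmul i t (kconj \<kappa>))"
    have "knorm i (kconj \<kappa>) = knorm i \<kappa>" unfolding knorm_def kconj_def by simp
    then have "knorm i \<rho> = knorm i t * inverse (knorm i \<kappa> * (D 2)\<^sup>2)"
      unfolding \<rho>_def knorm_kscale knorm_kmul using k0 D0[of 2] by (simp add: power2_eq_square field_simps)
    also have "\<dots> * D l = gam g j * gam g h * (D l * D j * D h) * inverse (knorm i \<kappa> * (D 2)\<^sup>2)"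
      unfolding t by (simp add: mult_ac)
    also have "\<dots> = gam g j * gam g h" 
    proof -
      have "knorm i \<kappa> * (D 2)\<^sup>2 \<noteq> 0" using k0 D0[of 2] by simp
      from right_inverse[OF this] show ?thesis unfolding eq by (subst mult.assoc) (simp only: mult.right_neutral)
    qed
    finally show ?thesis by blast
  qed
  obtain r0 where r0: "knorm i r0 * D 0 = gam g 1 * gam g 2"
    using scaled[of 1 2 0] k by (auto simp: power2_eq_square)
  obtain r1 where r1: "knorm i r1 * D 1 = gam g 0 * gam g 2"
    using scaled[of 0 2 1] k by (auto simp: power2_eq_square mult.commute)
  have "hf i ?F (vmul i r0 (w 0)) (vmul i r0 (w 0)) = (gam g 1 * gam g 2, 0)"
    "hf i ?F (vmul i r1 (w 1)) (vmul i r1 (w 1)) = (gam g 0 * gam g 2, 0)"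
    "hf i ?F (vmul i r0 (w 0)) (vmul i r1 (w 1)) = 0"
    unfolding hf_vmul kmul_kconj using hw[of 0 0] hw[of 1 1] hw[of 1 0] r0 r1
    by (simp_all add: kmul_zero) (simp_all add: kmul_def)
  then show ?thesis
    unfolding represents_def Let_def param_def[of g] fst_conv snd_conv hf_eq
    by (intro exI[of _ "vmul i r0 (w 0)"] exI[of _ "vmul i r1 (w 1)"]) (simp add: zero_prod_def)
qed

section \<open>Primitive trivectors\<close>

text \<open>Coordinates are indexed by numerals 1 to 6. Rewriting 1 to a successor would keep
  coordinate equations from matching.\<close>

declare One_nat_def [simp del]

definition omega :: "(nat \<Rightarrow> 'k::field) \<Rightarrow> (nat \<Rightarrow> 'k) \<Rightarrow> 'k" where
  "omega u v = (\<Sum>p\<in>{1..6}. \<Sum>q\<in>{1..6}. u p * Jsymp p q * v q)"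

lemma set16: "{1..6::nat} = {1, 2, 3, 4, 5, 6}"
  by auto

lemma sum16: "(\<Sum>p\<in>{1..6::nat}. f p) = f 1 + f 2 + f 3 + f 4 + f 5 + f 6"
  unfolding set16 by (simp add: add.assoc)

lemma omega_eq:
  "omega u v = u 1 * v 4 + u 2 * v 5 + u 3 * v 6 - u 4 * v 1 - u 5 * v 2 - u 6 * v 3"
  unfolding omega_def sum16 Jsymp_def by simp

lemma omega_swap: "omega v u = - omega u v"
  unfolding omega_eq by simp

text \<open>Under Sp6 the contraction \<open>x\<^sup>a\<^sup>p\<^sup>r x\<^sup>b\<^sup>q\<^sup>s J\<^sub>p\<^sub>q J\<^sub>r\<^sub>s\<close> transforms like a quadratic form Q. The
  endomorphism T with \<open>\<omega>(T u, v) = Q(u, v)\<close> satisfies \<open>T\<^sup>2 = - 16 J(x)\<close>, and \<open>(- Q / 4, \<omega>)\<close> are the two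
  components of the hermitian form attached to x.\<close>

definition Qmat :: "'k::field wedge3 \<Rightarrow> nat \<Rightarrow> nat \<Rightarrow> 'k" where
  "Qmat x a b = (\<Sum>p\<in>{1..6}. \<Sum>q\<in>{1..6}. Jsymp p q * omega (x a p) (x b q))"

lemma Qmat_eq:
  "Qmat x a b = omega (x a 1) (x b 4) + omega (x a 2) (x b 5) + omega (x a 3) (x b 6)
     - omega (x a 4) (x b 1) - omega (x a 5) (x b 2) - omega (x a 6) (x b 3)"
  unfolding Qmat_def sum16 Jsymp_def by simp

lemma Qmat_sym: "Qmat x b a = Qmat x a b"
  unfolding Qmat_eq omega_swap[of "x b 1"] omega_swap[of "x b 2"] omega_swap[of "x b 3"]
    omega_swap[of "x b 4"] omega_swap[of "x b 5"] omega_swap[of "x b 6"] by simp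

definition Tmat :: "'k::field wedge3 \<Rightarrow> nat \<Rightarrow> nat \<Rightarrow> 'k" where
  "Tmat x p q = (if p \<le> 3 then Qmat x q (p + 3) else - Qmat x q (p - 3))"

text \<open>These are the alternating trivectors annihilated by contraction with the symplectic
  form. The conditions are linear and invariant under Sp6, so they pass from \<open>e123\<close> to
  all of \<open>Xk\<close> and stand in for its description as a span. The two swaps spread the
  support condition from the first index to all three.\<close>

definition primitive :: "'k::field wedge3 \<Rightarrow> bool" where
  "primitive x \<longleftrightarrow> (\<forall>p q r. x q p r = - x p q r \<and> x p r q = - x p q r)
     \<and> (\<forall>p q r. p \<notin> {1..6} \<longrightarrow> x p q r = 0)
     \<and> (\<forall>r. (\<Sum>p\<in>{1..6}. \<Sum>q\<in>{1..6}. Jsymp p q * x p q r) = 0)"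

locale primitive_trivector =
  fixes x :: "'k::field wedge3"
  assumes two: "(2::'k) \<noteq> 0" and prim: "primitive x"
begin

lemma swap12: "x q p r = - x p q r" and swap23: "x p r q = - x p q r"
  using prim unfolding primitive_def by blast+

lemma self_neg: "(c::'k) = - c \<Longrightarrow> c = 0"
proof -
  assume "c = - c"
  then have "c + c = 0" by (rule iffD1[OF eq_neg_iff_add_eq_0])
  then have "2 * c = 0" unfolding mult_2 .
  then show "c = 0" using two mult_eq_0_iff[of 2 c] by blast
qed

lemma diag0: "x p p r = 0" "x p r p = 0" "x r p p = 0"
proof -
  show *: "x p p r = 0" for r by (rule self_neg) (rule swap12)
  show "x r p p = 0" by (rule self_neg) (rule swap23)
  show "x p r p = 0" by (subst swap23) (simp only: * minus_zero)
qed

text \<open>The side conditions orient the swap laws, so that rewriting terminates with increasing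
  indices.\<close>

lemma sort12: "q < p \<Longrightarrow> x p q r = - x q p r" and sort23: "r < q \<Longrightarrow> x p q r = - x p r q"
  by (rule swap12, rule swap23)

lemma contraction: "x 1 4 r + x 2 5 r + x 3 6 r = 0"
proof -
  have "(\<Sum>p\<in>{1..6}. \<Sum>q\<in>{1..6}. Jsymp p q * x p q r) = 0"
    using prim unfolding primitive_def by blast
  then have "x 1 4 r + x 2 5 r + x 3 6 r - x 4 1 r - x 5 2 r - x 6 3 r = 0"
    unfolding sum16 Jsymp_def by simp
  then have "2 * (x 1 4 r + x 2 5 r + x 3 6 r) = 0"
    unfolding swap12[of 1 4] swap12[of 2 5] swap12[of 3 6] by (simp add: algebra_simps)
  then show ?thesis using two mult_eq_0_iff[of 2] by blast
qed

text \<open>The six contraction equations involve different coordinates. Each eliminates one of the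
  20 increasing ones, and the 14 that remain can be treated as free variables in polynomial
  identities.\<close>

lemma contraction_coords:
  "x 1 3 6 = - x 1 2 5" "x 2 3 6 = x 1 2 4" "x 2 3 5 = - x 1 3 4"
  "x 3 4 6 = - x 2 4 5" "x 3 5 6 = x 1 4 5" "x 2 5 6 = - x 1 4 6"
proof -
  have "x 1 3 6 + x 1 2 5 = 0" "x 2 3 6 - x 1 2 4 = 0" "x 2 3 5 + x 1 3 4 = 0"
    "x 3 4 6 + x 2 4 5 = 0" "x 3 5 6 - x 1 4 5 = 0" "x 2 5 6 + x 1 4 6 = 0"
    using contraction[of 1] contraction[of 2] contraction[of 3] contraction[of 4]
      contraction[of 5] contraction[of 6]
    by (simp_all add: diag0 sort12 sort23) algebra+
  then show "x 1 3 6 = - x 1 2 5" "x 2 3 6 = x 1 2 4" "x 2 3 5 = - x 1 3 4"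
    "x 3 4 6 = - x 2 4 5" "x 3 5 6 = x 1 4 5" "x 2 5 6 = - x 1 4 6"
    by (simp_all only: eq_neg_iff_add_eq_0 eq_iff_diff_eq_0[of "x 2 3 6"] eq_iff_diff_eq_0[of "x 3 5 6"])
qed

lemmas coords = diag0 sort12 sort23 contraction_coords

lemma Qmat_coords:
  "Qmat x 1 1 = 4 * x 1 2 3 * x 1 5 6 + 4 * x 1 2 5 * x 1 2 5 + 4 * x 1 2 6 * x 1 3 5"
  "Qmat x 1 2 = - (4 * x 1 2 3 * x 1 4 6) - 4 * x 1 2 4 * x 1 2 5 - 4 * x 1 2 6 * x 1 3 4"
  "Qmat x 1 3 = 4 * x 1 2 3 * x 1 4 5 + 4 * x 1 2 5 * x 1 3 4 - 4 * x 1 2 4 * x 1 3 5"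
  "Qmat x 1 4 = 2 * x 1 2 3 * x 4 5 6 + 2 * x 1 5 6 * x 2 3 4 - 4 * x 1 2 5 * x 2 4 5 - 2 * x 1 2 6 * x 3 4 5 - 2 * x 1 3 5 * x 2 4 6"
  "Qmat x 1 5 = 4 * x 1 2 5 * x 1 4 5 + 4 * x 1 3 5 * x 1 4 6 - 4 * x 1 3 4 * x 1 5 6"
  "Qmat x 1 6 = 4 * x 1 2 4 * x 1 5 6 + 4 * x 1 2 6 * x 1 4 5 - 4 * x 1 2 5 * x 1 4 6"
  "Qmat x 2 2 = 4 * x 1 2 4 * x 1 2 4 - 4 * x 1 2 3 * x 2 4 6 - 4 * x 1 2 6 * x 2 3 4"
  "Qmat x 2 3 = 4 * x 1 2 3 * x 2 4 5 + 4 * x 1 2 4 * x 1 3 4 + 4 * x 1 2 5 * x 2 3 4"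
  "Qmat x 2 4 = 4 * x 1 2 4 * x 2 4 5 + 4 * x 1 3 4 * x 2 4 6 - 4 * x 1 4 6 * x 2 3 4"
  "Qmat x 2 5 = 2 * x 1 2 3 * x 4 5 6 + 2 * x 1 3 5 * x 2 4 6 - 4 * x 1 2 4 * x 1 4 5 - 2 * x 1 2 6 * x 3 4 5 - 2 * x 1 5 6 * x 2 3 4"
  "Qmat x 2 6 = 4 * x 1 2 6 * x 2 4 5 - 4 * x 1 2 4 * x 1 4 6 - 4 * x 1 2 5 * x 2 4 6"
  "Qmat x 3 3 = 4 * x 1 2 3 * x 3 4 5 + 4 * x 1 3 4 * x 1 3 4 + 4 * x 1 3 5 * x 2 3 4"
  "Qmat x 3 4 = 4 * x 1 2 4 * x 3 4 5 + 4 * x 1 4 5 * x 2 3 4 - 4 * x 1 3 4 * x 2 4 5"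
  "Qmat x 3 5 = 4 * x 1 2 5 * x 3 4 5 - 4 * x 1 3 4 * x 1 4 5 - 4 * x 1 3 5 * x 2 4 5"
  "Qmat x 3 6 = 2 * x 1 2 3 * x 4 5 6 + 2 * x 1 2 6 * x 3 4 5 - 4 * x 1 3 4 * x 1 4 6 - 2 * x 1 3 5 * x 2 4 6 - 2 * x 1 5 6 * x 2 3 4"
  "Qmat x 4 4 = 4 * x 2 3 4 * x 4 5 6 + 4 * x 2 4 5 * x 2 4 5 + 4 * x 2 4 6 * x 3 4 5"
  "Qmat x 4 5 = - (4 * x 1 3 4 * x 4 5 6) - 4 * x 1 4 5 * x 2 4 5 - 4 * x 1 4 6 * x 3 4 5"
  "Qmat x 4 6 = 4 * x 1 2 4 * x 4 5 6 + 4 * x 1 4 6 * x 2 4 5 - 4 * x 1 4 5 * x 2 4 6"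
  "Qmat x 5 5 = 4 * x 1 4 5 * x 1 4 5 - 4 * x 1 3 5 * x 4 5 6 - 4 * x 1 5 6 * x 3 4 5"
  "Qmat x 5 6 = 4 * x 1 2 5 * x 4 5 6 + 4 * x 1 4 5 * x 1 4 6 + 4 * x 1 5 6 * x 2 4 5"
  "Qmat x 6 6 = 4 * x 1 2 6 * x 4 5 6 + 4 * x 1 4 6 * x 1 4 6 + 4 * x 1 5 6 * x 2 4 6"
  unfolding Qmat_eq omega_eq by (simp_all add: coords)

lemma Tmat_rows:
  "Tmat x 1 q = Qmat x q 4" "Tmat x 2 q = Qmat x q 5" "Tmat x 3 q = Qmat x q 6"
  "Tmat x 4 q = - Qmat x q 1" "Tmat x 5 q = - Qmat x q 2" "Tmat x 6 q = - Qmat x q 3"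
  by (simp_all add: Tmat_def One_nat_def)

lemmas Qmat_sorts = Qmat_sym[of x 2 1] Qmat_sym[of x 3 1] Qmat_sym[of x 4 1] Qmat_sym[of x 5 1] Qmat_sym[of x 6 1] Qmat_sym[of x 3 2] Qmat_sym[of x 4 2] Qmat_sym[of x 5 2] Qmat_sym[of x 6 2] Qmat_sym[of x 4 3] Qmat_sym[of x 5 3] Qmat_sym[of x 6 3] Qmat_sym[of x 5 4] Qmat_sym[of x 6 4] Qmat_sym[of x 6 5]

lemmas Tmat_coords = Tmat_rows Qmat_sorts Qmat_coords

text \<open>Clearing the quarter leaves identities with integer coefficients, within reach of ring
  normalisation.\<close>

lemma Jq16:
  "16 * Jq x = 16 * (x0c x * det3 (Bc x) + y0c x * det3 (Ac x) + tr_prod3 (adj3 (Ac x)) (adj3 (Bc x)))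
     - 4 * (x0c x * y0c x - tr_prod3 (Ac x) (Bc x))^2"
proof -
  have "(4::'k) = 2 * 2" "(16::'k) = 4 * 4" by simp_all
  then have "(16::'k) * (1/4) = 4" using two by simp
  then show ?thesis unfolding Jq_def by (simp only: right_diff_distrib mult.assoc[symmetric])
qed

lemma Tmat_square_11: "(\<Sum>d\<in>{1..6}. Tmat x 1 d * Tmat x d 1) = - (16 * Jq x)"
  unfolding sum16 Tmat_coords Jq16
  by (simp add: x0c_def y0c_def det3_def Ac_def Bc_def mat3_def adj3_def tr_prod3_def sum3 coords) algebra

lemma Tmat_square_diag:
  "(\<Sum>d\<in>{1..6}. Tmat x 2 d * Tmat x d 2) = (\<Sum>d\<in>{1..6}. Tmat x 1 d * Tmat x d 1)"
  "(\<Sum>d\<in>{1..6}. Tmat x 3 d * Tmat x d 3) = (\<Sum>d\<in>{1..6}. Tmat x 1 d * Tmat x d 1)"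
  "(\<Sum>d\<in>{1..6}. Tmat x 4 d * Tmat x d 4) = (\<Sum>d\<in>{1..6}. Tmat x 1 d * Tmat x d 1)"
  "(\<Sum>d\<in>{1..6}. Tmat x 5 d * Tmat x d 5) = (\<Sum>d\<in>{1..6}. Tmat x 1 d * Tmat x d 1)"
  "(\<Sum>d\<in>{1..6}. Tmat x 6 d * Tmat x d 6) = (\<Sum>d\<in>{1..6}. Tmat x 1 d * Tmat x d 1)"
  unfolding sum16 Tmat_coords by algebra+

lemma Tmat_square_off:
  "(\<Sum>d\<in>{1..6}. Tmat x 1 d * Tmat x d 2) = 0"
  "(\<Sum>d\<in>{1..6}. Tmat x 1 d * Tmat x d 3) = 0"
  "(\<Sum>d\<in>{1..6}. Tmat x 1 d * Tmat x d 4) = 0"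
  "(\<Sum>d\<in>{1..6}. Tmat x 1 d * Tmat x d 5) = 0"
  "(\<Sum>d\<in>{1..6}. Tmat x 1 d * Tmat x d 6) = 0"
  "(\<Sum>d\<in>{1..6}. Tmat x 2 d * Tmat x d 1) = 0"
  "(\<Sum>d\<in>{1..6}. Tmat x 2 d * Tmat x d 3) = 0"
  "(\<Sum>d\<in>{1..6}. Tmat x 2 d * Tmat x d 4) = 0"
  "(\<Sum>d\<in>{1..6}. Tmat x 2 d * Tmat x d 5) = 0"
  "(\<Sum>d\<in>{1..6}. Tmat x 2 d * Tmat x d 6) = 0"
  "(\<Sum>d\<in>{1..6}. Tmat x 3 d * Tmat x d 1) = 0"
  "(\<Sum>d\<in>{1..6}. Tmat x 3 d * Tmat x d 2) = 0"
  "(\<Sum>d\<in>{1..6}. Tmat x 3 d * Tmat x d 4) = 0"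
  "(\<Sum>d\<in>{1..6}. Tmat x 3 d * Tmat x d 5) = 0"
  "(\<Sum>d\<in>{1..6}. Tmat x 3 d * Tmat x d 6) = 0"
  "(\<Sum>d\<in>{1..6}. Tmat x 4 d * Tmat x d 1) = 0"
  "(\<Sum>d\<in>{1..6}. Tmat x 4 d * Tmat x d 2) = 0"
  "(\<Sum>d\<in>{1..6}. Tmat x 4 d * Tmat x d 3) = 0"
  "(\<Sum>d\<in>{1..6}. Tmat x 4 d * Tmat x d 5) = 0"
  "(\<Sum>d\<in>{1..6}. Tmat x 4 d * Tmat x d 6) = 0"
  "(\<Sum>d\<in>{1..6}. Tmat x 5 d * Tmat x d 1) = 0"
  "(\<Sum>d\<in>{1..6}. Tmat x 5 d * Tmat x d 2) = 0"
  "(\<Sum>d\<in>{1..6}. Tmat x 5 d * Tmat x d 3) = 0"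
  "(\<Sum>d\<in>{1..6}. Tmat x 5 d * Tmat x d 4) = 0"
  "(\<Sum>d\<in>{1..6}. Tmat x 5 d * Tmat x d 6) = 0"
  "(\<Sum>d\<in>{1..6}. Tmat x 6 d * Tmat x d 1) = 0"
  "(\<Sum>d\<in>{1..6}. Tmat x 6 d * Tmat x d 2) = 0"
  "(\<Sum>d\<in>{1..6}. Tmat x 6 d * Tmat x d 3) = 0"
  "(\<Sum>d\<in>{1..6}. Tmat x 6 d * Tmat x d 4) = 0"
  "(\<Sum>d\<in>{1..6}. Tmat x 6 d * Tmat x d 5) = 0"
  unfolding sum16 Tmat_coords by algebra+

lemma Tmat_square:
  assumes "p \<in> {1..6}" "q \<in> {1..6}"
  shows "(\<Sum>d\<in>{1..6}. Tmat x p d * Tmat x d q) = (if p = q then - (16 * Jq x) else 0)"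
  using assms unfolding set16
  by (elim insertE emptyE; simp only: Tmat_square_11 Tmat_square_diag Tmat_square_off flip: set16; simp)

text \<open>That \<open>Tx\<close> is again alternating says that x is the real part of a K-trilinear form.\<close>

definition Tx :: "nat \<Rightarrow> nat \<Rightarrow> nat \<Rightarrow> 'k" where
  "Tx p q r = (\<Sum>d\<in>{1..6}. Tmat x d p * x d q r)"

lemma Tx_coords_1:
  "Tx 1 1 2 = - Tx 1 1 2" "Tx 1 1 3 = - Tx 1 1 3" "Tx 1 1 4 = - Tx 1 1 4" "Tx 1 1 5 = - Tx 1 1 5"
  "Tx 1 1 6 = - Tx 1 1 6" "Tx 1 2 3 = - Tx 2 1 3" "Tx 1 2 4 = - Tx 2 1 4" "Tx 1 2 5 = - Tx 2 1 5"
  "Tx 1 2 6 = - Tx 2 1 6" "Tx 1 3 4 = - Tx 3 1 4" "Tx 1 3 5 = - Tx 3 1 5" "Tx 1 3 6 = - Tx 3 1 6"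
  "Tx 1 4 5 = - Tx 4 1 5" "Tx 1 4 6 = - Tx 4 1 6" "Tx 1 5 6 = - Tx 5 1 6" "Tx 1 2 1 = - Tx 2 1 1"
  "Tx 1 3 1 = - Tx 3 1 1" "Tx 1 3 2 = - Tx 3 1 2" "Tx 1 4 1 = - Tx 4 1 1" "Tx 1 4 2 = - Tx 4 1 2"
  "Tx 1 4 3 = - Tx 4 1 3" "Tx 1 5 1 = - Tx 5 1 1" "Tx 1 5 2 = - Tx 5 1 2" "Tx 1 5 3 = - Tx 5 1 3"
  "Tx 1 5 4 = - Tx 5 1 4" "Tx 1 6 1 = - Tx 6 1 1" "Tx 1 6 2 = - Tx 6 1 2" "Tx 1 6 3 = - Tx 6 1 3"
  "Tx 1 6 4 = - Tx 6 1 4" "Tx 1 6 5 = - Tx 6 1 5" "Tx 1 1 1 = - Tx 1 1 1" "Tx 1 2 2 = - Tx 2 1 2"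
  "Tx 1 3 3 = - Tx 3 1 3" "Tx 1 4 4 = - Tx 4 1 4" "Tx 1 5 5 = - Tx 5 1 5" "Tx 1 6 6 = - Tx 6 1 6"
  unfolding Tx_def sum16 Tmat_coords by (simp_all only: coords rel_simps) algebra+

lemma Tx_coords_2:
  "Tx 2 2 3 = - Tx 2 2 3" "Tx 2 2 4 = - Tx 2 2 4" "Tx 2 2 5 = - Tx 2 2 5" "Tx 2 2 6 = - Tx 2 2 6"
  "Tx 2 3 4 = - Tx 3 2 4" "Tx 2 3 5 = - Tx 3 2 5" "Tx 2 3 6 = - Tx 3 2 6" "Tx 2 4 5 = - Tx 4 2 5"
  "Tx 2 4 6 = - Tx 4 2 6" "Tx 2 5 6 = - Tx 5 2 6" "Tx 2 2 1 = - Tx 2 2 1" "Tx 2 3 1 = - Tx 3 2 1"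
  "Tx 2 3 2 = - Tx 3 2 2" "Tx 2 4 1 = - Tx 4 2 1" "Tx 2 4 2 = - Tx 4 2 2" "Tx 2 4 3 = - Tx 4 2 3"
  "Tx 2 5 1 = - Tx 5 2 1" "Tx 2 5 2 = - Tx 5 2 2" "Tx 2 5 3 = - Tx 5 2 3" "Tx 2 5 4 = - Tx 5 2 4"
  "Tx 2 6 1 = - Tx 6 2 1" "Tx 2 6 2 = - Tx 6 2 2" "Tx 2 6 3 = - Tx 6 2 3" "Tx 2 6 4 = - Tx 6 2 4"
  "Tx 2 6 5 = - Tx 6 2 5" "Tx 2 2 2 = - Tx 2 2 2" "Tx 2 3 3 = - Tx 3 2 3" "Tx 2 4 4 = - Tx 4 2 4"
  "Tx 2 5 5 = - Tx 5 2 5" "Tx 2 6 6 = - Tx 6 2 6"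
  unfolding Tx_def sum16 Tmat_coords by (simp_all only: coords rel_simps) algebra+

lemma Tx_coords_3:
  "Tx 3 3 4 = - Tx 3 3 4" "Tx 3 3 5 = - Tx 3 3 5" "Tx 3 3 6 = - Tx 3 3 6" "Tx 3 4 5 = - Tx 4 3 5"
  "Tx 3 4 6 = - Tx 4 3 6" "Tx 3 5 6 = - Tx 5 3 6" "Tx 3 3 1 = - Tx 3 3 1" "Tx 3 3 2 = - Tx 3 3 2"
  "Tx 3 4 1 = - Tx 4 3 1" "Tx 3 4 2 = - Tx 4 3 2" "Tx 3 4 3 = - Tx 4 3 3" "Tx 3 5 1 = - Tx 5 3 1"
  "Tx 3 5 2 = - Tx 5 3 2" "Tx 3 5 3 = - Tx 5 3 3" "Tx 3 5 4 = - Tx 5 3 4" "Tx 3 6 1 = - Tx 6 3 1"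
  "Tx 3 6 2 = - Tx 6 3 2" "Tx 3 6 3 = - Tx 6 3 3" "Tx 3 6 4 = - Tx 6 3 4" "Tx 3 6 5 = - Tx 6 3 5"
  "Tx 3 3 3 = - Tx 3 3 3" "Tx 3 4 4 = - Tx 4 3 4" "Tx 3 5 5 = - Tx 5 3 5" "Tx 3 6 6 = - Tx 6 3 6"
  unfolding Tx_def sum16 Tmat_coords by (simp_all only: coords rel_simps) algebra+

lemma Tx_coords_4:
  "Tx 4 4 5 = - Tx 4 4 5" "Tx 4 4 6 = - Tx 4 4 6" "Tx 4 5 6 = - Tx 5 4 6" "Tx 4 4 1 = - Tx 4 4 1"
  "Tx 4 4 2 = - Tx 4 4 2" "Tx 4 4 3 = - Tx 4 4 3" "Tx 4 5 1 = - Tx 5 4 1" "Tx 4 5 2 = - Tx 5 4 2"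
  "Tx 4 5 3 = - Tx 5 4 3" "Tx 4 5 4 = - Tx 5 4 4" "Tx 4 6 1 = - Tx 6 4 1" "Tx 4 6 2 = - Tx 6 4 2"
  "Tx 4 6 3 = - Tx 6 4 3" "Tx 4 6 4 = - Tx 6 4 4" "Tx 4 6 5 = - Tx 6 4 5" "Tx 4 4 4 = - Tx 4 4 4"
  "Tx 4 5 5 = - Tx 5 4 5" "Tx 4 6 6 = - Tx 6 4 6"
  unfolding Tx_def sum16 Tmat_coords by (simp_all only: coords rel_simps) algebra+

lemma Tx_coords_5:
  "Tx 5 5 6 = - Tx 5 5 6" "Tx 5 5 1 = - Tx 5 5 1" "Tx 5 5 2 = - Tx 5 5 2" "Tx 5 5 3 = - Tx 5 5 3"
  "Tx 5 5 4 = - Tx 5 5 4" "Tx 5 6 1 = - Tx 6 5 1" "Tx 5 6 2 = - Tx 6 5 2" "Tx 5 6 3 = - Tx 6 5 3"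
  "Tx 5 6 4 = - Tx 6 5 4" "Tx 5 6 5 = - Tx 6 5 5" "Tx 5 5 5 = - Tx 5 5 5" "Tx 5 6 6 = - Tx 6 5 6"
  unfolding Tx_def sum16 Tmat_coords by (simp_all only: coords rel_simps) algebra+

lemma Tx_coords_6:
  "Tx 6 6 1 = - Tx 6 6 1" "Tx 6 6 2 = - Tx 6 6 2" "Tx 6 6 3 = - Tx 6 6 3" "Tx 6 6 4 = - Tx 6 6 4"
  "Tx 6 6 5 = - Tx 6 6 5" "Tx 6 6 6 = - Tx 6 6 6"
  unfolding Tx_def sum16 Tmat_coords by (simp_all only: coords rel_simps) algebra+

text \<open>Skew symmetry in the last two arguments is inherited from x, so the first two are the
  only pair to check. The cases \<open>p = q\<close> express that \<open>Tx\<close> vanishes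
  there.\<close>

lemma Tx_swap12:
  assumes "p \<in> {1..6}" "q \<in> {1..6}" "r \<in> {1..6}"
  shows "Tx p q r = - Tx q p r"
proof -
  have le: "Tx p q r = - Tx q p r" if "p \<le> q" "p \<in> {1..6}" "q \<in> {1..6}" for p q
    using that assms(3) unfolding set16
    by (elim insertE emptyE; hypsubst)
      (rule Tx_coords_1 Tx_coords_2 Tx_coords_3 Tx_coords_4 Tx_coords_5 Tx_coords_6 | simp; fail)+
  show ?thesis
    using le[of p q] le[of q p] assms by (cases "p \<le> q") simp_all
qed

end

section \<open>Symplectic matrices\<close>

abbreviation S6 :: "nat set" where "S6 \<equiv> {1..6}"

lemma omega_cong:
  assumes "\<And>p. p \<in> S6 \<Longrightarrow> u p = u' p" "\<And>p. p \<in> S6 \<Longrightarrow> v p = v' p"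
  shows "omega u v = omega u' v'"
  unfolding omega_def by (intro sum.cong refl) (simp add: assms)

lemma omega_sum_left: "omega (\<lambda>p. \<Sum>q\<in>Q. c q * F q p) v = (\<Sum>q\<in>Q. c q * omega (F q) v)"
  unfolding omega_eq
  by (simp add: sum_distrib_left sum_distrib_right sum.distrib sum_subtractf algebra_simps)

lemma omega_sum_right: "omega v (\<lambda>p. \<Sum>q\<in>Q. c q * F q p) = (\<Sum>q\<in>Q. c q * omega v (F q))"
  unfolding omega_swap[of v] omega_sum_left by (simp add: sum_negf)

lemma Sp6_iff: "g \<in> Sp6 \<longleftrightarrow> (\<forall>a\<in>S6. \<forall>b\<in>S6. omega (\<lambda>p. g p a) (\<lambda>p. g p b) = Jsymp a b)"
  unfolding Sp6_def omega_def by simp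

definition dual :: "nat \<Rightarrow> nat" where "dual p = (if p \<le> 3 then p + 3 else p - 3)"
definition sgn6 :: "nat \<Rightarrow> 'k::field" where "sgn6 p = (if p \<le> 3 then 1 else - 1)"

lemma dual_simps: "dual 1 = 4" "dual 2 = 5" "dual 3 = 6" "dual 4 = 1" "dual 5 = 2" "dual 6 = 3"
  by (simp_all add: dual_def One_nat_def)

lemma sgn6_simps: "sgn6 1 = 1" "sgn6 2 = 1" "sgn6 3 = 1" "sgn6 4 = - 1" "sgn6 5 = - 1" "sgn6 6 = - 1"
  by (simp_all add: sgn6_def)

text \<open>This is the symplectic inverse - J g^t J, entry by entry.\<close>

definition sp_inv :: "(nat \<Rightarrow> nat \<Rightarrow> 'k::field) \<Rightarrow> nat \<Rightarrow> nat \<Rightarrow> 'k" where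
  "sp_inv g p b = sgn6 p * sgn6 b * g (dual b) (dual p)"

lemma rows_sp_inv:
  assumes "\<And>a b. a \<in> S6 \<Longrightarrow> b \<in> S6 \<Longrightarrow> omega (g a) (g b) = Jsymp a b"
    and ab: "a \<in> S6" "b \<in> S6"
  shows "(\<Sum>p\<in>S6. g a p * sp_inv g p b) = (if a = b then 1 else 0)"
    and "(\<Sum>p\<in>S6. sp_inv g a p * g p b) = (if a = b then 1 else 0)"
proof -
  have *: "(\<Sum>p\<in>S6. g a p * sp_inv g p b) = (if a = b then 1 else 0)" if "a \<in> S6" "b \<in> S6" for a b
  proof -
    have d: "dual b \<in> S6" using that unfolding dual_def by auto
    have "(\<Sum>p\<in>S6. g a p * sp_inv g p b) = sgn6 b * omega (g a) (g (dual b))"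
      unfolding sum16 sp_inv_def omega_eq dual_simps sgn6_simps by (simp add: algebra_simps)
    also have "\<dots> = sgn6 b * Jsymp a (dual b)" using assms(1) that d by simp
    also have "\<dots> = (if a = b then 1 else 0)"
      using that unfolding Jsymp_def sgn6_def dual_def by auto
    finally show ?thesis .
  qed
  show "(\<Sum>p\<in>S6. g a p * sp_inv g p b) = (if a = b then 1 else 0)" using * ab by blast
  show "(\<Sum>p\<in>S6. sp_inv g a p * g p b) = (if a = b then 1 else 0)"
    by (rule fun_matrix_left_right_inverse[where 'n = 6, OF _ _ *]) (use ab in simp_all)
qed

text \<open>Symplectic rows say that \<open>sp_inv g\<close> is a right inverse, symplectic columns
  that it is a left inverse. For square matrices these agree.\<close>

lemma symplectic_transpose:
  assumes "\<And>a b. a \<in> S6 \<Longrightarrow> b \<in> S6 \<Longrightarrow> omega (g a) (g b) = Jsymp a b"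
    and ab: "a \<in> S6" "b \<in> S6"
  shows "omega (\<lambda>p. g p a) (\<lambda>p. g p b) = Jsymp a b"
proof -
  have d: "dual a \<in> S6" using ab unfolding dual_def by auto
  have dd: "dual (dual a) = a" and sd: "- sgn6 (dual a) = (sgn6 a :: 'a)" and ss: "sgn6 a * sgn6 a = (1 :: 'a)"
    using ab unfolding dual_def sgn6_def by auto
  have "sgn6 a * omega (\<lambda>p. g p a) (\<lambda>p. g p b)
      = - sgn6 (dual a) * omega (\<lambda>p. g p (dual (dual a))) (\<lambda>p. g p b)"
    unfolding dd sd ..
  also have "\<dots> = (\<Sum>p\<in>S6. sp_inv g (dual a) p * g p b)"
    unfolding sum16 sp_inv_def omega_eq dual_simps sgn6_simps by (simp add: algebra_simps)
  also have "\<dots> = (if dual a = b then 1 else 0)"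
    using rows_sp_inv(2)[OF assms(1) d ab(2)] .
  finally have "sgn6 a * omega (\<lambda>p. g p a) (\<lambda>p. g p b) = (if dual a = b then 1 else 0)" .
  then have "sgn6 a * (sgn6 a * omega (\<lambda>p. g p a) (\<lambda>p. g p b)) = sgn6 a * (if dual a = b then 1 else 0)"
    by simp
  then have "omega (\<lambda>p. g p a) (\<lambda>p. g p b) = sgn6 a * (if dual a = b then 1 else 0)"
    unfolding mult.assoc[symmetric] ss mult_1_left .
  also have "\<dots> = Jsymp a b" using ab unfolding Jsymp_def sgn6_def dual_def by auto
  finally show ?thesis .
qed

text \<open>\<open>Sp6\<close> is a condition on columns, but \<open>act3\<close> contracts x
  against rows. In this form a symplectic basis written as rows is a group element that evaluates x
  on that basis.\<close>

lemma Sp6_iff_rows: "g \<in> Sp6 \<longleftrightarrow> (\<forall>a\<in>S6. \<forall>b\<in>S6. omega (g a) (g b) = Jsymp a b)"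
proof
  assume "g \<in> Sp6"
  then show "\<forall>a\<in>S6. \<forall>b\<in>S6. omega (g a) (g b) = Jsymp a b"
    using symplectic_transpose[of "\<lambda>a p. g p a"] unfolding Sp6_iff by auto
next
  assume "\<forall>a\<in>S6. \<forall>b\<in>S6. omega (g a) (g b) = Jsymp a b"
  then show "g \<in> Sp6" using symplectic_transpose[of g] unfolding Sp6_iff by auto
qed

text \<open>Stated for an arbitrary two-index \<open>F\<close>, this is the single source of the
  invariance of \<open>omega\<close>, of Q and of primitivity.\<close>

lemma Jsymp_contract_Sp6:
  assumes g: "g \<in> Sp6"
  shows "(\<Sum>p\<in>S6. \<Sum>q\<in>S6. Jsymp p q * (\<Sum>s\<in>S6. \<Sum>t\<in>S6. g p s * g q t * F s t))
    = (\<Sum>s\<in>S6. \<Sum>t\<in>S6. Jsymp s t * F s t)"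
proof -
  have "(\<Sum>p\<in>S6. \<Sum>q\<in>S6. Jsymp p q * (\<Sum>s\<in>S6. \<Sum>t\<in>S6. g p s * g q t * F s t))
     = (\<Sum>p\<in>S6. \<Sum>q\<in>S6. \<Sum>s\<in>S6. \<Sum>t\<in>S6. g p s * Jsymp p q * g q t * F s t)"
    by (simp only: sum_distrib_left mult.assoc mult.left_commute)
  also have "\<dots> = (\<Sum>p\<in>S6. \<Sum>s\<in>S6. \<Sum>q\<in>S6. \<Sum>t\<in>S6. g p s * Jsymp p q * g q t * F s t)"
    by (rule sum.cong[OF refl], rule sum.swap)
  also have "\<dots> = (\<Sum>s\<in>S6. \<Sum>p\<in>S6. \<Sum>t\<in>S6. \<Sum>q\<in>S6. g p s * Jsymp p q * g q t * F s t)"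
    unfolding sum.swap[of _ S6 S6, where g = "\<lambda>p s. \<Sum>q\<in>S6. \<Sum>t\<in>S6. g p s * Jsymp p q * g q t * F s t"]
    by (rule sum.cong[OF refl], rule sum.cong[OF refl], rule sum.swap)
  also have "\<dots> = (\<Sum>s\<in>S6. \<Sum>t\<in>S6. \<Sum>p\<in>S6. \<Sum>q\<in>S6. g p s * Jsymp p q * g q t * F s t)"
    by (rule sum.cong[OF refl], rule sum.swap)
  also have "\<dots> = (\<Sum>s\<in>S6. \<Sum>t\<in>S6. omega (\<lambda>p. g p s) (\<lambda>p. g p t) * F s t)"
    unfolding omega_def by (simp only: sum_distrib_right)
  also have "\<dots> = (\<Sum>s\<in>S6. \<Sum>t\<in>S6. Jsymp s t * F s t)"
    using g unfolding Sp6_iff by (intro sum.cong refl) simp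
  finally show ?thesis .
qed

lemma omega_Sp6:
  assumes "g \<in> Sp6"
  shows "omega (\<lambda>p. \<Sum>s\<in>S6. g p s * f s) (\<lambda>p. \<Sum>s\<in>S6. g p s * f' s) = omega f f'"
proof -
  have "omega (\<lambda>p. \<Sum>s\<in>S6. g p s * f s) (\<lambda>p. \<Sum>s\<in>S6. g p s * f' s)
    = (\<Sum>p\<in>S6. \<Sum>q\<in>S6. Jsymp p q * (\<Sum>s\<in>S6. \<Sum>t\<in>S6. g p s * g q t * (f s * f' t)))"
  proof -
    have "(\<Sum>s\<in>S6. g p s * f s) * Jsymp p q * (\<Sum>s\<in>S6. g q s * f' s)
        = Jsymp p q * (\<Sum>s\<in>S6. \<Sum>t\<in>S6. g p s * g q t * (f s * f' t))" for p q
    proof -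
      have "(\<Sum>s\<in>S6. g p s * f s) * (\<Sum>s\<in>S6. g q s * f' s)
        = (\<Sum>s\<in>S6. \<Sum>t\<in>S6. g p s * g q t * (f s * f' t))"
        unfolding sum_product by (simp only: mult_ac)
      then show ?thesis by (simp only: mult_ac)
    qed
    then show ?thesis unfolding omega_def by (intro sum.cong refl)
  qed
  also have "\<dots> = omega f f'" unfolding Jsymp_contract_Sp6[OF assms] omega_def by (simp add: mult_ac)
  finally show ?thesis .
qed

definition mmul6 :: "(nat \<Rightarrow> nat \<Rightarrow> 'k::field) \<Rightarrow> (nat \<Rightarrow> nat \<Rightarrow> 'k) \<Rightarrow> nat \<Rightarrow> nat \<Rightarrow> 'k" where
  "mmul6 g h a b = (\<Sum>c\<in>S6. g a c * h c b)"

lemma Sp6_mmul6: assumes "g \<in> Sp6" "h \<in> Sp6" shows "mmul6 g h \<in> Sp6"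
  unfolding Sp6_iff mmul6_def omega_Sp6[OF assms(1)] using assms(2) unfolding Sp6_iff .

lemma Sp6_one: "(\<lambda>a b. if a = b then 1 else 0) \<in> Sp6"
  unfolding Sp6_iff_rows omega_eq Jsymp_def set16 by simp

lemma sp_inv_mmul6:
  assumes "g \<in> Sp6" "a \<in> S6" "b \<in> S6"
  shows "mmul6 g (sp_inv g) a b = (if a = b then 1 else 0)"
    and "mmul6 (sp_inv g) g a b = (if a = b then 1 else 0)"
  using rows_sp_inv[of g a b] assms unfolding mmul6_def Sp6_iff_rows by blast+

lemma Sp6_sp_inv: assumes g: "g \<in> Sp6" shows "sp_inv g \<in> Sp6"
  unfolding Sp6_iff
proof (intro ballI)
  fix a b assume ab: "a \<in> S6" "b \<in> S6"
  have "omega (\<lambda>p. sp_inv g p a) (\<lambda>p. sp_inv g p b)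
      = omega (\<lambda>p. mmul6 g (sp_inv g) p a) (\<lambda>p. mmul6 g (sp_inv g) p b)"
    unfolding mmul6_def omega_Sp6[OF g] ..
  also have "\<dots> = omega (\<lambda>p. if p = a then 1 else 0) (\<lambda>p. if p = b then 1 else 0)"
    using ab by (intro omega_cong) (simp_all add: sp_inv_mmul6 g)
  also have "\<dots> = Jsymp a b"
    using ab unfolding omega_eq Jsymp_def set16 by auto
  finally show "omega (\<lambda>p. sp_inv g p a) (\<lambda>p. sp_inv g p b) = Jsymp a b" .
qed

section \<open>Trivectors as trilinear forms and the action of Sp6\<close>

definition tri :: "'k::field wedge3 \<Rightarrow> (nat \<Rightarrow> 'k) \<Rightarrow> (nat \<Rightarrow> 'k) \<Rightarrow> (nat \<Rightarrow> 'k) \<Rightarrow> 'k" where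
  "tri x u v w = (\<Sum>p\<in>S6. \<Sum>q\<in>S6. \<Sum>r\<in>S6. u p * v q * w r * x p q r)"

lemma act3_tri: "a \<in> S6 \<Longrightarrow> b \<in> S6 \<Longrightarrow> c \<in> S6 \<Longrightarrow> act3 g x a b c = tri x (g a) (g b) (g c)"
  unfolding act3_def tri_def by simp

lemma act3_outside: "\<not> (a \<in> S6 \<and> b \<in> S6 \<and> c \<in> S6) \<Longrightarrow> act3 g x a b c = 0"
  unfolding act3_def by auto

lemma tri_cong:
  assumes "\<And>p. p \<in> S6 \<Longrightarrow> u p = u' p" "\<And>p. p \<in> S6 \<Longrightarrow> v p = v' p" "\<And>p. p \<in> S6 \<Longrightarrow> w p = w' p"
    "\<And>p q r. p \<in> S6 \<Longrightarrow> q \<in> S6 \<Longrightarrow> r \<in> S6 \<Longrightarrow> x p q r = x' p q r"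
  shows "tri x u v w = tri x' u' v' w'"
  unfolding tri_def by (intro sum.cong refl) (simp add: assms)

lemma tri_nested: "tri x u v w = (\<Sum>p\<in>S6. u p * (\<Sum>q\<in>S6. v q * (\<Sum>r\<in>S6. w r * x p q r)))"
  unfolding tri_def by (simp only: sum_distrib_left mult.assoc)

lemma tri_sum1: "tri x (\<lambda>p. \<Sum>s\<in>Q. c s * F s p) v w = (\<Sum>s\<in>Q. c s * tri x (F s) v w)"
  unfolding tri_nested sum_distrib_right sum_distrib_left[of _ _ Q]
  by (subst sum.swap) (simp only: sum_distrib_left mult.assoc)

lemma tri_sum2: "tri x u (\<lambda>p. \<Sum>s\<in>Q. c s * F s p) w = (\<Sum>s\<in>Q. c s * tri x u (F s) w)"
proof -
  have *: "tri x u v w = (\<Sum>q\<in>S6. v q * (\<Sum>p\<in>S6. u p * (\<Sum>r\<in>S6. w r * x p q r)))" for v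
    unfolding tri_def sum_distrib_left
    by (subst sum.swap) (simp only: mult.assoc mult.left_commute)
  show ?thesis unfolding * sum_distrib_right sum_distrib_left[of _ _ Q]
    by (subst sum.swap) (simp only: sum_distrib_left mult.assoc)
qed

lemma sum_reverse3:
  "(\<Sum>p\<in>A. \<Sum>q\<in>B. \<Sum>r\<in>C. f p q r) = (\<Sum>r\<in>C. \<Sum>q\<in>B. \<Sum>p\<in>A. f p q r)"
proof -
  have "(\<Sum>p\<in>A. \<Sum>q\<in>B. \<Sum>r\<in>C. f p q r) = (\<Sum>q\<in>B. \<Sum>p\<in>A. \<Sum>r\<in>C. f p q r)"
    by (rule sum.swap)
  also have "\<dots> = (\<Sum>q\<in>B. \<Sum>r\<in>C. \<Sum>p\<in>A. f p q r)"
    by (intro sum.cong refl) (rule sum.swap)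
  also have "\<dots> = (\<Sum>r\<in>C. \<Sum>q\<in>B. \<Sum>p\<in>A. f p q r)"
    by (rule sum.swap)
  finally show ?thesis .
qed

lemma tri_sum3: "tri x u v (\<lambda>p. \<Sum>s\<in>Q. c s * F s p) = (\<Sum>s\<in>Q. c s * tri x u v (F s))"
proof -
  have "tri x u v w = tri (\<lambda>p q r. x r q p) w v u" for w
    unfolding tri_def sum_reverse3[of "\<lambda>p q r. u p * v q * w r * x p q r"] by (simp only: mult_ac)
  then show ?thesis by (simp only: tri_sum1)
qed

lemma tri_act3: "tri (act3 h x) u v w
   = tri x (\<lambda>p. \<Sum>s\<in>S6. u s * h s p) (\<lambda>p. \<Sum>s\<in>S6. v s * h s p) (\<lambda>p. \<Sum>s\<in>S6. w s * h s p)"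
proof -
  have "tri (act3 h x) u v w = tri (\<lambda>p q r. tri x (h p) (h q) (h r)) u v w"
    by (intro tri_cong refl act3_tri)
  also have "\<dots> = tri x (\<lambda>p. \<Sum>s\<in>S6. u s * h s p) (\<lambda>p. \<Sum>s\<in>S6. v s * h s p) (\<lambda>p. \<Sum>s\<in>S6. w s * h s p)"
    unfolding tri_sum1 tri_sum2 tri_sum3 tri_nested[of "\<lambda>p q r. tri x (h p) (h q) (h r)"] ..
  finally show ?thesis .
qed

lemma act3_mmul6: "act3 g (act3 h x) = act3 (mmul6 g h) x"
proof (intro ext)
  fix a b c
  show "act3 g (act3 h x) a b c = act3 (mmul6 g h) x a b c"
  proof (cases "a \<in> S6 \<and> b \<in> S6 \<and> c \<in> S6")
    case True
    then show ?thesis by (simp only: act3_tri tri_act3) (simp only: mmul6_def[abs_def])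
  next
    case False
    show ?thesis unfolding act3_outside[OF False] ..
  qed
qed

lemma act3_one:
  assumes "\<And>a b. a \<in> S6 \<Longrightarrow> b \<in> S6 \<Longrightarrow> g a b = (if a = b then 1 else 0)"
    and x: "\<And>a b c. \<not> (a \<in> S6 \<and> b \<in> S6 \<and> c \<in> S6) \<Longrightarrow> x a b c = 0"
  shows "act3 g x = x"
proof (intro ext)
  fix a b c
  show "act3 g x a b c = x a b c"
  proof (cases "a \<in> S6 \<and> b \<in> S6 \<and> c \<in> S6")
    case True
    then have "act3 g x a b c = tri x (\<lambda>p. if a = p then 1 else 0) (\<lambda>p. if b = p then 1 else 0) (\<lambda>p. if c = p then 1 else 0)"
      unfolding act3_tri[OF conjunct1[OF True] conjunct1[OF conjunct2[OF True]] conjunct2[OF conjunct2[OF True]]]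
      by (intro tri_cong) (simp_all add: assms(1))
    also have "\<dots> = x a b c" unfolding tri_nested using True by (simp add: if_distrib[of "\<lambda>t. t * _"] cong: if_cong)
    finally show ?thesis .
  next
    case False
    show ?thesis unfolding act3_outside[OF False] x[OF False] ..
  qed
qed

definition Qf :: "'k::field wedge3 \<Rightarrow> (nat \<Rightarrow> 'k) \<Rightarrow> (nat \<Rightarrow> 'k) \<Rightarrow> 'k" where
  "Qf x u v = (\<Sum>p\<in>S6. \<Sum>q\<in>S6. u p * v q * Qmat x p q)"

text \<open>In the two copies of x the other indices are paired by J, which g preserves, so g acts
  only through the free indices a and b.\<close>

lemma Qmat_act3:
  assumes g: "g \<in> Sp6" and ab: "a \<in> S6" "b \<in> S6"
  shows "Qmat (act3 g x) a b = Qf x (g a) (g b)"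
proof -
  define X where "X a t = (\<lambda>r. \<Sum>s\<in>S6. g a s * x s t r)" for a t
  have Q0: "Qmat (act3 g x) a b
      = (\<Sum>p\<in>S6. \<Sum>q\<in>S6. Jsymp p q * (\<Sum>s\<in>S6. \<Sum>t\<in>S6. g p s * g q t * omega (X a s) (X b t)))"
    unfolding Qmat_def
  proof (intro sum.cong refl)
    fix p q assume pq: "p \<in> S6" "q \<in> S6"
    have c: "act3 g x e p' r = (\<Sum>t\<in>S6. g r t * (\<Sum>s\<in>S6. g p' s * X e s t))"
      if "e \<in> S6" "p' \<in> S6" "r \<in> S6" for e p' r
    proof -
      have "act3 g x e p' r = (\<Sum>p\<in>S6. \<Sum>s\<in>S6. \<Sum>t\<in>S6. g r t * (g p' s * (g e p * x p s t)))"
        unfolding act3_tri[OF that] tri_def by (simp only: mult_ac)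
      also have "\<dots> = (\<Sum>t\<in>S6. g r t * (\<Sum>s\<in>S6. g p' s * X e s t))"
        by (subst sum_reverse3) (simp only: X_def sum_distrib_left)
      finally show ?thesis .
    qed
    have "omega (act3 g x a p) (act3 g x b q)
      = omega (\<lambda>r. \<Sum>t\<in>S6. g r t * (\<Sum>s\<in>S6. g p s * X a s t)) (\<lambda>r. \<Sum>t\<in>S6. g r t * (\<Sum>s\<in>S6. g q s * X b s t))"
      by (intro omega_cong c ab pq)
    also have "\<dots> = (\<Sum>s\<in>S6. \<Sum>t\<in>S6. g p s * g q t * omega (X a s) (X b t))"
      unfolding omega_Sp6[OF g] omega_sum_left omega_sum_right by (simp only: sum_distrib_left mult.assoc)
    finally show "Jsymp p q * omega (act3 g x a p) (act3 g x b q)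
      = Jsymp p q * (\<Sum>s\<in>S6. \<Sum>t\<in>S6. g p s * g q t * omega (X a s) (X b t))" by simp
  qed
  have "(\<Sum>s\<in>S6. \<Sum>t\<in>S6. Jsymp s t * omega (X a s) (X b t))
      = (\<Sum>s\<in>S6. \<Sum>t\<in>S6. \<Sum>p\<in>S6. \<Sum>q\<in>S6. g a p * g b q * (Jsymp s t * omega (x p s) (x q t)))"
    unfolding X_def omega_sum_left omega_sum_right sum_distrib_left by (simp only: mult_ac)
  also have "\<dots> = (\<Sum>p\<in>S6. \<Sum>q\<in>S6. \<Sum>s\<in>S6. \<Sum>t\<in>S6. g a p * g b q * (Jsymp s t * omega (x p s) (x q t)))"
  proof -
    have "(\<Sum>s\<in>S6. \<Sum>t\<in>S6. \<Sum>p\<in>S6. \<Sum>q\<in>S6. f s t p q) = (\<Sum>p\<in>S6. \<Sum>q\<in>S6. \<Sum>s\<in>S6. \<Sum>t\<in>S6. f s t p q)"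
      for f :: "nat \<Rightarrow> nat \<Rightarrow> nat \<Rightarrow> nat \<Rightarrow> 'a"
    proof -
      have "(\<Sum>s\<in>S6. \<Sum>t\<in>S6. \<Sum>p\<in>S6. \<Sum>q\<in>S6. f s t p q) = (\<Sum>s\<in>S6. \<Sum>p\<in>S6. \<Sum>q\<in>S6. \<Sum>t\<in>S6. f s t p q)"
        by (rule sum.cong[OF refl], subst sum.swap, rule sum.cong[OF refl], rule sum.swap)
      also have "\<dots> = (\<Sum>p\<in>S6. \<Sum>q\<in>S6. \<Sum>s\<in>S6. \<Sum>t\<in>S6. f s t p q)"
        by (subst sum.swap, rule sum.cong[OF refl], rule sum.swap)
      finally show ?thesis .
    qed
    then show ?thesis .
  qed
  also have "\<dots> = Qf x (g a) (g b)"
    unfolding Qf_def Qmat_def sum_distrib_left ..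
  finally show ?thesis unfolding Q0 Jsymp_contract_Sp6[OF g] .
qed

lemma tri_swap:
  assumes x: "primitive x"
  shows "tri x v u w = - tri x u v w" "tri x u w v = - tri x u v w"
proof -
  have a1: "x q p r = - x p q r" and a2: "x p r q = - x p q r" for p q r
    using x unfolding primitive_def by blast+
  have "tri x v u w = (\<Sum>q\<in>S6. \<Sum>p\<in>S6. \<Sum>r\<in>S6. v p * u q * w r * x p q r)"
    unfolding tri_def by (rule sum.swap)
  also have "\<dots> = - tri x u v w"
    unfolding tri_def sum_negf[symmetric]
    by (intro sum.cong refl) (subst a1, simp only: mult_ac mult_minus_right)
  finally show "tri x v u w = - tri x u v w" .
  have "tri x u w v = (\<Sum>p\<in>S6. \<Sum>r\<in>S6. \<Sum>q\<in>S6. u p * w q * v r * x p q r)"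
    unfolding tri_def by (rule sum.cong[OF refl], rule sum.swap)
  also have "\<dots> = - tri x u v w"
    unfolding tri_def sum_negf[symmetric]
    by (intro sum.cong refl) (subst a2, simp only: mult_ac mult_minus_right)
  finally show "tri x u w v = - tri x u v w" .
qed

lemma primitive_act3:
  assumes g: "g \<in> Sp6" and x: "primitive x"
  shows "primitive (act3 g x)"
proof -
  note s1 = tri_swap(1)[OF x] and s2 = tri_swap(2)[OF x]
  have "act3 g x q p r = - act3 g x p q r \<and> act3 g x p r q = - act3 g x p q r" for p q r
  proof (cases "p \<in> S6 \<and> q \<in> S6 \<and> r \<in> S6")
    case True
    then have e: "act3 g x q p r = tri x (g q) (g p) (g r)" "act3 g x p r q = tri x (g p) (g r) (g q)"
      "act3 g x p q r = tri x (g p) (g q) (g r)"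
      by (simp_all only: act3_tri)
    show ?thesis unfolding e using s1[of "g q" "g p" "g r"] s2[of "g p" "g r" "g q"] by (rule conjI)
  next
    case False
    then have "act3 g x q p r = 0" "act3 g x p r q = 0" "act3 g x p q r = 0"
      by (auto intro!: act3_outside)
    then show ?thesis by simp
  qed
  moreover have "act3 g x p q r = 0" if "p \<notin> S6" for p q r
    using act3_outside that by blast
  moreover have "(\<Sum>p\<in>S6. \<Sum>q\<in>S6. Jsymp p q * act3 g x p q r) = 0" for r
  proof (cases "r \<in> S6")
    case True
    have "(\<Sum>p\<in>S6. \<Sum>q\<in>S6. Jsymp p q * act3 g x p q r)
      = (\<Sum>p\<in>S6. \<Sum>q\<in>S6. Jsymp p q * (\<Sum>s\<in>S6. \<Sum>t\<in>S6. g p s * g q t * (\<Sum>d\<in>S6. g r d * x s t d)))"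
      using True by (intro sum.cong refl) (simp only: act3_tri tri_def sum_distrib_left mult_ac)
    also have "\<dots> = (\<Sum>s\<in>S6. \<Sum>t\<in>S6. Jsymp s t * (\<Sum>d\<in>S6. g r d * x s t d))"
      by (rule Jsymp_contract_Sp6[OF g])
    also have "\<dots> = (\<Sum>s\<in>S6. \<Sum>t\<in>S6. \<Sum>d\<in>S6. g r d * (Jsymp s t * x s t d))"
      unfolding sum_distrib_left by (simp only: mult.left_commute)
    also have "\<dots> = (\<Sum>d\<in>S6. g r d * (\<Sum>t\<in>S6. \<Sum>s\<in>S6. Jsymp s t * x s t d))"
      by (subst sum_reverse3) (simp only: sum_distrib_left)
    also have "\<dots> = 0"
    proof (intro sum.neutral ballI)
      fix d
      have "(\<Sum>p\<in>S6. \<Sum>q\<in>S6. Jsymp p q * x p q d) = 0"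
        using x unfolding primitive_def by blast
      then show "g r d * (\<Sum>q\<in>S6. \<Sum>p\<in>S6. Jsymp p q * x p q d) = 0"
        by (subst sum.swap) simp
    qed
    finally show ?thesis .
  next
    case False
    then have "act3 g x p q r = 0" for p q by (auto intro!: act3_outside)
    then show ?thesis by simp
  qed
  ultimately show ?thesis unfolding primitive_def by blast
qed

lemma primitive_sum:
  assumes "\<And>s. s \<in> Q \<Longrightarrow> primitive (v s)"
  shows "primitive (\<lambda>p q r. \<Sum>s\<in>Q. c s * v s p q r)"
proof -
  have "(\<Sum>s\<in>Q. c s * v s q p r) = - (\<Sum>s\<in>Q. c s * v s p q r)"
    "(\<Sum>s\<in>Q. c s * v s p r q) = - (\<Sum>s\<in>Q. c s * v s p q r)" for p q r
    using assms unfolding primitive_def sum_negf[symmetric] mult_minus_right[symmetric]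
    by (intro sum.cong refl arg_cong[where f = "(*) _"]; blast)+
  moreover have "(\<Sum>s\<in>Q. c s * v s p q r) = 0" if "p \<notin> S6" for p q r
  proof (intro sum.neutral ballI)
    fix s assume "s \<in> Q"
    then have "v s p q r = 0" using assms that unfolding primitive_def by blast
    then show "c s * v s p q r = 0" by simp
  qed
  moreover have "(\<Sum>p\<in>S6. \<Sum>q\<in>S6. Jsymp p q * (\<Sum>s\<in>Q. c s * v s p q r)) = 0" for r
  proof -
    have "(\<Sum>p\<in>S6. \<Sum>q\<in>S6. Jsymp p q * (\<Sum>s\<in>Q. c s * v s p q r))
      = (\<Sum>p\<in>S6. \<Sum>q\<in>S6. \<Sum>s\<in>Q. c s * (Jsymp p q * v s p q r))"
      by (simp only: sum_distrib_left mult.left_commute)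
    also have "\<dots> = (\<Sum>s\<in>Q. c s * (\<Sum>q\<in>S6. \<Sum>p\<in>S6. Jsymp p q * v s p q r))"
      by (subst sum_reverse3) (simp only: sum_distrib_left)
    also have "\<dots> = 0"
    proof (intro sum.neutral ballI)
      fix s assume "s \<in> Q"
      then have "(\<Sum>p\<in>S6. \<Sum>q\<in>S6. Jsymp p q * v s p q r) = 0"
        using assms unfolding primitive_def by blast
      then show "c s * (\<Sum>q\<in>S6. \<Sum>p\<in>S6. Jsymp p q * v s p q r) = 0"
        by (subst sum.swap) simp
    qed
    finally show ?thesis .
  qed
  ultimately show ?thesis unfolding primitive_def by blast
qed

lemma primitive_e123: "primitive e123"
proof -
  have "e123 q p r = - e123 p q r \<and> e123 p r q = - e123 p q r" for p q r
    unfolding e123_def by (simp add: algebra_simps)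
  moreover have "e123 p q r = 0" if "p \<notin> S6" for p q r
    using that unfolding e123_def kd_def by auto
  moreover have "(\<Sum>p\<in>S6. \<Sum>q\<in>S6. Jsymp p q * e123 p q r) = 0" for r
    unfolding sum16 Jsymp_def e123_def kd_def by simp
  ultimately show ?thesis unfolding primitive_def by blast
qed

lemma Xk_primitive:
  assumes "x \<in> Xk" shows "primitive x"
proof -
  obtain n :: nat and c v where x: "x = (\<lambda>p q r. \<Sum>s<n. c s * v s p q r)"
    and v: "\<And>s. s < n \<Longrightarrow> \<exists>g\<in>Sp6. v s = act3 g e123"
    using assms unfolding Xk_def by blast
  have "primitive (v s)" if "s \<in> {..<n}" for s
    using v[of s] that primitive_act3[OF _ primitive_e123] by auto
  then show ?thesis unfolding x by (rule primitive_sum)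
qed

section \<open>The K-structure T attached to a trivector\<close>

definition vadd :: "(nat \<Rightarrow> 'k::field) \<Rightarrow> (nat \<Rightarrow> 'k) \<Rightarrow> nat \<Rightarrow> 'k" where
  "vadd u v = (\<lambda>p. u p + v p)"

definition vsc :: "'k::field \<Rightarrow> (nat \<Rightarrow> 'k) \<Rightarrow> nat \<Rightarrow> 'k" where
  "vsc c u = (\<lambda>p. c * u p)"

lemma omega_lin:
  "omega (vadd u v) w = omega u w + omega v w" "omega w (vadd u v) = omega w u + omega w v"
  "omega (vsc c u) w = c * omega u w" "omega w (vsc c u) = c * omega w u"
  unfolding vadd_def vsc_def omega_eq by (simp_all add: algebra_simps)

lemma tri_lin:
  "tri x (vadd u v) w z = tri x u w z + tri x v w z"
  "tri x w (vadd u v) z = tri x w u z + tri x w v z"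
  "tri x w z (vadd u v) = tri x w z u + tri x w z v"
  "tri x (vsc c u) w z = c * tri x u w z"
  "tri x w (vsc c u) z = c * tri x w u z"
  "tri x w z (vsc c u) = c * tri x w z u"
  unfolding tri_def vadd_def vsc_def sum.distrib[symmetric] sum_distrib_left
  by (intro sum.cong refl, simp add: algebra_simps)+

lemma omega_self: "omega u u = 0"
  unfolding omega_eq by simp

context primitive_trivector
begin

definition Tv :: "(nat \<Rightarrow> 'k) \<Rightarrow> nat \<Rightarrow> 'k" where
  "Tv u = (\<lambda>p. \<Sum>q\<in>S6. Tmat x p q * u q)"

lemma Tv_lin: "Tv (vadd u v) = vadd (Tv u) (Tv v)" "Tv (vsc c u) = vsc c (Tv u)"
  unfolding Tv_def vadd_def vsc_def sum.distrib[symmetric] sum_distrib_left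
  by (intro ext sum.cong refl, simp add: algebra_simps)+

lemma Qf_sym: "Qf x u v = Qf x v u"
proof -
  have "Qf x u v = (\<Sum>q\<in>S6. \<Sum>p\<in>S6. u p * v q * Qmat x p q)"
    unfolding Qf_def by (rule sum.swap)
  also have "\<dots> = Qf x v u"
    unfolding Qf_def by (intro sum.cong refl) (subst Qmat_sym, simp only: mult_ac)
  finally show ?thesis .
qed

lemma omega_Tv_left: "omega (Tv u) v = Qf x u v"
  unfolding omega_eq Tv_def Tmat_rows Qf_def sum16 by (simp add: algebra_simps)

lemma omega_Tv_right: "omega u (Tv v) = - Qf x u v"
  unfolding omega_swap[of u] omega_Tv_left using Qf_sym by simp

lemma Qf_lin:
  "Qf x (vadd u v) w = Qf x u w + Qf x v w" "Qf x w (vadd u v) = Qf x w u + Qf x w v"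
  "Qf x (vsc c u) w = c * Qf x u w" "Qf x w (vsc c u) = c * Qf x w u"
  unfolding omega_Tv_left[symmetric] by (simp_all add: Tv_lin omega_lin)

lemmas tri_swap12 = tri_swap(1)[OF prim] and tri_swap23 = tri_swap(2)[OF prim]

lemma tri_same: "tri x u u w = 0" "tri x u w w = 0" "tri x u w u = 0"
proof -
  show *: "tri x u u w = 0" for w by (rule self_neg) (rule tri_swap12)
  show "tri x u w w = 0" by (rule self_neg) (rule tri_swap23)
  show "tri x u w u = 0" by (subst tri_swap23) (simp only: * minus_zero)
qed

lemma tri_Tx: "tri x (Tv u) v w = tri Tx u v w"
proof -
  have "tri x (Tv u) v w = tri x (\<lambda>p. \<Sum>q\<in>S6. u q * Tmat x p q) v w"
    unfolding Tv_def by (simp only: mult.commute)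
  also have "\<dots> = (\<Sum>a\<in>S6. u a * tri x (\<lambda>p. Tmat x p a) v w)"
    by (rule tri_sum1)
  also have "\<dots> = (\<Sum>a\<in>S6. u a * (\<Sum>b\<in>S6. v b * (\<Sum>c\<in>S6. w c * Tx a b c)))"
  proof (intro sum.cong refl arg_cong2[where f = "(*)"])
    fix a
    have "tri x (\<lambda>p. Tmat x p a) v w = (\<Sum>b\<in>S6. \<Sum>p\<in>S6. \<Sum>c\<in>S6. Tmat x p a * v b * w c * x p b c)"
      unfolding tri_def by (rule sum.swap)
    also have "\<dots> = (\<Sum>b\<in>S6. \<Sum>c\<in>S6. \<Sum>p\<in>S6. Tmat x p a * v b * w c * x p b c)"
      by (rule sum.cong[OF refl], rule sum.swap)
    also have "\<dots> = (\<Sum>b\<in>S6. v b * (\<Sum>c\<in>S6. w c * Tx a b c))"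
      unfolding Tx_def sum_distrib_left by (simp only: mult_ac)
    finally show "tri x (\<lambda>p. Tmat x p a) v w = (\<Sum>b\<in>S6. v b * (\<Sum>c\<in>S6. w c * Tx a b c))" .
  qed
  finally show ?thesis unfolding tri_nested[of Tx] .
qed

lemma tri_Tv12: "tri x (Tv u) v w = tri x u (Tv v) w"
proof -
  have "tri x u (Tv v) w = - tri Tx v u w"
    using tri_swap12[of u "Tv v" w] tri_Tx[of v u w] by simp
  also have "\<dots> = tri Tx u v w"
  proof -
    have "tri Tx v u w = (\<Sum>q\<in>S6. \<Sum>p\<in>S6. \<Sum>r\<in>S6. v p * u q * w r * Tx p q r)"
      unfolding tri_def by (rule sum.swap)
    also have "\<dots> = - tri Tx u v w"
      unfolding tri_def sum_negf[symmetric]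
      by (intro sum.cong refl) (subst Tx_swap12, simp_all only: mult_ac mult_minus_right)
    finally show ?thesis by simp
  qed
  finally show ?thesis using tri_Tx by simp
qed

lemma tri_Tv23: "tri x u (Tv v) w = tri x u v (Tv w)"
  by (metis add.inverse_inverse tri_Tv12 tri_swap12 tri_swap23)

end

locale orbit_point = primitive_trivector x for x :: "'k::field wedge3" +
  fixes i :: 'k
  assumes J: "Jq x = i" and i0: "i \<noteq> 0"
begin

text \<open>The equation is confined to \<open>S6\<close>, since \<open>Tv\<close> also takes
  meaningless values at other indices. Hence it is applied inside \<open>omega\<close> and
  \<open>tri\<close>, through their congruence rules.\<close>

lemma Tv_Tv: assumes "p \<in> S6" shows "Tv (Tv u) p = - (16 * i) * u p"
proof -
  have "Tv (Tv u) p = (\<Sum>q\<in>S6. (\<Sum>d\<in>S6. Tmat x p d * Tmat x d q) * u q)"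
    unfolding Tv_def sum_distrib_left sum_distrib_right
    by (subst sum.swap) (simp only: mult.assoc)
  also have "\<dots> = (\<Sum>q\<in>S6. (if p = q then - (16 * i) * u q else 0))"
    by (intro sum.cong refl) (simp add: Tmat_square[OF assms] J del: atLeastAtMost_iff)
  also have "\<dots> = - (16 * i) * u p" using assms by simp
  finally show ?thesis .
qed

lemma omega_TT: "omega (Tv (Tv u)) v = - (16 * i) * omega u v"
proof -
  have "omega (Tv (Tv u)) v = omega (vsc (- (16 * i)) u) v"
    by (intro omega_cong) (simp_all add: Tv_Tv vsc_def)
  then show ?thesis unfolding omega_lin .
qed

lemma Qf_Tv: "Qf x (Tv u) v = - (16 * i) * omega u v" "Qf x u (Tv v) = 16 * i * omega u v"
proof -
  show *: "Qf x (Tv u) v = - (16 * i) * omega u v" for u v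
    using omega_TT omega_Tv_left[of "Tv u" v] by simp
  show "Qf x u (Tv v) = 16 * i * omega u v"
    using *[of v u] Qf_sym[of "Tv v" u] omega_swap[of u v] by simp
qed

lemma tri_TT: "tri x u v (Tv (Tv w)) = - (16 * i) * tri x u v w"
proof -
  have "tri x u v (Tv (Tv w)) = tri x u v (vsc (- (16 * i)) w)"
    by (intro tri_cong) (simp_all add: Tv_Tv vsc_def)
  then show ?thesis unfolding tri_lin .
qed

end

lemma primitive_eqI:
  fixes x y :: "'k::field wedge3"
  assumes two: "(2::'k) \<noteq> 0" and x: "primitive x" and y: "primitive y"
    and eq: "x 1 2 3 = y 1 2 3" "x 1 2 4 = y 1 2 4" "x 1 2 5 = y 1 2 5" "x 1 2 6 = y 1 2 6"
      "x 1 3 4 = y 1 3 4" "x 1 3 5 = y 1 3 5" "x 1 4 5 = y 1 4 5" "x 1 4 6 = y 1 4 6"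
      "x 1 5 6 = y 1 5 6" "x 2 3 4 = y 2 3 4" "x 2 4 5 = y 2 4 5" "x 2 4 6 = y 2 4 6"
      "x 3 4 5 = y 3 4 5" "x 4 5 6 = y 4 5 6"
  shows "x = y"
proof (intro ext)
  interpret X: primitive_trivector x using two x by unfold_locales
  interpret Y: primitive_trivector y using two y by unfold_locales
  have 0: "z p q r = 0" if "primitive z" "\<not> (p \<in> S6 \<and> q \<in> S6 \<and> r \<in> S6)" for z :: "'k wedge3" and p q r
  proof -
    have a: "z q p r = - z p q r" "z p r q = - z p q r" "p \<notin> S6 \<Longrightarrow> z p q r = 0" for p q r
      using that(1) unfolding primitive_def by blast+
    have "z p q r = 0" if "q \<notin> S6"
      unfolding a(1)[of p q r] a(3)[OF that] by simp
    moreover have "z p q r = 0" if "r \<notin> S6"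
      unfolding a(2)[of p q r] a(1)[of p r q] a(3)[OF that] by simp
    ultimately show ?thesis using that(2) a(3) by blast
  qed
  fix p q r
  show "x p q r = y p q r"
  proof (cases "p \<in> S6 \<and> q \<in> S6 \<and> r \<in> S6")
    case False
    then show ?thesis using 0 x y by metis
  next
    case True
    then have "p \<in> S6" "q \<in> S6" "r \<in> S6" by auto
    then show ?thesis
      unfolding set16
      by (elim insertE emptyE; hypsubst; simp only: X.coords Y.coords rel_simps eq)
  qed
qed

section \<open>Symplectic frames adapted to a trivector\<close>

context orbit_point
begin

text \<open>Each vector of an orthogonal K-basis is paired with a multiple of its T-image:
  \<open>omega u (Tv u) = - Qf x u u\<close> equals 4 a for the first one, hence the factor 1 / (4
  a). For \<open>\<nu>\<close> the two places are exchanged, which reverses the sign.\<close>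

definition frame :: "(nat \<Rightarrow> 'k) \<Rightarrow> (nat \<Rightarrow> 'k) \<Rightarrow> (nat \<Rightarrow> 'k) \<Rightarrow> 'k \<Rightarrow> 'k \<Rightarrow> 'k \<Rightarrow> nat \<Rightarrow> nat \<Rightarrow> 'k" where
  "frame \<rho> \<sigma> \<nu> a b d = (\<lambda>p. if p = 1 then \<rho> else if p = 2 then \<sigma> else if p = 3 then vsc (- 1 / (4 * d)) (Tv \<nu>)
     else if p = 4 then vsc (1 / (4 * a)) (Tv \<rho>) else if p = 5 then vsc (1 / (4 * b)) (Tv \<sigma>) else \<nu>)"

lemma four: "(4::'k) \<noteq> 0"
proof -
  have e: "(2::'k) * 2 = 4" by simp
  show ?thesis unfolding e[symmetric] mult_eq_0_iff using two by blast
qed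

lemma sixteen: "(16::'k) \<noteq> 0"
proof -
  have e: "(4::'k) * 4 = 16" by simp
  show ?thesis unfolding e[symmetric] mult_eq_0_iff using four by blast
qed

lemma sixtyfour: "(64::'k) \<noteq> 0"
proof -
  have e: "(4::'k) * 16 = 64" by simp
  show ?thesis unfolding e[symmetric] mult_eq_0_iff using four sixteen by blast
qed

text \<open>T can be moved to the last argument and its square is a scalar, so every coordinate is 0
  or a multiple of \<open>\<alpha>\<close> or \<open>\<beta>\<close>: one element of K determines x.
  The final equation says that d \<beta> + \<alpha> t has norm a b d.\<close>

lemma frame_coords:
  assumes nz: "a \<noteq> 0" "b \<noteq> 0" "d \<noteq> 0"
    and Q: "Qf x \<rho> \<rho> = - 4 * a" "Qf x \<sigma> \<sigma> = - 4 * b" "Qf x \<nu> \<nu> = - 4 * d"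
    and Q0: "Qf x \<rho> \<sigma> = 0" "Qf x \<rho> \<nu> = 0" "Qf x \<sigma> \<nu> = 0"
    and w0: "omega \<rho> \<sigma> = 0" "omega \<rho> \<nu> = 0" "omega \<sigma> \<nu> = 0"
    and ab: "\<alpha> = tri x \<rho> \<sigma> \<nu>" "tri x \<rho> \<sigma> (Tv \<nu>) = - 4 * d * \<beta>"
    and y: "y = act3 (frame \<rho> \<sigma> \<nu> a b d) x"
  shows "frame \<rho> \<sigma> \<nu> a b d \<in> Sp6" "primitive y"
    "y 1 2 3 = \<beta>" "y 1 2 4 = 0" "y 1 2 5 = 0" "y 1 2 6 = \<alpha>" "y 1 3 4 = 0" "y 1 3 5 = - (i * \<alpha> / (b * d))"
    "y 1 4 5 = 0" "y 1 4 6 = 0" "y 1 5 6 = - (d * \<beta> / b)" "y 2 3 4 = i * \<alpha> / (a * d)" "y 2 4 5 = 0"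
    "y 2 4 6 = d * \<beta> / a" "y 3 4 5 = - (i * \<beta> / (a * b))" "y 4 5 6 = - (i * \<alpha> / (a * b))"
    "(d * \<beta>)\<^sup>2 + i * \<alpha>\<^sup>2 = a * b * d"
proof -
  let ?h = "frame \<rho> \<sigma> \<nu> a b d"
  have h: "?h 1 = \<rho>" "?h 2 = \<sigma>" "?h 3 = vsc (- 1 / (4 * d)) (Tv \<nu>)" "?h 4 = vsc (1 / (4 * a)) (Tv \<rho>)"
    "?h 5 = vsc (1 / (4 * b)) (Tv \<sigma>)" "?h 6 = \<nu>"
    unfolding frame_def by simp_all
  have Q0': "Qf x \<sigma> \<rho> = 0" "Qf x \<nu> \<rho> = 0" "Qf x \<nu> \<sigma> = 0" 
    using Q0 by (simp_all only: Qf_sym[of \<sigma> \<rho>] Qf_sym[of \<nu> \<rho>] Qf_sym[of \<nu> \<sigma>])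
  have w0': "omega \<sigma> \<rho> = 0" "omega \<nu> \<rho> = 0" "omega \<nu> \<sigma> = 0" 
    using w0 by (simp_all only: omega_swap[of \<sigma> \<rho>] omega_swap[of \<nu> \<rho>] omega_swap[of \<nu> \<sigma>] minus_zero)
  show sp: "?h \<in> Sp6"
    unfolding Sp6_iff_rows
  proof (intro ballI)
    fix p q assume "p \<in> S6" "q \<in> S6"
    then show "omega (?h p) (?h q) = Jsymp p q"
      unfolding set16
      by (elim insertE emptyE; hypsubst; simp add: h omega_lin Qf_lin omega_Tv_left omega_Tv_right Qf_Tv Q Q0 Q0' w0 w0' omega_self Jsymp_def nz four)
  qed
  show yp: "primitive y" unfolding y using primitive_act3[OF sp prim] .
  interpret Y: primitive_trivector y using two yp by unfold_locales
  have ye: "y p q r = tri x (?h p) (?h q) (?h r)" if "p \<in> S6" "q \<in> S6" "r \<in> S6" for p q r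
    unfolding y using act3_tri[OF that] .
  have t: "tri x u (Tv v) w = tri x u v (Tv w)" "tri x (Tv u) v w = tri x u v (Tv w)" for u v w
    using tri_Tv12 tri_Tv23 by simp_all
  have t0: "tri x u v (Tv u) = 0" "tri x u v (Tv v) = 0" for u v
    using tri_Tv23[of u v u] tri_Tv23[of u v v] tri_Tv12[of u v v] unfolding tri_same by simp_all
  note s = ye h tri_lin t t0 tri_TT tri_same ab(1)[symmetric] ab(2) nz four sixteen sixtyfour
  show e1: "y 1 2 3 = \<beta>" by (simp add: s)
  show "y 1 2 4 = 0" by (simp add: s)
  show e2: "y 1 2 5 = 0" by (simp add: s)
  show e3: "y 1 2 6 = \<alpha>" by (simp add: s)
  show "y 1 3 4 = 0" by (simp add: s)
  have "y 1 5 3 = i * \<alpha> / (b * d)" by (simp add: s field_simps)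
  then show e4: "y 1 3 5 = - (i * \<alpha> / (b * d))" using Y.swap23[of 1 3 5] by simp
  show "y 1 4 5 = 0" by (simp add: s)
  show "y 1 4 6 = 0" by (simp add: s)
  show e5: "y 1 5 6 = - (d * \<beta> / b)" by (simp add: s field_simps)
  have "y 4 2 3 = i * \<alpha> / (a * d)" by (simp add: s field_simps)
  then show "y 2 3 4 = i * \<alpha> / (a * d)" using Y.swap12[of 4 2 3] Y.swap23[of 2 4 3] by simp
  show "y 2 4 5 = 0" by (simp add: s)
  have "y 4 2 6 = - (d * \<beta> / a)" by (simp add: s field_simps)
  then show "y 2 4 6 = d * \<beta> / a" using Y.swap12[of 4 2 6] by simp
  have "y 4 5 3 = - (i * \<beta> / (a * b))" by (simp add: s field_simps)
  then show "y 3 4 5 = - (i * \<beta> / (a * b))" using Y.swap12[of 4 3 5] Y.swap23[of 4 5 3] by simp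
  show "y 4 5 6 = - (i * \<alpha> / (a * b))" by (simp add: s field_simps)
  \<comment> \<open>The relation between \<open>\<alpha>\<close> and \<open>\<beta>\<close> comes
    from computing Q on the first row twice: by invariance, and from the coordinates of
    \<open>y\<close>.\<close>
  have "Qmat y 1 1 = - 4 * a"
    unfolding y using Qmat_act3[OF sp, of 1 1 x] by (simp add: h Q)
  then have "4 * (\<beta> * (d * \<beta> / b) + \<alpha> * (i * \<alpha> / (b * d))) = 4 * a"
    unfolding Y.Qmat_coords e1 e2 e3 e4 e5 by (simp add: algebra_simps)
  then have "\<beta> * (d * \<beta> / b) + \<alpha> * (i * \<alpha> / (b * d)) = a"
    using mult_left_cancel[OF four] by blast
  then show "(d * \<beta>)\<^sup>2 + i * \<alpha>\<^sup>2 = a * b * d"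
    using nz by (simp add: field_simps power2_eq_square)
qed

text \<open>This is minus the hermitian projection of u onto K v: Q yields the coefficient of v, and
  \<open>omega\<close> that of \<open>Tv v\<close>, because
  \<open>omega (Tv v) v = Qf x v v\<close>.\<close>

definition proj :: "(nat \<Rightarrow> 'k) \<Rightarrow> (nat \<Rightarrow> 'k) \<Rightarrow> nat \<Rightarrow> 'k" where
  "proj v u = vadd (vsc (- Qf x u v / Qf x v v) v) (vsc (- omega u v / Qf x v v) (Tv v))"

text \<open>Zero vectors are allowed for \<open>\<rho>\<close> and \<open>\<sigma>\<close> (\<open>proj 0\<close> vanishes because division by 0 gives 0), so the
  same statement yields the first, second and third vector of an orthogonal K-basis.\<close>

lemma exists_orthogonal_anisotropic:
  assumes \<rho>: "Qf x \<rho> \<rho> = 0 \<Longrightarrow> \<rho> = (\<lambda>p. 0)" and \<sigma>: "Qf x \<sigma> \<sigma> = 0 \<Longrightarrow> \<sigma> = (\<lambda>p. 0)"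
    and orth: "Qf x \<rho> \<sigma> = 0" "omega \<rho> \<sigma> = 0"
  obtains \<nu> where "Qf x \<nu> \<nu> \<noteq> 0" "Qf x \<rho> \<nu> = 0" "Qf x \<sigma> \<nu> = 0" "omega \<rho> \<nu> = 0" "omega \<sigma> \<nu> = 0"
proof -
  define P where "P u = vadd u (vadd (proj \<rho> u) (proj \<sigma> u))" for u
  have z: "Qf x u (\<lambda>p. 0) = 0" "omega u (\<lambda>p. 0) = 0" for u
    unfolding Qf_def omega_def by simp_all
  have orth': "Qf x \<sigma> \<rho> = 0" "omega \<sigma> \<rho> = 0"
    using orth Qf_sym[of \<sigma> \<rho>] omega_swap[of \<sigma> \<rho>] by simp_all
  have P: "Qf x (P u) \<rho> = 0" "Qf x (P u) \<sigma> = 0" "omega (P u) \<rho> = 0" "omega (P u) \<sigma> = 0" for u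
  proof -
    have n: "Qf x \<rho> \<rho> \<noteq> 0 \<or> \<rho> = (\<lambda>p. 0)" "Qf x \<sigma> \<sigma> \<noteq> 0 \<or> \<sigma> = (\<lambda>p. 0)" using \<rho> \<sigma> by blast+
    note s = P_def proj_def Qf_lin omega_lin orth orth' Qf_Tv omega_Tv_left omega_self
    show "Qf x (P u) \<rho> = 0" using n(1) by (auto simp: s z)
    show "Qf x (P u) \<sigma> = 0" using n(2) by (auto simp: s z)
    show "omega (P u) \<rho> = 0" using n(1) by (auto simp: s z)
    show "omega (P u) \<sigma> = 0" using n(2) by (auto simp: s z)
  qed
  have "\<exists>u. Qf x (P u) (P u) \<noteq> 0"
  proof (rule ccontr)
    assume "\<not> (\<exists>u. Qf x (P u) (P u) \<noteq> 0)"
    then have iso: "Qf x (P u) (P u) = 0" for u by blast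
    have Padd: "P (vadd u v) = vadd (P u) (P v)" for u v
      unfolding P_def proj_def Qf_lin omega_lin unfolding vadd_def vsc_def
      by (intro ext) (simp add: add_divide_distrib diff_divide_distrib algebra_simps)
    have PP: "Qf x (P u) (P v) = 0" for u v
    proof -
      have "Qf x (P (vadd u v)) (P (vadd u v)) = Qf x (P u) (P v) + Qf x (P u) (P v)"
        unfolding Padd Qf_lin iso Qf_sym[of "P v" "P u"] by simp
      then have "2 * Qf x (P u) (P v) = 0" unfolding iso mult_2 by (rule sym)
      then show ?thesis using two mult_eq_0_iff[of 2] by blast
    qed
    have PQ: "Qf x (P u) v = 0" for u v
    proof -
      have "Qf x (P u) (P v) = Qf x (P u) v"
        unfolding P_def[of v] proj_def Qf_lin P Qf_Tv by simp
      then show ?thesis using PP by simp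
    qed
    have P0: "P u p = 0" if "p \<in> S6" for u p
    proof -
      have "omega (P u) v = 0" for v
        using PQ[of u "Tv v"] i0 sixteen unfolding Qf_Tv mult_eq_0_iff by blast
      from this[of "\<lambda>q. if q = dual p then 1 else 0"] show ?thesis
        using that unfolding omega_eq set16 dual_def by auto
    qed
    \<comment> \<open>With \<open>P\<close> zero every unit vector is a combination of
      \<open>\<rho>\<close>, \<open>Tv \<rho>\<close>, \<open>\<sigma>\<close>,
      \<open>Tv \<sigma>\<close>, so the 6 by 6 identity factors through rank at most 4. Padding the
      factors with zeros lets the reversed product be compared at the entry (6, 6).\<close>
    define A where "A p j = (if j = 1 then Qf x (\<lambda>q. if q = p then 1 else 0) \<rho> / Qf x \<rho> \<rho>
        else if j = 2 then omega (\<lambda>q. if q = p then 1 else 0) \<rho> / Qf x \<rho> \<rho>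
        else if j = 3 then Qf x (\<lambda>q. if q = p then 1 else 0) \<sigma> / Qf x \<sigma> \<sigma>
        else if j = 4 then omega (\<lambda>q. if q = p then 1 else 0) \<sigma> / Qf x \<sigma> \<sigma> else 0)" for p j :: nat
    define B where "B j = (if j = 1 then \<rho> else if j = 2 then Tv \<rho> else if j = 3 then \<sigma>
        else if j = 4 then Tv \<sigma> else (\<lambda>p. 0))" for j :: nat
    have AB: "(\<Sum>j\<in>S6. A p j * B j q) = (if p = q then 1 else 0)" if "p \<in> S6" "q \<in> S6" for p q
      using P0[OF that(2), of "\<lambda>q. if q = p then 1 else 0"]
      unfolding P_def proj_def vadd_def vsc_def sum16 A_def B_def by (auto simp: algebra_simps)
    have "(\<Sum>q\<in>S6. B 6 q * A q 6) = 1"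
      using fun_matrix_left_right_inverse[where 'n = 6, OF _ _ AB, of 6 6] by simp
    then show False by (simp add: A_def)
  qed
  then obtain u where "Qf x (P u) (P u) \<noteq> 0" by blast
  then show ?thesis
    using that[of "P u"] P[of u] Qf_sym[of \<rho> "P u"] Qf_sym[of \<sigma> "P u"]
      omega_swap[of \<rho> "P u"] omega_swap[of \<sigma> "P u"] by simp
qed

text \<open>In an orthogonal K-basis \<open>x = Re (c z\<^sub>1 z\<^sub>2 z\<^sub>3)\<close>; multiplying \<open>\<nu>\<close> by a suitable element of K
  makes c equal to the required constant, and \<open>J(x) = i\<close> forces \<open>Q(\<nu>, \<nu>) = - 4 a b\<close>.\<close>

lemma exists_normalizing_frame:
  assumes nz: "a \<noteq> 0" "b \<noteq> 0"
    and Q: "Qf x \<rho> \<rho> = - 4 * a" "Qf x \<sigma> \<sigma> = - 4 * b" "Qf x \<rho> \<sigma> = 0" "omega \<rho> \<sigma> = 0"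
  obtains h y where "h \<in> Sp6" "y = act3 h x" "primitive y"
    "y 1 2 3 = - 1" "y 1 2 4 = 0" "y 1 2 5 = 0" "y 1 2 6 = 0" "y 1 3 4 = 0" "y 1 3 5 = 0"
    "y 1 4 5 = 0" "y 1 4 6 = 0" "y 1 5 6 = a" "y 2 3 4 = 0" "y 2 4 5 = 0"
    "y 2 4 6 = - b" "y 3 4 5 = i / (a * b)" "y 4 5 6 = 0"
proof -
  have "Qf x \<rho> \<rho> \<noteq> 0" "Qf x \<sigma> \<sigma> \<noteq> 0" using Q nz four by auto
  then obtain \<nu> where \<nu>: "Qf x \<nu> \<nu> \<noteq> 0" "Qf x \<rho> \<nu> = 0" "Qf x \<sigma> \<nu> = 0" "omega \<rho> \<nu> = 0" "omega \<sigma> \<nu> = 0"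
    using exists_orthogonal_anisotropic[of \<rho> \<sigma>] Q by blast
  define d where "d = - Qf x \<nu> \<nu> / 4"
  have d: "d \<noteq> 0" "Qf x \<nu> \<nu> = - 4 * d" using \<nu> four unfolding d_def by auto
  define \<alpha> where "\<alpha> = tri x \<rho> \<sigma> \<nu>"
  define \<beta> where "\<beta> = - tri x \<rho> \<sigma> (Tv \<nu>) / (4 * d)"
  have \<beta>: "tri x \<rho> \<sigma> (Tv \<nu>) = - 4 * d * \<beta>" unfolding \<beta>_def using d four by simp
  have rel: "(d * \<beta>)\<^sup>2 + i * \<alpha>\<^sup>2 = a * b * d"
    using frame_coords(17)[OF nz d(1) Q(1,2) d(2) Q(3) \<nu>(2,3) Q(4) \<nu>(4,5) \<alpha>_def \<beta> refl] .
  \<comment> \<open>The two coefficients are chosen so that the contributions of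
    \<open>\<nu>\<close> and \<open>Tv \<nu>\<close> to \<open>tri x \<rho> \<sigma> m\<close>
    cancel.\<close>
  define m where "m = vadd (vsc \<beta> \<nu>) (vsc (\<alpha> / (4 * d)) (Tv \<nu>))"
  have m0: "tri x \<rho> \<sigma> m = 0"
    unfolding m_def tri_lin \<beta> \<alpha>_def[symmetric] using d four by simp
  have mo: "Qf x \<rho> m = 0" "Qf x \<sigma> m = 0" "omega \<rho> m = 0" "omega \<sigma> m = 0"
    unfolding m_def Qf_lin omega_lin Qf_Tv omega_Tv_right \<nu> by simp_all
  have mm: "Qf x m m = - 4 * (a * b)"
  proof -
    define c where "c = \<alpha> / (4 * d)"
    have c: "4 * d * c = \<alpha>" using d four unfolding c_def by simp
    have "Qf x m m = - 4 * d * (\<beta> * \<beta> + 16 * i * (c * c))"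
      unfolding m_def Qf_lin Qf_Tv omega_lin omega_self omega_Tv_left omega_Tv_right d(2) c_def[symmetric]
      by (simp add: algebra_simps)
    then have "d * Qf x m m = d * (- 4 * d * (\<beta> * \<beta> + 16 * i * (c * c)))" by (rule arg_cong)
    also have "\<dots> = - 4 * ((d * \<beta>)\<^sup>2 + i * (4 * d * c)\<^sup>2)"
      by (simp add: algebra_simps power2_eq_square)
    finally have "d * Qf x m m = - 4 * ((d * \<beta>)\<^sup>2 + i * (4 * d * c)\<^sup>2)" .
    then have "Qf x m m = - 4 * (((d * \<beta>)\<^sup>2 + i * \<alpha>\<^sup>2) / d)"
      unfolding c using d(1) by (simp add: field_simps)
    also have "\<dots> = - 4 * (a * b)" unfolding rel using d by simp
    finally show ?thesis .
  qed
  define \<gamma> where "\<gamma> = - tri x \<rho> \<sigma> (Tv m) / (4 * (a * b))"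
  have \<gamma>: "tri x \<rho> \<sigma> (Tv m) = - 4 * (a * b) * \<gamma>" unfolding \<gamma>_def using nz four by simp
  have ab: "a * b \<noteq> 0" using nz by simp
  have "(a * b * \<gamma>)\<^sup>2 + i * 0\<^sup>2 = a * b * (a * b)"
    using frame_coords(17)[OF nz ab Q(1,2) mm Q(3) mo(1,2) Q(4) mo(3,4) m0[symmetric] \<gamma> refl] .
  then have "\<gamma> * \<gamma> = 1" using nz by (simp add: power2_eq_square)
  \<comment> \<open>As \<open>\<gamma>\<close> squares to 1, this rescaling keeps the value of Q and
    changes the remaining constant from \<open>\<gamma>\<close> to - 1, the 123-coordinate of the
    normal form.\<close>
  define n where "n = vsc (- \<gamma>) m"
  have n0: "0 = tri x \<rho> \<sigma> n" unfolding n_def tri_lin m0 by simp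
  have no: "Qf x \<rho> n = 0" "Qf x \<sigma> n = 0" "omega \<rho> n = 0" "omega \<sigma> n = 0"
    unfolding n_def Qf_lin omega_lin mo by simp_all
  have "Qf x n n = \<gamma> * \<gamma> * (- 4 * (a * b))" unfolding n_def Qf_lin mm by simp
  then have nn: "Qf x n n = - 4 * (a * b)" unfolding \<open>\<gamma> * \<gamma> = 1\<close> by simp
  have "tri x \<rho> \<sigma> (Tv n) = 4 * (a * b) * (\<gamma> * \<gamma>)"
    unfolding n_def Tv_lin tri_lin \<gamma> by simp
  then have n1: "tri x \<rho> \<sigma> (Tv n) = - 4 * (a * b) * - 1" unfolding \<open>\<gamma> * \<gamma> = 1\<close> by simp
  note F = frame_coords[OF nz ab Q(1,2) nn Q(3) no(1,2) Q(4) no(3,4) n0 n1 refl]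
  show ?thesis
    by (rule that[OF F(1) refl F(2)]) (use F nz in simp_all)
qed

lemma exists_orthogonal_pair:
  obtains \<rho> \<sigma> a b where "a \<noteq> 0" "b \<noteq> 0" "Qf x \<rho> \<rho> = - 4 * a" "Qf x \<sigma> \<sigma> = - 4 * b"
    "Qf x \<rho> \<sigma> = 0" "omega \<rho> \<sigma> = 0"
proof -
  have z: "Qf x u (\<lambda>p. 0) = 0" "omega u (\<lambda>p. 0) = 0" for u
    unfolding Qf_def omega_def by simp_all
  obtain \<rho> where \<rho>: "Qf x \<rho> \<rho> \<noteq> 0"
    using exists_orthogonal_anisotropic[of "\<lambda>p. 0" "\<lambda>p. 0"] z by blast
  then obtain \<sigma> where \<sigma>: "Qf x \<sigma> \<sigma> \<noteq> 0" "Qf x \<rho> \<sigma> = 0" "omega \<rho> \<sigma> = 0"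
    using exists_orthogonal_anisotropic[of \<rho> "\<lambda>p. 0"] z by blast
  show ?thesis
    by (rule that[of "- Qf x \<rho> \<rho> / 4" "- Qf x \<sigma> \<sigma> / 4" \<rho> \<sigma>]) (use \<rho> \<sigma> four in simp_all)
qed

end

section \<open>Normal forms of trivectors\<close>

text \<open>For q in \<open>D\<close> this sends e_q to e_(q+3) and e_(q+3) to - e_q. The three
  nonempty sets below move e1 e2 e3 to e1 e5 e6, e4 e2 e6 and e4 e5 e3, the trivectors behind the
  diagonal of B, which places the normal form in the span of the orbit.\<close>

definition weyl :: "nat set \<Rightarrow> nat \<Rightarrow> nat \<Rightarrow> 'k::field" where
  "weyl D p q = (if q \<le> 3 then (if q \<in> D then (if p = q + 3 then 1 else 0) else if p = q then 1 else 0)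
     else if q - 3 \<in> D then (if p + 3 = q then - 1 else 0) else if p = q then 1 else 0)"

text \<open>The point \<open>x\<^sub>0 = 1\<close>, \<open>y\<^sub>0 = 0\<close>, \<open>A = 0\<close>, \<open>B = diag(a, b, i / (a b))\<close>.\<close>

definition normal_form :: "'k::field \<Rightarrow> 'k \<times> 'k \<Rightarrow> 'k wedge3" where
  "normal_form i p = (\<lambda>a b c. \<Sum>s<4::nat. [- 1, fst p, snd p, i / (fst p * snd p)] ! s
     * act3 (weyl ([{}, {2, 3}, {1, 3}, {1, 2}] ! s)) e123 a b c)"

lemma minus_3: "4 - 3 = (1::nat)" "5 - 3 = (2::nat)" "6 - 3 = (3::nat)"
  by simp_all

lemma weyl_Sp6:
  assumes "D \<in> {{}, {2, 3}, {1, 3}, {1, 2}}"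
  shows "weyl D \<in> Sp6"
  unfolding Sp6_iff
proof (intro ballI)
  fix a b assume "a \<in> S6" "b \<in> S6"
  with assms show "omega (\<lambda>p. weyl D p a) (\<lambda>p. weyl D p b) = Jsymp a b"
    unfolding set16 omega_eq by (elim insertE emptyE; hypsubst; simp add: weyl_def Jsymp_def minus_3)
qed

lemma tri_e123:
  "tri e123 u v w = u 1 * (v 2 * w 3 - v 3 * w 2) - u 2 * (v 1 * w 3 - v 3 * w 1) + u 3 * (v 1 * w 2 - v 2 * w 1)"
  unfolding tri_nested sum16 e123_def kd_def by (simp add: algebra_simps)

lemma act3_e123:
  assumes "p \<in> S6" "q \<in> S6" "r \<in> S6"
  shows "act3 g e123 p q r = g p 1 * (g q 2 * g r 3 - g q 3 * g r 2)
    - g p 2 * (g q 1 * g r 3 - g q 3 * g r 1) + g p 3 * (g q 1 * g r 2 - g q 2 * g r 1)"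
  unfolding act3_tri[OF assms] tri_e123 ..

lemma sum4: "(\<Sum>s<4::nat. f s) = f 0 + f 1 + f 2 + f 3"
  by (simp add: eval_nat_numeral One_nat_def)

lemma normal_form_Xk: "normal_form i p \<in> Xk"
proof -
  have "\<forall>s<4. \<exists>g\<in>Sp6. act3 (weyl ([{}, {2, 3}, {1, 3}, {1, 2}] ! s)) e123 = act3 g e123"
  proof (intro allI impI)
    fix s :: nat assume "s < 4"
    then have "[{}, {2, 3}, {1, 3}, {1, 2}] ! s \<in> set [{}, {2, 3}, {1, 3}, {1, 2::nat}]"
      by (intro nth_mem) simp
    then have "[{}, {2, 3}, {1, 3}, {1, 2}] ! s \<in> {{}, {2, 3}, {1, 3}, {1, 2::nat}}" by (simp only: list.set)
    then show "\<exists>g\<in>Sp6. act3 (weyl ([{}, {2, 3}, {1, 3}, {1, 2}] ! s)) e123 = act3 g e123"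
      using weyl_Sp6 by blast
  qed
  then show ?thesis unfolding Xk_def normal_form_def
    by (intro CollectI exI[of _ 4] exI[of _ "\<lambda>s. [- 1, fst p, snd p, i / (fst p * snd p)] ! s"]
        exI[of _ "\<lambda>s. act3 (weyl ([{}, {2, 3}, {1, 3}, {1, 2}] ! s)) e123"] conjI refl)
qed

lemma nth4: "[a, b, c, d] ! 0 = a" "[a, b, c, d] ! 1 = b" "[a, b, c, d] ! 2 = c" "[a, b, c, d] ! 3 = d"
  by (simp_all add: eval_nat_numeral One_nat_def)

lemma normal_form_coords:
  fixes i a b :: "'k::field"
  defines "y \<equiv> normal_form i (a, b)"
  shows "y 1 2 3 = - 1" "y 1 2 4 = 0" "y 1 2 5 = 0" "y 1 2 6 = 0" "y 1 3 4 = 0" "y 1 3 5 = 0"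
    "y 1 4 5 = 0" "y 1 4 6 = 0" "y 1 5 6 = a" "y 2 3 4 = 0" "y 2 4 5 = 0"
    "y 2 4 6 = - b" "y 3 4 5 = i / (a * b)" "y 4 5 6 = 0"
  unfolding y_def normal_form_def sum4 nth4
  by (simp_all add: act3_e123 weyl_def)

locale normal_form_point =
  fixes i a b :: "'k::field"
  assumes two': "(2::'k) \<noteq> 0" and i0': "i \<noteq> 0" and a0: "a \<noteq> 0" and b0: "b \<noteq> 0"
begin

sublocale primitive_trivector "normal_form i (a, b)"
  using two' Xk_primitive[OF normal_form_Xk] by unfold_locales

text \<open>With A and y0 zero, only x0 det B remains, and the third diagonal entry i / (a b) was
  chosen to make it i.\<close>

lemma Jq_normal_form: "Jq (normal_form i (a, b)) = i"
  unfolding Jq_def x0c_def y0c_def det3_def Ac_def Bc_def mat3_def adj3_def tr_prod3_def sum3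
  using a0 b0 by (simp add: coords normal_form_coords)

sublocale orbit_point "normal_form i (a, b)" i
  using Jq_normal_form i0' by unfold_locales

lemma normal_form_Ui: "normal_form i (a, b) \<in> Ui i"
  unfolding Ui_def using normal_form_Xk Jq_normal_form by blast

text \<open>The third K-basis vector is the sixth basis vector, not the third: there - Q / 4 takes the value ab,
  whereas on the third it takes \<open>i / (a b)\<close>.\<close>

definition toK :: "(nat \<Rightarrow> 'k) \<Rightarrow> nat \<Rightarrow> 'k \<times> 'k" where
  "toK u j = (if j = 0 then (u 1, - u 4 / a) else if j = 1 then (u 2, - u 5 / b) else (u 6, u 3 / (a * b)))"

definition ofK :: "(nat \<Rightarrow> 'k \<times> 'k) \<Rightarrow> nat \<Rightarrow> 'k" where
  "ofK z p = (if p = 1 then fst (z 0) else if p = 4 then - a * snd (z 0) else if p = 2 then fst (z 1)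
     else if p = 5 then - b * snd (z 1) else if p = 6 then fst (z 2) else a * b * snd (z 2))"

lemma Qf_normal_form: "Qf (normal_form i (a, b)) u v = - 4 * hre i (a, b, a * b) (toK u) (toK v)"
proof -
  have "Qf (normal_form i (a, b)) u v = - 4 * (a * u 1 * v 1 + b * u 2 * v 2 + i / (a * b) * u 3 * v 3
      + b * (i / (a * b)) * u 4 * v 4 + a * (i / (a * b)) * u 5 * v 5 + a * b * u 6 * v 6)"
    unfolding Qf_def sum16 Qmat_sorts Qmat_coords normal_form_coords by (simp add: algebra_simps)
  also have "\<dots> = - 4 * hre i (a, b, a * b) (toK u) (toK v)"
    unfolding hre_def sum3 gam_def toK_def using a0 b0 by (simp add: field_simps)
  finally show ?thesis .
qed

lemma omega_toK: "omega u v = him (a, b, a * b) (toK u) (toK v)"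
  unfolding him_def sum3 gam_def toK_def omega_eq using a0 b0 by (simp add: field_simps)

lemma toK_ofK: "toK (ofK z) 0 = z 0" "toK (ofK z) 1 = z 1" "toK (ofK z) 2 = z 2"
  unfolding toK_def ofK_def using a0 b0 by simp_all

lemma represents_iff:
  "represents i (a, b) p' \<longleftrightarrow> (\<exists>\<rho> \<sigma>. Qf (normal_form i (a, b)) \<rho> \<rho> = - 4 * fst p'
     \<and> Qf (normal_form i (a, b)) \<sigma> \<sigma> = - 4 * snd p' \<and> Qf (normal_form i (a, b)) \<rho> \<sigma> = 0 \<and> omega \<rho> \<sigma> = 0)"
  (is "?L \<longleftrightarrow> ?R")
proof
  assume ?L
  then obtain u v where *: "hre i (a, b, a * b) u u = fst p'" "hre i (a, b, a * b) v v = snd p'"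
      "hre i (a, b, a * b) u v = 0" "him (a, b, a * b) u v = 0"
    unfolding represents_def Let_def fst_conv snd_conv by blast
  have K: "hre i d (toK (ofK u)) (toK (ofK v)) = hre i d u v" "him d (toK (ofK u)) (toK (ofK v)) = him d u v" for d u v
    unfolding hre_def him_def sum3 toK_ofK by (rule refl)+
  show ?R unfolding Qf_normal_form omega_toK
    by (rule exI[of _ "ofK u"], rule exI[of _ "ofK v"]) (simp only: K * mult_zero_right simp_thms)
next
  assume ?R
  then obtain \<rho> \<sigma> where *: "- 4 * hre i (a, b, a * b) (toK \<rho>) (toK \<rho>) = - 4 * fst p'"
     "- 4 * hre i (a, b, a * b) (toK \<sigma>) (toK \<sigma>) = - 4 * snd p'"
     "- 4 * hre i (a, b, a * b) (toK \<rho>) (toK \<sigma>) = 0" "him (a, b, a * b) (toK \<rho>) (toK \<sigma>) = 0"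
    unfolding Qf_normal_form omega_toK by blast
  have c: "- 4 * s = - 4 * t \<longleftrightarrow> s = t" "- 4 * s = 0 \<longleftrightarrow> s = 0" for s t :: 'k
    using four by simp_all
  show ?L unfolding represents_def Let_def fst_conv snd_conv
    by (rule exI[of _ "toK \<rho>"], rule exI[of _ "toK \<sigma>"]) (use * in \<open>simp only: c simp_thms\<close>)
qed

end

text \<open>The fourteen coordinates reached by a normalizing frame mention only i, a and b. The
  choice of vectors disappears, and \<open>primitive_eqI\<close> identifies the result.\<close>

lemma orbit_of_normal_form:
  fixes i :: "'k::field"
  assumes two: "(2::'k) \<noteq> 0" and i0: "i \<noteq> 0" and x: "x \<in> Ui i" and nz: "a \<noteq> 0" "b \<noteq> 0"
    and Q: "Qf x \<rho> \<rho> = - 4 * a" "Qf x \<sigma> \<sigma> = - 4 * b" "Qf x \<rho> \<sigma> = 0" "omega \<rho> \<sigma> = 0"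
  shows "\<exists>g\<in>Sp6. act3 g x = normal_form i (a, b)"
proof -
  interpret orbit_point x i
    using two i0 x Xk_primitive unfolding Ui_def by unfold_locales auto
  obtain h y where h: "h \<in> Sp6" "y = act3 h x" "primitive y" and
    c: "y 1 2 3 = - 1" "y 1 2 4 = 0" "y 1 2 5 = 0" "y 1 2 6 = 0" "y 1 3 4 = 0" "y 1 3 5 = 0"
    "y 1 4 5 = 0" "y 1 4 6 = 0" "y 1 5 6 = a" "y 2 3 4 = 0" "y 2 4 5 = 0"
    "y 2 4 6 = - b" "y 3 4 5 = i / (a * b)" "y 4 5 6 = 0"
    by (rule exists_normalizing_frame[OF nz Q])
  have "y = normal_form i (a, b)"
    by (rule primitive_eqI[OF two h(3) Xk_primitive[OF normal_form_Xk]]) (simp_all only: c normal_form_coords)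
  then have "act3 h x = normal_form i (a, b)" unfolding h(2)[symmetric] .
  then show ?thesis using h(1) by blast
qed

lemma orbit_meets_normal_form:
  fixes i :: "'k::field"
  assumes two: "(2::'k) \<noteq> 0" and i0: "i \<noteq> 0" and x: "x \<in> Ui i"
  shows "\<exists>a b. a \<noteq> 0 \<and> b \<noteq> 0 \<and> (\<exists>g\<in>Sp6. act3 g x = normal_form i (a, b))"
proof -
  interpret orbit_point x i
    using two i0 x Xk_primitive unfolding Ui_def by unfold_locales auto
  show ?thesis
    by (rule exists_orthogonal_pair) (blast intro: orbit_of_normal_form[OF assms])
qed

text \<open>For a symplectic g between the normal forms, its first two rows are the wanted vectors:
  Q on them is read off the second normal form and \<open>omega\<close> off J. Conversely the two
  vectors begin a normalizing frame.\<close>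

lemma normal_form_orbit_iff:
  fixes i :: "'k::field"
  assumes two: "(2::'k) \<noteq> 0" and i0: "i \<noteq> 0" and nz: "a \<noteq> 0" "b \<noteq> 0" "a' \<noteq> 0" "b' \<noteq> 0"
  shows "(\<exists>g\<in>Sp6. act3 g (normal_form i (a, b)) = normal_form i (a', b')) \<longleftrightarrow> represents i (a, b) (a', b')"
proof -
  interpret N: normal_form_point i a b using assms by unfold_locales
  interpret N': normal_form_point i a' b' using assms by unfold_locales
  show ?thesis
  proof
    assume "\<exists>g\<in>Sp6. act3 g (normal_form i (a, b)) = normal_form i (a', b')"
    then obtain g where g: "g \<in> Sp6" "act3 g (normal_form i (a, b)) = normal_form i (a', b')" by blast
    have q: "Qf (normal_form i (a, b)) (g p) (g q) = Qmat (normal_form i (a', b')) p q" if "p \<in> S6" "q \<in> S6" for p q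
      using Qmat_act3[OF g(1) that, of "normal_form i (a, b)"] unfolding g(2) by (rule sym)
    have w: "omega (g 1) (g 2) = 0"
      using g(1) unfolding Sp6_iff_rows by (simp add: Jsymp_def)
    show "represents i (a, b) (a', b')"
      unfolding N.represents_iff
      by (intro exI[of _ "g 1"] exI[of _ "g 2"]) (simp add: q w N'.Qmat_coords normal_form_coords)
  next
    assume "represents i (a, b) (a', b')"
    then obtain \<rho> \<sigma> where "Qf (normal_form i (a, b)) \<rho> \<rho> = - 4 * a'" "Qf (normal_form i (a, b)) \<sigma> \<sigma> = - 4 * b'"
      "Qf (normal_form i (a, b)) \<rho> \<sigma> = 0" "omega \<rho> \<sigma> = 0"
      unfolding N.represents_iff by auto
    then show "\<exists>g\<in>Sp6. act3 g (normal_form i (a, b)) = normal_form i (a', b')"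
      by (rule orbit_of_normal_form[OF two i0 N.normal_form_Ui nz(3,4)])
  qed
qed

lemma equiv_Ui:
  "equiv (Ui i) {(x, y). x \<in> Ui i \<and> y \<in> Ui i \<and> (\<exists>g\<in>Sp6. act3 g x = y)}"
proof -
  \<comment> \<open>\<open>act3\<close> cuts off all coordinates outside \<open>S6\<close>, so the
    identity matrix acts trivially only on trivectors supported there.\<close>
  have out: "x a b c = 0" if x: "x \<in> Ui i" and "\<not> (a \<in> S6 \<and> b \<in> S6 \<and> c \<in> S6)" for x :: "'a wedge3" and a b c
  proof -
    obtain n :: nat and c' v where x: "x = (\<lambda>p q r. \<Sum>s<n. c' s * v s p q r)"
      and v: "\<And>s. s < n \<Longrightarrow> \<exists>g\<in>Sp6. v s = act3 g e123"
      using x unfolding Ui_def Xk_def by blast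
    have "v s a b c = 0" if "s < n" for s
      using v[OF that] act3_outside[OF \<open>\<not> (a \<in> S6 \<and> b \<in> S6 \<and> c \<in> S6)\<close>] by auto
    then show ?thesis unfolding x by simp
  qed
  show ?thesis
  proof (rule equivI)
    show "refl_on (Ui i) {(x, y). x \<in> Ui i \<and> y \<in> Ui i \<and> (\<exists>g\<in>Sp6. act3 g x = y)}"
    proof (rule refl_onI)
      fix x assume x: "x \<in> Ui i"
      have "act3 (\<lambda>a b. if a = b then 1 else 0) x = x"
        by (rule act3_one) (use out[OF x] in blast)+
      then show "(x, x) \<in> {(x, y). x \<in> Ui i \<and> y \<in> Ui i \<and> (\<exists>g\<in>Sp6. act3 g x = y)}"
        using x Sp6_one by blast
    qed
    show "sym {(x, y). x \<in> Ui i \<and> y \<in> Ui i \<and> (\<exists>g\<in>Sp6. act3 g x = y)}"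
    proof (rule symI)
      fix x y assume "(x, y) \<in> {(x, y). x \<in> Ui i \<and> y \<in> Ui i \<and> (\<exists>g\<in>Sp6. act3 g x = y)}"
      then obtain g where g: "x \<in> Ui i" "y \<in> Ui i" "g \<in> Sp6" "act3 g x = y" by blast
      have "act3 (sp_inv g) y = act3 (mmul6 (sp_inv g) g) x"
        unfolding g(4)[symmetric] by (rule act3_mmul6)
      also have "\<dots> = x"
        by (rule act3_one) (use out[OF g(1)] sp_inv_mmul6(2)[OF g(3)] in blast)+
      finally show "(y, x) \<in> {(x, y). x \<in> Ui i \<and> y \<in> Ui i \<and> (\<exists>g\<in>Sp6. act3 g x = y)}"
        using g Sp6_sp_inv by blast
    qed
    show "trans {(x, y). x \<in> Ui i \<and> y \<in> Ui i \<and> (\<exists>g\<in>Sp6. act3 g x = y)}"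
      by (rule transI) (auto simp: act3_mmul6 intro: Sp6_mmul6)
  qed auto
qed

section \<open>The bijections\<close>

lemma param_nonzero: "g \<in> diag_GL3 \<Longrightarrow> fst (param g) \<noteq> 0 \<and> snd (param g) \<noteq> 0"
  unfolding param_def by (simp add: gam_nonzero)

lemma exists_param: "fst p \<noteq> 0 \<Longrightarrow> snd p \<noteq> 0 \<Longrightarrow> \<exists>g\<in>diag_GL3. param g = p"
  by (rule bexI[of _ "(snd p, fst p, 1)"]) (simp_all add: param_def gam_def diag_GL3_def)

text \<open>It makes isomorphism of the Jordan algebras an equivalence relation by transport from
  the octonion side, without composing or inverting Jordan isomorphisms.\<close>

lemma equiv_pullback:
  assumes s: "equiv B s" and F: "\<And>a. a \<in> A \<Longrightarrow> F a \<in> B"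
    and r: "\<And>a a'. (a, a') \<in> r \<longleftrightarrow> a \<in> A \<and> a' \<in> A \<and> (F a, F a') \<in> s"
  shows "equiv A r"
proof (rule equivI)
  show "r \<subseteq> A \<times> A" using r by auto
  show "refl_on A r" using r F s unfolding equiv_def refl_on_def by blast
  show "sym r" using r s unfolding equiv_def sym_def by blast
  show "trans r" using r s unfolding equiv_def trans_def by blast
qed

theorem theorem6p2:
  fixes i :: "'k::field"
  assumes "(2::'k) \<noteq> 0" and "(3::'k) \<noteq> 0" and "i \<noteq> 0"
  shows "(\<exists>f. bij_betw f (H3_classes i) (oct_K_classes i)) \<and>
         (\<exists>f. bij_betw f (H3_classes i) (Ui_orbits i))"
proof -
  note two = assms(1) and i0 = assms(3)
  let ?r = "{(g, g'). g \<in> diag_GL3 \<and> g' \<in> diag_GL3 \<and> H3_iso i g g'}"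
  let ?s = "{(A, A'). A \<in> oct_K i \<and> A' \<in> oct_K i \<and> oct_K_iso A A'}"
  let ?t = "{(x, y). x \<in> Ui i \<and> y \<in> Ui i \<and> (\<exists>g\<in>Sp6. act3 g x = y)}"
  define F where "F g = (cd_mult i (param g), cd_embed :: 'k \<times> 'k \<Rightarrow> 'k ^ 8)" for g
  define G where "G g = normal_form i (param g)" for g
  have H3: "H3_iso i g g' \<longleftrightarrow> represents i (param g') (param g)" if "g \<in> diag_GL3" "g' \<in> diag_GL3" for g g'
    using H3_iso_imp_represents[OF two i0 that] represents_imp_H3_iso[OF that] by blast
  have F: "F g \<in> oct_K i" if "g \<in> diag_GL3" for g
    unfolding F_def using cd_oct_K[OF two i0] param_nonzero[OF that] by blast
  have F_rel: "(g, g') \<in> ?r \<longleftrightarrow> (F g, F g') \<in> ?s" if "g \<in> diag_GL3" "g' \<in> diag_GL3" for g g'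
  proof -
    have "represents i (param g') (param g) \<longleftrightarrow> oct_K_iso (F g) (F g')"
      unfolding F_def using iso_imp_represents[OF two i0] represents_imp_iso[OF two i0]
        param_nonzero[OF that(1)] param_nonzero[OF that(2)] by blast
    then show ?thesis using that F by (simp add: H3)
  qed
  have equiv_r: "equiv diag_GL3 ?r"
    by (rule equiv_pullback[where F = F, OF equiv_oct_K]) (use F F_rel in blast)+
  have F_onto: "\<exists>g\<in>diag_GL3. (F g, A) \<in> ?s" if A: "A \<in> oct_K i" for A
  proof -
    obtain p where p: "fst p \<noteq> 0" "snd p \<noteq> 0" "oct_K_iso (cd_mult i p, cd_embed) A"
      using oct_K_meets_cd_mult[OF two i0 A] by blast
    obtain g where "g \<in> diag_GL3" "param g = p" using exists_param[OF p(1,2)] by blast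
    then show ?thesis using p(3) F[of g] A unfolding F_def by blast
  qed
  have G: "G g \<in> Ui i" if "g \<in> diag_GL3" for g
  proof -
    have "normal_form_point i (fst (param g)) (snd (param g))"
      using two i0 param_nonzero[OF that] by unfold_locales auto
    then show ?thesis unfolding G_def using normal_form_point.normal_form_Ui by fastforce
  qed
  have G_rel: "(g, g') \<in> ?r \<longleftrightarrow> (G g, G g') \<in> ?t" if "g \<in> diag_GL3" "g' \<in> diag_GL3" for g g'
  proof -
    have "represents i (param g') (param g) \<longleftrightarrow> (\<exists>h\<in>Sp6. act3 h (G g') = G g)"
      using normal_form_orbit_iff[OF two i0, of "fst (param g')" "snd (param g')" "fst (param g)" "snd (param g)"]
        param_nonzero[OF that(1)] param_nonzero[OF that(2)] unfolding G_def by simp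
    then have "(g, g') \<in> ?r \<longleftrightarrow> (G g', G g) \<in> ?t" using that G by (simp add: H3)
    \<comment> \<open>\<open>represents\<close> moves the normal form of g' to that of g, the
      opposite of the direction wanted; symmetry of the orbit relation reverses it.\<close>
    also have "\<dots> \<longleftrightarrow> (G g, G g') \<in> ?t"
      using equiv_Ui[of i] unfolding equiv_def by (meson symE)
    finally show ?thesis .
  qed
  have G_onto: "\<exists>g\<in>diag_GL3. (G g, x) \<in> ?t" if x: "x \<in> Ui i" for x
  proof -
    obtain a b where ab: "a \<noteq> 0" "b \<noteq> 0" "\<exists>g\<in>Sp6. act3 g x = normal_form i (a, b)"
      using orbit_meets_normal_form[OF two i0 x] by blast
    obtain g where g: "g \<in> diag_GL3" "param g = (a, b)" using exists_param[of "(a, b)"] ab by auto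
    have "(x, G g) \<in> ?t" using ab(3) x G[OF g(1)] g(2) unfolding G_def by auto
    then have "(G g, x) \<in> ?t" using equiv_Ui[of i] unfolding equiv_def by (meson symE)
    then show ?thesis using g(1) by blast
  qed
  have "\<exists>f. bij_betw f (diag_GL3 // ?r) (oct_K i // ?s)"
    by (rule ex_bij_betw_quotients[OF equiv_r equiv_oct_K F F_rel F_onto])
  moreover have "\<exists>f. bij_betw f (diag_GL3 // ?r) (Ui i // ?t)"
    by (rule ex_bij_betw_quotients[OF equiv_r equiv_Ui G G_rel G_onto])
  ultimately show ?thesis
    unfolding H3_classes_def oct_K_classes_def Ui_orbits_def by blast
qed

end
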